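(* The group $\mathrm{Isom}(Q)$ of all sub-Riemannian isometries of $Q$ is an extension of $\mathrm E_2$ by the two-element group $\mathbb Z/2\mathbb Z$, this two-element group being generated by the isometric involution $\Phi(\mathbf b,\mathbf f)=(\mathbf b,2\mathbf b-\mathbf f)$. Thus $$\mathrm{Isom}(Q)\simeq \mathrm E_2\rtimes\mathbb Z/2\mathbb Z\simeq \mathrm{SE}_2\rtimes(\mathbb Z/2\mathbb Z\times\mathbb Z/2\mathbb Z).$$ The identity component of $\mathrm{Isom}(Q)$ is $\mathrm{SE}_2$, acting freely and transitively on $Q$, and so it induces a sub-Riemannian isometry between $Q$ and a left-invariant sub-Riemannian metric on $\mathrm{SE}_2$.
   Context: Fix $\ell>0$. $Q=\{(\mathbf b,\mathbf f)\in\mathbb R^2\times\mathbb R^2:\|\mathbf f-\mathbf b\|=\ell\}$ is the bicycle configuration space, a smooth 3-manifold. The rank 2 distribution $D\subset TQ$ (no-skid condition) is defined by: $(\dot{\mathbf b},\dot{\mathbf f})\in T_{(\mathbf b,\mathbf f)}Q$ belongs to $D_{(\mathbf b,\mathbf f)}$ if and only if $\dot{\mathbf b}$ is a multiple of $\mathbf f-\mathbf b$. $D$ carries the inner product $\langle(\dot{\mathbf b},\dot{\mathbf f}),(\dot{\mathbf b}',\dot{\mathbf f}')\rangle=\dot{\mathbf f}\cdot\dot{\mathbf f}'$. A sub-Riemannian isometry of $Q$ is a diffeomorphism of $Q$ that preserves $D$ and the inner product on it. $\mathrm E_2$ is the group of isometries of the Euclidean plane $\mathbb R^2$ and $\mathrm{SE}_2\subset\mathrm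 E_2$ the subgroup of orientation preserving ones; $g\in\mathrm E_2$ acts on $Q$ by sub-Riemannian isometries $(\mathbf b,\mathbf f)\mapsto(g\mathbf b,g\mathbf f)$, and in this way $\mathrm{SE}_2\subset\mathrm E_2\subset\mathrm{Isom}(Q)$. For a fixed $\mathbf q_0\in Q$, $\mathrm{SE}_2$ is identified with $Q$ via $g\mapsto g\mathbf q_0$. *)

theory Defs
  imports "HOL-Analysis.Analysis" "HOL-Algebra.Elementary_Groups" "HOL-Algebra.Group_Action"
begin

section \<open>Smooth maps between subsets of Euclidean spaces\<close>

text \<open>\<open>C_on k U f\<close>: the map \<open>f\<close> is of class \<open>C\<^sup>k\<close> on the open set \<open>U\<close>. In finite dimension this
  amounts to iterated directional derivatives existing (as Frechet derivatives) and being
  continuous.\<close>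

primrec C_on :: "nat \<Rightarrow> 'a::euclidean_space set \<Rightarrow> ('a \<Rightarrow> 'b::euclidean_space) \<Rightarrow> bool" where
  "C_on 0 U f \<longleftrightarrow> continuous_on U f"
| "C_on (Suc k) U f \<longleftrightarrow>
     (\<forall>x\<in>U. f differentiable (at x)) \<and> (\<forall>v. C_on k U (\<lambda>x. frechet_derivative f (at x) v))"

definition smooth_on :: "'a::euclidean_space set \<Rightarrow> ('a \<Rightarrow> 'b::euclidean_space) \<Rightarrow> bool" where
  "smooth_on U f \<longleftrightarrow> open U \<and> (\<forall>k. C_on k U f)"

text \<open>Manifolds are embedded submanifolds of Euclidean spaces: a map on one is smooth iff it
  extends locally to a smooth map of the ambient space.\<close>

definition smooth_map :: "'a::euclidean_space set \<Rightarrow> ('a \<Rightarrow> 'b::euclidean_space) \<Rightarrow> bool" where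
  "smooth_map M F \<longleftrightarrow>
     (\<forall>x\<in>M. \<exists>U G. x \<in> U \<and> smooth_on U G \<and> (\<forall>y\<in>U \<inter> M. F y = G y))"

definition diffeo :: "'a::euclidean_space set \<Rightarrow> 'b::euclidean_space set \<Rightarrow> ('a \<Rightarrow> 'b) \<Rightarrow> bool" where
  "diffeo M N F \<longleftrightarrow> bij_betw F M N \<and> smooth_map M F \<and> smooth_map N (inv_into M F)"

definition tangent_space :: "'a::euclidean_space set \<Rightarrow> 'a \<Rightarrow> 'a set" where
  "tangent_space M x =
     {v. \<exists>\<gamma> e. e > 0 \<and> smooth_on {-e<..<e} \<gamma> \<and> \<gamma> ` {-e<..<e} \<subseteq> M \<and> \<gamma> (0::real) = x \<and>
           (\<gamma> has_vector_derivative v) (at 0)}"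


section \<open>Sub-Riemannian structures\<close>

text \<open>The inner product \<open>met S x\<close> is only meaningful on the fibre \<open>distr S x\<close>.\<close>

record 'a sub_riem =
  pts :: "'a set"
  distr :: "'a \<Rightarrow> 'a set"
  met :: "'a \<Rightarrow> 'a \<Rightarrow> 'a \<Rightarrow> real"

text \<open>A smooth distribution of rank \<open>r\<close> together with a smooth inner product on its fibres;
  smoothness is tested on local frames.\<close>

definition sub_riemannian :: "nat \<Rightarrow> 'a::euclidean_space sub_riem \<Rightarrow> bool" where
  "sub_riemannian r S \<longleftrightarrow>
     (\<forall>x\<in>pts S. subspace (distr S x) \<and> dim (distr S x) = r \<and>
        distr S x \<subseteq> tangent_space (pts S) x) \<and>
     (\<forall>x\<in>pts S. \<forall>u\<in>distr S x. \<forall>v\<in>distr S x. \<forall>w\<in>distr S x. \<forall>a b.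
        met S x u v = met S x v u \<and>
        met S x (a *\<^sub>R u + b *\<^sub>R v) w = a * met S x u w + b * met S x v w \<and>
        (u \<noteq> 0 \<longrightarrow> met S x u u > 0)) \<and>
     (\<forall>x\<in>pts S. \<exists>U (X :: nat \<Rightarrow> 'a \<Rightarrow> 'a). open U \<and> x \<in> U \<and>
        (\<forall>i<r. smooth_map (U \<inter> pts S) (X i)) \<and>
        (\<forall>y\<in>U \<inter> pts S. distr S y = span ((\<lambda>i. X i y) ` {..<r})) \<and>
        (\<forall>i<r. \<forall>j<r. smooth_map (U \<inter> pts S) (\<lambda>y. met S y (X i y) (X j y))))"

text \<open>A derivative \<open>F'\<close> of \<open>F\<close> within \<open>pts S\<close> is a linear map of the ambient space which is
  determined on tangent vectors, where it is the differential of \<open>F\<close>; only its values on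
  \<open>distr S x\<close> enter.\<close>

definition sr_isometry ::
    "'a::euclidean_space sub_riem \<Rightarrow> 'b::euclidean_space sub_riem \<Rightarrow> ('a \<Rightarrow> 'b) \<Rightarrow> bool" where
  "sr_isometry S T F \<longleftrightarrow>
     diffeo (pts S) (pts T) F \<and>
     (\<forall>x\<in>pts S. \<exists>F'. (F has_derivative F') (at x within pts S) \<and>
        F' ` distr S x = distr T (F x) \<and>
        (\<forall>u\<in>distr S x. \<forall>v\<in>distr S x. met T (F x) (F' u) (F' v) = met S x u v))"


section \<open>The bicycle configuration space and its isometry group\<close>

type_synonym plane = "real^2"

text \<open>A configuration is a pair \<open>(b, f)\<close> of the back and front wheel positions.\<close>

definition Q :: "real \<Rightarrow> (plane \<times> plane) set" where
  "Q l = {(b, f). norm (f - b) = l}"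

definition bicycle :: "real \<Rightarrow> (plane \<times> plane) sub_riem" where
  "bicycle l =
     \<lparr>pts = Q l,
      distr = (\<lambda>q. {v \<in> tangent_space (Q l) q. \<exists>c. fst v = c *\<^sub>R (snd q - fst q)}),
      met = (\<lambda>q v w. snd v \<bullet> snd w)\<rparr>"

text \<open>Self-maps of \<open>Q l\<close> are taken extensional, as in \<^const>\<open>BijGroup\<close>, so that each has a unique
  representative.\<close>

definition IsomQ :: "real \<Rightarrow> (plane \<times> plane \<Rightarrow> plane \<times> plane) monoid" where
  "IsomQ l = (BijGroup (Q l))\<lparr>carrier :=
     {F \<in> extensional (Q l). sr_isometry (bicycle l) (bicycle l) F}\<rparr>"

definition Phi :: "real \<Rightarrow> plane \<times> plane \<Rightarrow> plane \<times> plane" where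
  "Phi l = (\<lambda>(b, f)\<in>Q l. (b, 2 *\<^sub>R b - f))"

definition compact_open :: "'a::topological_space set \<Rightarrow> ('a \<Rightarrow> 'a) set \<Rightarrow> ('a \<Rightarrow> 'a) topology" where
  "compact_open M \<F> =
     topology_generated_by {{F \<in> \<F>. F ` K \<subseteq> U} | K U. compact K \<and> K \<subseteq> M \<and> openin (top_of_set M) U}"


section \<open>Euclidean motions of the plane\<close>

definition rigid :: "(real^2^2) \<times> plane \<Rightarrow> plane \<Rightarrow> plane" where
  "rigid p = (\<lambda>x. fst p *v x + snd p)"

definition E2 :: "(plane \<Rightarrow> plane) monoid" where
  "E2 = (BijGroup UNIV)\<lparr>carrier := {g. bij g \<and> (\<forall>x y. dist (g x) (g y) = dist x y)}\<rparr>"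

definition SE2 :: "(plane \<Rightarrow> plane) monoid" where
  "SE2 = E2\<lparr>carrier := {g \<in> carrier E2. \<exists>p. g = rigid p \<and> det (fst p) > 0}\<rparr>"

definition act :: "real \<Rightarrow> (plane \<Rightarrow> plane) \<Rightarrow> plane \<times> plane \<Rightarrow> plane \<times> plane" where
  "act l g = (\<lambda>(b, f)\<in>Q l. (g b, g f))"

text \<open>The Lie group \<^const>\<open>SE2\<close> as a submanifold of the space of pairs (linear part, translation
  part). Since \<^const>\<open>rigid\<close> is injective, \<open>motion_coords\<close> recovers these parts.\<close>

definition motion_coords :: "(plane \<Rightarrow> plane) \<Rightarrow> (real^2^2) \<times> plane" where
  "motion_coords = inv_into UNIV rigid"

definition SE2_mfd :: "((real^2^2) \<times> plane) set" where
  "SE2_mfd = {p. rigid p \<in> carrier SE2}"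

definition left_invariant :: "((real^2^2) \<times> plane) sub_riem \<Rightarrow> bool" where
  "left_invariant S \<longleftrightarrow> pts S = SE2_mfd \<and>
     (\<forall>g\<in>carrier SE2. sr_isometry S S (\<lambda>p. motion_coords (g \<circ> rigid p)))"


section \<open>Extensions and semidirect products of groups\<close>

definition group_extension ::
    "('a, 'm) monoid_scheme \<Rightarrow> ('b, 'n) monoid_scheme \<Rightarrow> ('c, 'k) monoid_scheme \<Rightarrow>
     ('a \<Rightarrow> 'b) \<Rightarrow> ('b \<Rightarrow> 'c) \<Rightarrow> bool" where
  "group_extension N G H i p \<longleftrightarrow>
     group N \<and> group G \<and> group H \<and> i \<in> mon N G \<and> p \<in> epi G H \<and> kernel G H p = i ` carrier N"

definition semidirect ::
    "('a, 'm) monoid_scheme \<Rightarrow> ('b, 'n) monoid_scheme \<Rightarrow> ('b \<Rightarrow> 'a \<Rightarrow> 'a) \<Rightarrow> ('a \<times> 'b) monoid" where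
  "semidirect N H \<theta> =
     \<lparr>carrier = carrier N \<times> carrier H,
      monoid.mult = (\<lambda>(n, h) (n', h'). (n \<otimes>\<^bsub>N\<^esub> \<theta> h n', h \<otimes>\<^bsub>H\<^esub> h')),
      one = (\<one>\<^bsub>N\<^esub>, \<one>\<^bsub>H\<^esub>)\<rparr>"

abbreviation Z2 :: "int monoid" where
  "Z2 \<equiv> integer_mod_group 2"

end

theory Submission
  imports Defs
begin

text \<open>In terms of the unit vector \<open>e\<close> from the back to the front wheel and its rotation \<open>n\<close> by a right
  angle, \<open>D\<close> has the orthonormal frame \<open>X1 = (e, e)\<close>, \<open>X2 = (0, n)\<close>, and with
  \<open>X0 = [X1, X2] = - (n, n) / l\<close> one has \<open>[X1, X0] = 0\<close> and \<open>[X2, X0] = X1 / l\<^sup>2\<close>. So the bracket with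
  the transversal field \<open>X0\<close> distinguishes \<open>X1\<close> from all other horizontal directions: writing
  \<open>F\<^sub>* X1 = a X1 + b X2\<close> and \<open>F\<^sub>* X2 = \<epsilon> (- b X1 + a X2)\<close> for an isometry \<open>F\<close> and comparing
  brackets forces \<open>b = 0\<close>, so \<open>a\<close> and \<open>\<epsilon>\<close> are constant signs. The differential
  of \<open>F\<close> then agrees with that of a Euclidean motion (\<open>a = 1\<close>) or of a motion followed by
  \<^const>\<open>Phi\<close> (\<open>a = -1\<close>), and \<open>F\<close> itself agrees with such a map because the three fields span the
  tangent spaces of the connected manifold \<^const>\<open>Q\<close>. All three fields are linear on the ambient space,
  so the brackets reduce to commutators of linear maps and the symmetry of second derivatives.\<close>

section \<open>Smooth maps\<close>

text \<open>A push-forward of vector fields is never formed. An isometry \<open>F\<close> is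
  recorded by two plane-valued functions on \<open>Q l\<close>, the front wheel \<open>u\<close> and
  the unit heading \<open>E\<close> of the image; the image of the back wheel is
  \<open>u - l E\<close>. The no-skid condition at the image point expresses the derivatives of
  \<open>E\<close> along \<open>X1\<close> and \<open>X2\<close> through those of \<open>u\<close>,
  so one 2 x 2 matrix of coefficients governs both. The bracket relations, applied to
  \<open>u\<close> and to \<open>E\<close>, give an overdetermined system for this matrix, some
  combinations of which contain no derivatives. Since \<open>Q l\<close> has no interior, a
  derivative within it is determined only on tangent vectors, and second derivatives are taken of
  local ambient extensions. The group theory rests on one observation: \<open>Phi\<close> commutes
  with every Euclidean motion, because affine maps preserve point reflections. Thus
  \<open>Isom(Q)\<close> is the direct product of \<open>E2\<close> and \<open>Z2\<close>, the two
  extensions come from its two projections, and only the reflection inside \<open>E2\<close> acts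
  nontrivially in the second semidirect product.\<close>

lemma C_on_imp_continuous_on: "C_on k U f \<Longrightarrow> continuous_on U f"
  by (cases k) (auto intro!: differentiable_imp_continuous_on
      simp: differentiable_on_def differentiable_at_withinI)

lemma C_on_Suc_imp: "C_on (Suc k) U f \<Longrightarrow> C_on k U f"
proof (induction k arbitrary: f)
  case 0
  then show ?case using C_on_imp_continuous_on[OF 0] by simp
next
  case (Suc k)
  then show ?case by (metis C_on.simps(2))
qed

text \<open>Differentiability is known only on \<open>U\<close>, so the sum, product and chain rules
  for \<open>frechet_derivative\<close> are formulas valid at points of \<open>U\<close>. This
  transfer substitutes them under \<open>C_on\<close>; openness makes a derivative at a point of
  \<open>U\<close> depend only on values in \<open>U\<close>.\<close>

lemma C_on_cong:
  assumes "open U" "\<And>x. x \<in> U \<Longrightarrow> f x = g x" "C_on k U f"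
  shows "C_on k U g"
  using assms(2,3)
proof (induction k arbitrary: f g)
  case 0
  then show ?case by (metis C_on.simps(1) continuous_on_cong)
next
  case (Suc k)
  have d: "g differentiable at x" if "x \<in> U" for x
    using Suc.prems that \<open>open U\<close> unfolding C_on.simps differentiable_def
    by (meson has_derivative_transform_within_open)
  have "frechet_derivative f (at x) v = frechet_derivative g (at x) v" if "x \<in> U" for x v
    using frechet_derivative_transform_within_open[of f x U g] Suc.prems that \<open>open U\<close> by simp
  then have "C_on k U (\<lambda>x. frechet_derivative g (at x) v)" for v
    using Suc.IH[of "\<lambda>x. frechet_derivative f (at x) v"] Suc.prems by simp
  then show ?case using d by simp
qed

lemma C_on_subset:
  assumes "C_on k U f" "V \<subseteq> U"
  shows "C_on k V f"
  using assms(1)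
proof (induction k arbitrary: f)
  case 0
  then show ?case using assms(2) by (auto intro: continuous_on_subset)
qed (use assms(2) in auto)

lemma C_on_const: "C_on k U (\<lambda>x. c)"
  by (induction k arbitrary: c) auto

lemma C_on_add:
  assumes "open U" "C_on k U f" "C_on k U g"
  shows "C_on k U (\<lambda>x. f x + g x)"
  using assms(2,3)
proof (induction k arbitrary: f g)
  case 0
  then show ?case by (auto intro: continuous_intros)
next
  case (Suc k)
  have fd: "((\<lambda>x. f x + g x) has_derivative
      (\<lambda>v. frechet_derivative f (at x) v + frechet_derivative g (at x) v)) (at x)" if "x \<in> U" for x
    using Suc.prems that by (auto intro!: has_derivative_add simp flip: frechet_derivative_works)
  have fr: "frechet_derivative (\<lambda>x. f x + g x) (at x) =
      (\<lambda>v. frechet_derivative f (at x) v + frechet_derivative g (at x) v)" if "x \<in> U" for x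
    using frechet_derivative_at[OF fd[OF that], symmetric] .
  have "C_on k U (\<lambda>x. frechet_derivative (\<lambda>x. f x + g x) (at x) v)" for v
    by (rule C_on_cong[OF \<open>open U\<close> _ Suc.IH]) (use fr Suc.prems in auto)
  then show ?case using fd by (auto simp: differentiable_def)
qed

lemma C_on_bounded_linear:
  assumes "open U" "bounded_linear T" "C_on k U f"
  shows "C_on k U (\<lambda>x. T (f x))"
  using assms(3)
proof (induction k arbitrary: f)
  case 0
  then show ?case using bounded_linear.continuous_on[OF assms(2)] by auto
next
  case (Suc k)
  have fd: "((\<lambda>x. T (f x)) has_derivative (\<lambda>v. T (frechet_derivative f (at x) v))) (at x)"
    if "x \<in> U" for x
    using Suc.prems that by (intro bounded_linear.has_derivative[OF assms(2)])
      (simp flip: frechet_derivative_works)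
  have fr: "frechet_derivative (\<lambda>x. T (f x)) (at x) = (\<lambda>v. T (frechet_derivative f (at x) v))"
    if "x \<in> U" for x
    using frechet_derivative_at[OF fd[OF that], symmetric] .
  have "C_on k U (\<lambda>x. frechet_derivative (\<lambda>x. T (f x)) (at x) v)" for v
    by (rule C_on_cong[OF \<open>open U\<close> _ Suc.IH]) (use fr Suc.prems in auto)
  then show ?case using fd by (auto simp: differentiable_def)
qed

lemma C_on_bounded_bilinear:
  assumes "open U" "bounded_bilinear T" "C_on k U f" "C_on k U g"
  shows "C_on k U (\<lambda>x. T (f x) (g x))"
  using assms(3,4)
proof (induction k arbitrary: f g)
  case 0
  then show ?case using bounded_bilinear.continuous_on[OF assms(2)] by auto
next
  case (Suc k)
  have fd: "((\<lambda>x. T (f x) (g x)) has_derivative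
      (\<lambda>v. T (f x) (frechet_derivative g (at x) v) + T (frechet_derivative f (at x) v) (g x))) (at x)"
    if "x \<in> U" for x
    using Suc.prems that by (auto intro!: bounded_bilinear.FDERIV[OF assms(2)]
        simp flip: frechet_derivative_works)
  have fr: "frechet_derivative (\<lambda>x. T (f x) (g x)) (at x) =
      (\<lambda>v. T (f x) (frechet_derivative g (at x) v) + T (frechet_derivative f (at x) v) (g x))"
    if "x \<in> U" for x
    using frechet_derivative_at[OF fd[OF that], symmetric] .
  have "C_on k U (\<lambda>x. frechet_derivative (\<lambda>x. T (f x) (g x)) (at x) v)" for v
  proof (rule C_on_cong[OF \<open>open U\<close>])
    \<comment> \<open>The product rule brings back \<open>f\<close> and \<open>g\<close>
      undifferentiated, so their regularity is lowered from order \<open>Suc k\<close> to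
      \<open>k\<close>.\<close>
    show "C_on k U (\<lambda>x. T (f x) (frechet_derivative g (at x) v) + T (frechet_derivative f (at x) v) (g x))"
      using Suc.prems C_on_Suc_imp[OF Suc.prems(1)] C_on_Suc_imp[OF Suc.prems(2)]
      by (intro C_on_add[OF \<open>open U\<close>] Suc.IH) auto
  qed (use fr in simp)
  then show ?case using fd by (auto simp: differentiable_def)
qed

lemma C_on_linear: "bounded_linear T \<Longrightarrow> open U \<Longrightarrow> C_on k U T"
proof (cases k)
  case (Suc n)
  assume "bounded_linear T" "open U"
  then have "(T has_derivative T) (at x)" for x
    by (simp add: bounded_linear_imp_has_derivative)
  then have "frechet_derivative T (at x) = T" "T differentiable at x" for x
    by (auto simp: differentiable_def intro: frechet_derivative_at[symmetric])
  then show ?thesis by (simp add: Suc C_on_const)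
qed (auto simp: linear_continuous_on)

lemma C_on_sum:
  assumes "open U" "finite I" "\<And>i. i \<in> I \<Longrightarrow> C_on k U (f i)"
  shows "C_on k U (\<lambda>x. \<Sum>i\<in>I. f i x)"
  using assms(2,3) by (induction rule: finite_induct) (auto intro: C_on_add[OF assms(1)] C_on_const)

text \<open>\<open>C_on\<close> speaks of derivatives in constant directions only. A variable
  direction \<open>X x\<close> is expanded in the basis, which leaves constant-direction derivatives
  with coefficients as regular as \<open>X\<close>.\<close>

lemma C_on_directional_derivative:
  assumes "open U" "C_on (Suc k) U f" "C_on k U X"
  shows "C_on k U (\<lambda>x. frechet_derivative f (at x) (X x))"
proof (rule C_on_cong[OF assms(1)])
  show "C_on k U (\<lambda>x. \<Sum>i\<in>Basis. (X x \<bullet> i) *\<^sub>R frechet_derivative f (at x) i)"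
    using assms(2) by (intro C_on_sum[OF assms(1)] C_on_bounded_bilinear[OF assms(1) bounded_bilinear_scaleR]
      C_on_bounded_linear[OF assms(1) bounded_linear_inner_left] assms(3)) auto
next
  fix x assume "x \<in> U"
  then have l: "linear (frechet_derivative f (at x))"
    using assms(2) linear_frechet_derivative by auto
  show "(\<Sum>i\<in>Basis. (X x \<bullet> i) *\<^sub>R frechet_derivative f (at x) i) = frechet_derivative f (at x) (X x)"
    by (subst (2) euclidean_representation[of "X x", symmetric])
      (simp add: linear_sum[OF l] linear_cmul[OF l])
qed

text \<open>The second difference over a parallelogram is symmetric in \<open>v\<close> and
  \<open>w\<close>, which makes its limit useful. Two applications of the mean value theorem, first
  in direction \<open>v\<close> and then in direction \<open>w\<close>, turn the quotient into the
  mixed derivative at an intermediate point; continuity at \<open>x\<close> does the rest.\<close>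

lemma second_difference_tendsto:
  fixes g :: "'a::euclidean_space \<Rightarrow> real"
  assumes "open U" "x \<in> U" "C_on 2 U g"
  shows "((\<lambda>t. (g (x + t *\<^sub>R v + t *\<^sub>R w) - g (x + t *\<^sub>R v) - g (x + t *\<^sub>R w) + g x) / t\<^sup>2)
    \<longlongrightarrow> frechet_derivative (\<lambda>y. frechet_derivative g (at y) v) (at x) w) (at_right 0)"
    (is "(?q \<longlongrightarrow> _) _")
proof -
  define g1 where "g1 y = frechet_derivative g (at y) v" for y
  define H where "H y = frechet_derivative g1 (at y) w" for y
  have g: "(g has_derivative frechet_derivative g (at y)) (at y)" if "y \<in> U" for y
    using assms that by (simp add: numeral_2_eq_2 flip: frechet_derivative_works)
  have g1: "(g1 has_derivative frechet_derivative g1 (at y)) (at y)" if "y \<in> U" for y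
    using assms that by (simp add: numeral_2_eq_2 g1_def[abs_def] flip: frechet_derivative_works)
  have H: "continuous_on U H"
    using assms by (simp add: numeral_2_eq_2 g1_def[abs_def] H_def[abs_def])
  show ?thesis unfolding g1_def[symmetric] H_def[symmetric]
  proof (rule tendstoI)
    fix e :: real assume "e > 0"
    have "isCont H x" using H assms continuous_on_eq_continuous_at by blast
    then obtain d where d: "d > 0" "\<And>y. dist y x < d \<Longrightarrow> dist (H y) (H x) < e"
      using \<open>e > 0\<close> unfolding continuous_at_eps_delta by blast
    obtain d' where d': "d' > 0" "ball x d' \<subseteq> U" using assms openE by blast
    \<comment> \<open>Small enough for the parallelogram with sides \<open>r v\<close> and
      \<open>r w\<close> to stay in both balls; the summand 1 avoids a division by zero when
      \<open>v = w = 0\<close>.\<close>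
    define r where "r = min d d' / (norm v + norm w + 1)"
    have r: "r > 0" using d(1) d'(1) unfolding r_def
      by (intro divide_pos_pos) (auto simp: add_nonneg_pos)
    have near: "dist (x + s *\<^sub>R v + t *\<^sub>R w) x < min d d'"
      if "0 \<le> s" "s < r" "0 \<le> t" "t < r" for s t
    proof -
      have "dist (x + s *\<^sub>R v + t *\<^sub>R w) x \<le> s * norm v + t * norm w"
        using norm_triangle_ineq[of "s *\<^sub>R v" "t *\<^sub>R w"] that by (simp add: dist_norm add.assoc)
      also have "\<dots> \<le> r * norm v + r * norm w"
        using that by (intro add_mono mult_right_mono) auto
      also have "\<dots> < r * (norm v + norm w + 1)" using r by (simp add: algebra_simps)
      also have "\<dots> = min d d'" unfolding r_def
        by (smt (verit) nonzero_eq_divide_eq norm_ge_zero)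
      finally show ?thesis .
    qed
    have inU: "x + s *\<^sub>R v + t *\<^sub>R w \<in> U" if "0 \<le> s" "s < r" "0 \<le> t" "t < r" for s t
      using near[OF that] d' by (auto simp: dist_commute)
    have "dist (?q t) (H x) < e" if t: "0 < t" "t < r" for t
    proof -
      have 1: "((\<lambda>s. g (x + s *\<^sub>R v + t *\<^sub>R w) - g (x + s *\<^sub>R v)) has_derivative
          (\<lambda>h. h * (g1 (x + s *\<^sub>R v + t *\<^sub>R w) - g1 (x + s *\<^sub>R v)))) (at s within {0..t})"
        if s: "0 \<le> s" "s \<le> t" for s
      proof -
        have a: "((\<lambda>s. g (x + s *\<^sub>R v + c)) has_derivative (\<lambda>h. h * g1 (x + s *\<^sub>R v + c))) (at s within {0..t})"
          if "x + s *\<^sub>R v + c \<in> U" for c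
        proof -
          have "((\<lambda>s. x + s *\<^sub>R v + c) has_derivative (\<lambda>h. h *\<^sub>R v)) (at s within {0..t})"
            by (auto intro!: derivative_eq_intros)
          from has_derivative_compose[OF this g[OF that]]
          show ?thesis using linear_cmul[OF has_derivative_linear[OF g[OF that]]] by (simp add: g1_def)
        qed
        show ?thesis
          using has_derivative_diff[OF a[of "t *\<^sub>R w"] a[of 0]] inU[of s t] inU[of s 0] s t
          by (simp add: algebra_simps)
      qed
      obtain s where s: "0 < s" "s < t" "(g (x + t *\<^sub>R v + t *\<^sub>R w) - g (x + t *\<^sub>R v)) - (g (x + t *\<^sub>R w) - g x)
          = t * (g1 (x + s *\<^sub>R v + t *\<^sub>R w) - g1 (x + s *\<^sub>R v))"
        using mvt_simple[OF t(1) 1] t by auto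
      have 2: "((\<lambda>\<tau>. g1 (x + s *\<^sub>R v + \<tau> *\<^sub>R w)) has_derivative
          (\<lambda>h. h * H (x + s *\<^sub>R v + \<tau> *\<^sub>R w))) (at \<tau> within {0..t})" if \<tau>: "0 \<le> \<tau>" "\<tau> \<le> t" for \<tau>
      proof -
        have i: "x + s *\<^sub>R v + \<tau> *\<^sub>R w \<in> U" using inU[of s \<tau>] s t \<tau> by auto
        have "((\<lambda>\<tau>. x + s *\<^sub>R v + \<tau> *\<^sub>R w) has_derivative (\<lambda>h. h *\<^sub>R w)) (at \<tau> within {0..t})"
          by (auto intro!: derivative_eq_intros)
        from has_derivative_compose[OF this g1[OF i]]
        show ?thesis using linear_cmul[OF has_derivative_linear[OF g1[OF i]]] by (simp add: H_def)
      qed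
      obtain \<tau> where \<tau>: "0 < \<tau>" "\<tau> < t" "g1 (x + s *\<^sub>R v + t *\<^sub>R w) - g1 (x + s *\<^sub>R v)
          = t * H (x + s *\<^sub>R v + \<tau> *\<^sub>R w)"
        using mvt_simple[OF t(1) 2] by auto
      have "?q t = H (x + s *\<^sub>R v + \<tau> *\<^sub>R w)"
        using s(3) \<tau>(3) t by (simp add: power2_eq_square divide_simps) (simp add: algebra_simps)
      then show ?thesis using d(2) near[of s \<tau>] s \<tau> t by auto
    qed
    then show "\<forall>\<^sub>F t in at_right 0. dist (?q t) (H x) < e"
      unfolding eventually_at_right_field using r by auto
  qed
qed

text \<open>The mean value theorem is scalar, hence the passage to components. Both orders of
  differentiation are limits of the same symmetric difference quotient.\<close>

lemma second_derivative_symmetric: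
  fixes G :: "'a::euclidean_space \<Rightarrow> 'b::euclidean_space"
  assumes "open U" "x \<in> U" "C_on 2 U G"
  shows "frechet_derivative (\<lambda>y. frechet_derivative G (at y) v) (at x) w
       = frechet_derivative (\<lambda>y. frechet_derivative G (at y) w) (at x) v"
proof (rule euclidean_eqI)
  fix c :: 'b assume "c \<in> Basis"
  define g where "g y = G y \<bullet> c" for y
  have C: "C_on 2 U g" unfolding g_def[abs_def]
    by (rule C_on_bounded_linear[OF assms(1) bounded_linear_inner_left assms(3)])
  have d1: "frechet_derivative g (at y) v = frechet_derivative G (at y) v \<bullet> c" if "y \<in> U" for y v
  proof -
    have "(G has_derivative frechet_derivative G (at y)) (at y)"
      using assms(3) that by (simp add: numeral_2_eq_2 flip: frechet_derivative_works)
    from frechet_derivative_at[OF has_derivative_inner_left[OF this, of c]]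
    show ?thesis unfolding g_def[abs_def] by (simp add: fun_eq_iff)
  qed
  have d2: "frechet_derivative (\<lambda>y. frechet_derivative g (at y) v) (at x) w
     = frechet_derivative (\<lambda>y. frechet_derivative G (at y) v) (at x) w \<bullet> c" for v w
  proof -
    have "((\<lambda>y. frechet_derivative G (at y) v) has_derivative
        frechet_derivative (\<lambda>y. frechet_derivative G (at y) v) (at x)) (at x)"
      using assms by (simp add: numeral_2_eq_2 flip: frechet_derivative_works)
    from frechet_derivative_at[OF has_derivative_transform_within_open[OF
        has_derivative_inner_left[OF this, of c] assms(1,2) d1[symmetric]]]
    show ?thesis by (simp add: fun_eq_iff)
  qed
  have "frechet_derivative (\<lambda>y. frechet_derivative g (at y) v) (at x) w
      = frechet_derivative (\<lambda>y. frechet_derivative g (at y) w) (at x) v"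
    using tendsto_unique[OF _ second_difference_tendsto[OF assms(1,2) C, of v w]]
      second_difference_tendsto[OF assms(1,2) C, of w v] by (simp add: algebra_simps)
  then show "frechet_derivative (\<lambda>y. frechet_derivative G (at y) v) (at x) w \<bullet> c
       = frechet_derivative (\<lambda>y. frechet_derivative G (at y) w) (at x) v \<bullet> c"
    by (simp add: d2)
qed

section \<open>Smooth maps on subsets of Euclidean space\<close>

lemma smooth_onD: "smooth_on U f \<Longrightarrow> open U" "smooth_on U f \<Longrightarrow> C_on k U f"
  by (auto simp: smooth_on_def)

lemma smooth_mapD:
  assumes "smooth_map M F" "x \<in> M"
  shows "\<exists>U G. open U \<and> x \<in> U \<and> smooth_on U G \<and> (\<forall>y. y \<in> U \<longrightarrow> y \<in> M \<longrightarrow> F y = G y)"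
  using assms unfolding smooth_map_def by (meson IntI smooth_onD(1))

lemma smooth_mapI:
  assumes "\<And>x. x \<in> M \<Longrightarrow> \<exists>U G. x \<in> U \<and> smooth_on U G \<and> (\<forall>y\<in>U \<inter> M. F y = G y)"
  shows "smooth_map M F"
  using assms by (simp add: smooth_map_def)

lemma smooth_map_cong:
  assumes "\<And>x. x \<in> M \<Longrightarrow> f x = g x" "smooth_map M f"
  shows "smooth_map M g"
  using assms unfolding smooth_map_def by (metis IntD2)

lemma smooth_map_linear: "bounded_linear T \<Longrightarrow> smooth_map M T"
  unfolding smooth_map_def smooth_on_def using C_on_linear by blast

lemma smooth_map_const: "smooth_map M (\<lambda>x. c)"
  unfolding smooth_map_def smooth_on_def using C_on_const by blast

lemma smooth_map_bounded_linear:
  assumes "bounded_linear T" "smooth_map M f"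
  shows "smooth_map M (\<lambda>x. T (f x))"
proof (rule smooth_mapI)
  fix x assume "x \<in> M"
  obtain U G where U: "open U" "x \<in> U" "smooth_on U G" "\<And>y. y \<in> U \<Longrightarrow> y \<in> M \<Longrightarrow> f y = G y"
    using smooth_mapD[OF assms(2) \<open>x \<in> M\<close>] by blast
  then show "\<exists>U G. x \<in> U \<and> smooth_on U G \<and> (\<forall>y\<in>U \<inter> M. T (f y) = G y)"
    by (intro exI[of _ U] exI[of _ "\<lambda>x. T (G x)"])
      (auto simp: smooth_on_def C_on_bounded_linear[OF _ assms(1)])
qed

lemma smooth_map_bounded_bilinear:
  assumes "bounded_bilinear T" "smooth_map M f" "smooth_map M g"
  shows "smooth_map M (\<lambda>x. T (f x) (g x))"
proof (rule smooth_mapI)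
  fix x assume x: "x \<in> M"
  obtain U G where U: "open U" "x \<in> U" "smooth_on U G" "\<And>y. y \<in> U \<Longrightarrow> y \<in> M \<Longrightarrow> f y = G y"
    using smooth_mapD[OF assms(2) x] by blast
  obtain V H where V: "open V" "x \<in> V" "smooth_on V H" "\<And>y. y \<in> V \<Longrightarrow> y \<in> M \<Longrightarrow> g y = H y"
    using smooth_mapD[OF assms(3) x] by blast
  have "C_on k (U \<inter> V) G" "C_on k (U \<inter> V) H" for k
    using U V by (auto simp: smooth_on_def intro: C_on_subset)
  then show "\<exists>U G. x \<in> U \<and> smooth_on U G \<and> (\<forall>y\<in>U \<inter> M. T (f y) (g y) = G y)"
    using U V by (intro exI[of _ "U \<inter> V"] exI[of _ "\<lambda>x. T (G x) (H x)"])
      (auto simp: smooth_on_def intro!: C_on_bounded_bilinear[OF _ assms(1)])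
qed

lemma smooth_map_add:
  assumes "smooth_map M f" "smooth_map M g"
  shows "smooth_map M (\<lambda>x. f x + g x)"
proof (rule smooth_mapI)
  fix x assume x: "x \<in> M"
  obtain U G where U: "open U" "x \<in> U" "smooth_on U G" "\<And>y. y \<in> U \<Longrightarrow> y \<in> M \<Longrightarrow> f y = G y"
    using smooth_mapD[OF assms(1) x] by blast
  obtain V H where V: "open V" "x \<in> V" "smooth_on V H" "\<And>y. y \<in> V \<Longrightarrow> y \<in> M \<Longrightarrow> g y = H y"
    using smooth_mapD[OF assms(2) x] by blast
  have "C_on k (U \<inter> V) G" "C_on k (U \<inter> V) H" for k
    using U V by (auto simp: smooth_on_def intro: C_on_subset)
  then show "\<exists>U G. x \<in> U \<and> smooth_on U G \<and> (\<forall>y\<in>U \<inter> M. f y + g y = G y)"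
    using U V by (intro exI[of _ "U \<inter> V"] exI[of _ "\<lambda>x. G x + H x"])
      (auto simp: smooth_on_def intro!: C_on_add)
qed

lemmas smooth_map_scaleR = smooth_map_bounded_bilinear[OF bounded_bilinear_scaleR]
lemmas smooth_map_inner = smooth_map_bounded_bilinear[OF bounded_bilinear_inner]
lemmas smooth_map_mult = smooth_map_bounded_bilinear[OF bounded_bilinear_mult]

lemma smooth_map_minus: "smooth_map M f \<Longrightarrow> smooth_map M (\<lambda>x. - f x)"
  using smooth_map_bounded_linear[OF bounded_linear_minus[OF bounded_linear_ident]] .

lemma smooth_map_diff:
  "smooth_map M f \<Longrightarrow> smooth_map M g \<Longrightarrow> smooth_map M (\<lambda>x. f x - g x)"
  using smooth_map_add[OF _ smooth_map_minus, of M f g] by simp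

lemma smooth_map_differentiable:
  assumes "smooth_map M f" "x \<in> M"
  shows "f differentiable (at x within M)"
proof -
  obtain U G where U: "open U" "x \<in> U" "smooth_on U G" "\<And>y. y \<in> U \<Longrightarrow> y \<in> M \<Longrightarrow> f y = G y"
    using smooth_mapD[OF assms] by blast
  have "G differentiable at x"
    using smooth_onD(2)[OF U(3), of "Suc 0"] U(2) by simp
  then obtain G' where "(G has_derivative G') (at x within M)"
    unfolding differentiable_def using has_derivative_at_withinI by blast
  moreover obtain d where "d > 0" "ball x d \<subseteq> U" using U openE by blast
  ultimately have "(f has_derivative G') (at x within M)"
    using U(4) assms(2)
    by (intro has_derivative_transform_within[of G G' x M d f]) (auto simp: subset_iff dist_commute)
  then show ?thesis unfolding differentiable_def by blast
qed

text \<open>The derivative within \<open>M\<close> controls \<open>h\<close> only on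
  \<open>M\<close>, which suffices along a curve that stays in \<open>M\<close>. Restricting time to
  the open set \<open>S\<close> lets the chain rule within sets produce a two-sided derivative at
  \<open>t\<close>.\<close>

lemma has_derivative_along_curve:
  assumes "(\<gamma> has_vector_derivative v) (at t)" "(h has_derivative h') (at (\<gamma> t) within M)"
    "open S" "t \<in> S" "\<gamma> ` S \<subseteq> M"
  shows "((\<lambda>s. h (\<gamma> s)) has_vector_derivative h' v) (at t)"
proof -
  have "(\<gamma> has_derivative (\<lambda>s. s *\<^sub>R v)) (at t within S)"
    using assms(1) by (simp add: has_vector_derivative_def has_derivative_at_withinI)
  moreover have "(h has_derivative h') (at (\<gamma> t) within \<gamma> ` S)"
    using assms(2,5) has_derivative_subset by blast
  ultimately have "((\<lambda>s. h (\<gamma> s)) has_derivative (\<lambda>s. h' (s *\<^sub>R v))) (at t within S)"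
    by (rule has_derivative_in_compose)
  then show ?thesis
    using assms(3,4) linear_cmul[OF has_derivative_linear[OF assms(2)]]
    by (simp add: has_vector_derivative_def at_within_open[OF assms(4,3)])
qed

text \<open>Derivatives within \<open>M\<close> need not be unique as linear maps of the ambient
  space. On a tangent vector both compute the ordinary derivative of \<open>h\<close> along a curve
  with that velocity.\<close>

lemma has_derivative_tangent_unique:
  assumes "v \<in> tangent_space M x"
    "(h has_derivative h') (at x within M)" "(h has_derivative h'') (at x within M)"
  shows "h' v = h'' v"
proof -
  obtain \<gamma> e where g: "e > 0" "\<gamma> ` {-e<..<e} \<subseteq> M" "\<gamma> (0::real) = x" "(\<gamma> has_vector_derivative v) (at 0)"
    using assms(1) unfolding tangent_space_def by blast
  have "((\<lambda>s. h (\<gamma> s)) has_vector_derivative f v) (at 0)" if "(h has_derivative f) (at x within M)" for f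
    by (rule has_derivative_along_curve[OF g(4) _ open_greaterThanLessThan _ g(2)]) (use that g in auto)
  then show ?thesis using vector_derivative_unique_at assms(2,3) by blast
qed

section \<open>Derivatives along linear vector fields\<close>

text \<open>The derivative of \<open>h\<close> along the vector field \<open>X\<close> on \<open>M\<close>; the choice made by
  \<^const>\<open>frechet_derivative\<close> is irrelevant when \<open>X\<close> is tangent to \<open>M\<close>.\<close>

definition along :: "'a::euclidean_space set \<Rightarrow> ('a \<Rightarrow> 'a) \<Rightarrow> ('a \<Rightarrow> 'b::euclidean_space) \<Rightarrow> 'a \<Rightarrow> 'b" where
  "along M X h q = frechet_derivative h (at q within M) (X q)"

definition linear_field :: "'a::euclidean_space set \<Rightarrow> ('a \<Rightarrow> 'a) \<Rightarrow> bool" where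
  "linear_field M X \<longleftrightarrow> bounded_linear X \<and> (\<forall>q\<in>M. X q \<in> tangent_space M q)"

lemma along_eq:
  assumes "X q \<in> tangent_space M q" "(h has_derivative h') (at q within M)"
  shows "along M X h q = h' (X q)"
  unfolding along_def using assms
  by (metis differentiableI frechet_derivative_works has_derivative_tangent_unique)

text \<open>The two functions have the same set of derivatives within \<open>M\<close> at
  \<open>q\<close>, so the choice in \<open>frechet_derivative\<close> picks the same one.\<close>

lemma along_cong:
  assumes "\<And>x. x \<in> M \<Longrightarrow> h x = k x" "q \<in> M"
  shows "along M X h q = along M X k q"
proof -
  have "(h has_derivative h') (at q within M) = (k has_derivative h') (at q within M)" for h'
    using assms by (metis has_derivative_transform)
  then show ?thesis by (simp add: along_def frechet_derivative_def)
qed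

context
  fixes M :: "'a::euclidean_space set" and X :: "'a \<Rightarrow> 'a"
  assumes X: "linear_field M X"
begin

lemma smooth_map_has_derivative_along:
  assumes "smooth_map M h" "q \<in> M"
  obtains h' where "(h has_derivative h') (at q within M)" "along M X h q = h' (X q)"
  using smooth_map_differentiable[OF assms] along_eq X assms(2)
  unfolding differentiable_def linear_field_def by blast

lemma along_linear:
  assumes "bounded_linear T" "q \<in> M"
  shows "along M X T q = T (X q)"
  using assms X by (intro along_eq bounded_linear_imp_has_derivative) (auto simp: linear_field_def)

lemma along_const: "q \<in> M \<Longrightarrow> along M X (\<lambda>x. c) q = 0"
  using X by (subst along_eq) (auto simp: linear_field_def)

lemma along_add:
  assumes "smooth_map M h" "smooth_map M k" "q \<in> M"
  shows "along M X (\<lambda>x. h x + k x) q = along M X h q + along M X k q"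
proof -
  obtain h' k' where hk: "(h has_derivative h') (at q within M)" "along M X h q = h' (X q)"
    "(k has_derivative k') (at q within M)" "along M X k q = k' (X q)"
    using assms smooth_map_has_derivative_along by metis
  show ?thesis
    using along_eq[of X q M, OF _ has_derivative_add[OF hk(1,3)]] hk X assms(3)
    by (simp add: linear_field_def)
qed

lemma along_bounded_bilinear:
  assumes "bounded_bilinear T" "smooth_map M h" "smooth_map M k" "q \<in> M"
  shows "along M X (\<lambda>x. T (h x) (k x)) q = T (along M X h q) (k q) + T (h q) (along M X k q)"
proof -
  obtain h' k' where hk: "(h has_derivative h') (at q within M)" "along M X h q = h' (X q)"
    "(k has_derivative k') (at q within M)" "along M X k q = k' (X q)"
    using assms smooth_map_has_derivative_along by metis
  show ?thesis
    using along_eq[of X q M, OF _ bounded_bilinear.FDERIV[OF assms(1) hk(1,3)]] hk X assms(4)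
    by (simp add: linear_field_def)
qed

lemma along_bounded_linear:
  assumes "bounded_linear T" "smooth_map M h" "q \<in> M"
  shows "along M X (\<lambda>x. T (h x)) q = T (along M X h q)"
proof -
  obtain h' where h: "(h has_derivative h') (at q within M)" "along M X h q = h' (X q)"
    using assms smooth_map_has_derivative_along by metis
  show ?thesis
    using along_eq[of X q M, OF _ bounded_linear.has_derivative[OF assms(1) h(1)]] h X assms(3)
    by (simp add: linear_field_def)
qed

lemmas along_scaleR = along_bounded_bilinear[OF bounded_bilinear_scaleR]
lemmas along_mult = along_bounded_bilinear[OF bounded_bilinear_mult]

lemma along_minus:
  assumes "smooth_map M h" "q \<in> M"
  shows "along M X (\<lambda>x. - h x) q = - along M X h q"
  using along_bounded_linear[OF bounded_linear_minus[OF bounded_linear_ident] assms] .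

lemma along_diff:
  assumes "smooth_map M h" "smooth_map M k" "q \<in> M"
  shows "along M X (\<lambda>x. h x - k x) q = along M X h q - along M X k q"
  using along_add[OF assms(1) smooth_map_minus[OF assms(2)] assms(3)] assms by (simp add: along_minus)

lemma along_local:
  assumes "open U" "q \<in> U" "q \<in> M" "G differentiable (at q)" "\<And>y. y \<in> U \<Longrightarrow> y \<in> M \<Longrightarrow> h y = G y"
  shows "along M X h q = frechet_derivative G (at q) (X q)"
proof (rule along_eq)
  obtain d where "d > 0" "ball q d \<subseteq> U" using assms openE by blast
  moreover have "(G has_derivative frechet_derivative G (at q)) (at q within M)"
    using assms(4) by (simp add: frechet_derivative_works has_derivative_at_withinI)
  ultimately show "(h has_derivative frechet_derivative G (at q)) (at q within M)"
    using assms by (intro has_derivative_transform_within[of G _ q M d h])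
      (auto simp: subset_iff dist_commute)
qed (use X assms in \<open>auto simp: linear_field_def\<close>)

text \<open>Near each point the derivative along \<open>X\<close> is that of a smooth ambient
  extension in direction \<open>X\<close>, hence again smooth; this permits iterated derivatives
  along fields.\<close>

lemma smooth_map_along:
  assumes "smooth_map M h"
  shows "smooth_map M (along M X h)"
proof (rule smooth_mapI)
  fix x assume x: "x \<in> M"
  obtain U G where U: "open U" "x \<in> U" "smooth_on U G" "\<And>y. y \<in> U \<Longrightarrow> y \<in> M \<Longrightarrow> h y = G y"
    using smooth_mapD[OF assms x] by blast
  have "C_on k U (\<lambda>y. frechet_derivative G (at y) (X y))" for k
    using C_on_directional_derivative[OF U(1)] C_on_linear[OF _ U(1)] smooth_onD(2)[OF U(3)] X
    unfolding linear_field_def by blast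
  moreover have "G differentiable (at y)" if "y \<in> U" for y
    using smooth_onD(2)[OF U(3), of "Suc 0"] that by simp
  moreover have "along M X h y = frechet_derivative G (at y) (X y)" if "y \<in> U" "y \<in> M" for y
    using along_local[of U y G h, OF U(1) that] \<open>\<And>y. y \<in> U \<Longrightarrow> G differentiable (at y)\<close> that U(4) by blast
  ultimately show "\<exists>U G. x \<in> U \<and> smooth_on U G \<and> (\<forall>y\<in>U \<inter> M. along M X h y = G y)"
    using U by (intro exI[of _ U] exI[of _ "\<lambda>y. frechet_derivative G (at y) (X y)"])
      (auto simp: smooth_on_def)
qed

end

text \<open>A product rule: differentiating \<open>DG(y)(Y y)\<close> hits the base point and the
  direction. A linear \<open>Y\<close> is its own derivative, so the second contribution is
  \<open>DG(q)(Y v)\<close>.\<close>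

lemma frechet_derivative_directional_derivative:
  assumes "open U" "q \<in> U" "C_on 2 U G" "bounded_linear Y"
  shows "frechet_derivative (\<lambda>y. frechet_derivative G (at y) (Y y)) (at q) v
    = frechet_derivative (\<lambda>y. frechet_derivative G (at y) (Y q)) (at q) v + frechet_derivative G (at q) (Y v)"
proof -
  let ?S = "\<lambda>T y. \<Sum>i\<in>Basis. (T y \<bullet> i) *\<^sub>R frechet_derivative G (at y) i"
  have G: "frechet_derivative G (at y) w = (\<Sum>i\<in>Basis. (w \<bullet> i) *\<^sub>R frechet_derivative G (at y) i)"
    if "y \<in> U" for y w
  proof -
    have l: "linear (frechet_derivative G (at y))"
      using assms(3) that linear_frechet_derivative by (auto simp: numeral_2_eq_2)
    show ?thesis
      by (subst (1) euclidean_representation[of "w", symmetric]) (simp add: linear_sum[OF l] linear_cmul[OF l])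
  qed
  have D: "((\<lambda>y. frechet_derivative G (at y) i) has_derivative
      frechet_derivative (\<lambda>y. frechet_derivative G (at y) i) (at q)) (at q)" for i
    using assms by (simp add: numeral_2_eq_2 flip: frechet_derivative_works)
  \<comment> \<open>Used for \<open>Y\<close> and for the constant field with value
    \<open>Y q\<close>; the two results differ exactly by the first-order term.\<close>
  have *: "frechet_derivative (\<lambda>y. frechet_derivative G (at y) (T y)) (at q) v
     = (\<Sum>i\<in>Basis. (T q \<bullet> i) *\<^sub>R frechet_derivative (\<lambda>y. frechet_derivative G (at y) i) (at q) v
         + (T' v \<bullet> i) *\<^sub>R frechet_derivative G (at q) i)"
    if "(T has_derivative T') (at q)" for T T'
  proof -
    have "(?S T has_derivative (\<lambda>v. \<Sum>i\<in>Basis.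
         (T q \<bullet> i) *\<^sub>R frechet_derivative (\<lambda>y. frechet_derivative G (at y) i) (at q) v
         + (T' v \<bullet> i) *\<^sub>R frechet_derivative G (at q) i)) (at q)"
      by (intro has_derivative_sum has_derivative_scaleR has_derivative_inner_left D that)
    from fun_cong[OF frechet_derivative_at[OF has_derivative_transform_within_open[OF this assms(1,2) G[symmetric]]], of v]
    show ?thesis by (rule sym)
  qed
  show ?thesis
    using *[OF bounded_linear_imp_has_derivative[OF assms(4)]] *[OF has_derivative_const[of "Y q"]]
      G[OF assms(2), of "Y v"] by (simp add: sum.distrib)
qed

text \<open>In an ambient extension the second-order parts of the two iterated derivatives cancel by
  symmetry, and the first-order parts leave \<open>DG(q)(Y (X q) - X (Y q))\<close>. For linear
  fields this difference of composites is the Lie bracket of \<open>X\<close> and \<open>Y\<close>,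
  in this order.\<close>

lemma along_commutator:
  assumes "linear_field M X" "linear_field M Y" "linear_field M Z" "smooth_map M h" "q \<in> M"
    and Z: "Y (X q) - X (Y q) = Z q"
  shows "along M X (along M Y h) q - along M Y (along M X h) q = along M Z h q"
proof -
  obtain U G where U: "open U" "q \<in> U" "smooth_on U G" "\<And>y. y \<in> U \<Longrightarrow> y \<in> M \<Longrightarrow> h y = G y"
    using smooth_mapD[OF assms(4,5)] by blast
  have dG: "G differentiable (at y)" if "y \<in> U" for y
    using smooth_onD(2)[OF U(3), of "Suc 0"] that by simp
  have C2: "C_on 2 U G" using smooth_onD(2)[OF U(3)] .
  have *: "along M X (along M Y h) q
      = frechet_derivative (\<lambda>y. frechet_derivative G (at y) (Y q)) (at q) (X q) + frechet_derivative G (at q) (Y (X q))"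
    if X: "linear_field M X" and Y: "linear_field M Y" for X Y
  proof -
    have bl: "bounded_linear Y" using Y by (simp add: linear_field_def)
    have "C_on (Suc 0) U (\<lambda>y. frechet_derivative G (at y) (Y y))"
      using C_on_directional_derivative[OF U(1) _ C_on_linear[OF bl U(1)], of "Suc 0" G] C2
      unfolding numeral_2_eq_2 .
    then have "(\<lambda>y. frechet_derivative G (at y) (Y y)) differentiable (at q)"
      using U(2) by simp
    then have "along M X (along M Y h) q = frechet_derivative (\<lambda>y. frechet_derivative G (at y) (Y y)) (at q) (X q)"
      using along_local[OF X U(1,2) assms(5)] along_local[OF Y U(1) _ _ dG U(4)] by blast
    then show ?thesis using frechet_derivative_directional_derivative[OF U(1,2) C2 bl] by simp
  qed
  have l: "linear (frechet_derivative G (at q))"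
    using dG[OF U(2)] linear_frechet_derivative by blast
  have "along M Z h q = frechet_derivative G (at q) (Y (X q) - X (Y q))"
    unfolding Z by (rule along_local[OF assms(3) U(1,2) assms(5) dG[OF U(2)] U(4)])
  then show ?thesis
    unfolding *[OF assms(1,2)] *[OF assms(2,1)] second_derivative_symmetric[OF U(1,2) C2, of "Y q"]
    by (simp add: linear_diff[OF l])
qed

section \<open>Tangent vectors of the configuration space\<close>

definition rot90 :: "plane \<Rightarrow> plane" where
  "rot90 v = (\<chi> i. if i = 1 then - v $ 2 else v $ 1)"

lemma rot90_nth [simp]: "rot90 v $ 1 = - v $ 2" "rot90 v $ 2 = v $ 1"
  by (simp_all add: rot90_def)

lemma plane_eq_iff: "(v::plane) = w \<longleftrightarrow> v $ 1 = w $ 1 \<and> v $ 2 = w $ 2"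
  by (simp add: vec_eq_iff forall_2)

lemma plane_inner: "(v::plane) \<bullet> w = v $ 1 * w $ 1 + v $ 2 * w $ 2"
  by (simp add: inner_vec_def sum_2)

lemma bounded_linear_rot90: "bounded_linear rot90"
  by (intro linear_conv_bounded_linear[THEN iffD1] linearI) (auto simp: plane_eq_iff)

lemma rot90_simps [simp]:
  "rot90 (rot90 v) = - v" "rot90 v \<bullet> v = 0" "v \<bullet> rot90 v = 0" "rot90 v \<bullet> rot90 w = v \<bullet> w"
  "rot90 (v + w) = rot90 v + rot90 w" "rot90 (c *\<^sub>R v) = c *\<^sub>R rot90 v"
  "rot90 (- v) = - rot90 v" "rot90 0 = 0" "norm (rot90 v) = norm v"
  by (auto simp: plane_eq_iff plane_inner norm_eq_sqrt_inner)

lemma plane_frame_expansion: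
  assumes "e \<bullet> e = 1"
  shows "v = (v \<bullet> e) *\<^sub>R e + (v \<bullet> rot90 e) *\<^sub>R rot90 e"
proof -
  have "v $ 1 = v $ 1 * (e \<bullet> e)" "v $ 2 = v $ 2 * (e \<bullet> e)" using assms by auto
  then show ?thesis by (auto simp: plane_eq_iff plane_inner algebra_simps)
qed

lemma plane_rotation_exists:
  assumes "norm v = norm w"
  obtains c where "w = cos c *\<^sub>R v + sin c *\<^sub>R rot90 v"
proof (cases "v = 0")
  case True
  then show ?thesis using assms that by auto
next
  case False
  define e where "e = v /\<^sub>R norm v"
  have "norm e = 1" using False by (simp add: e_def)
  then have e: "e \<bullet> e = 1" by (simp add: norm_eq_1)
  define z where "z = w /\<^sub>R norm v"
  have "norm z = 1" using False by (simp add: z_def assms[symmetric])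
  then have "z \<bullet> z = 1" by (simp add: norm_eq_1)
  moreover have "z = (z \<bullet> e) *\<^sub>R e + (z \<bullet> rot90 e) *\<^sub>R rot90 e" by (rule plane_frame_expansion[OF e])
  then have "z \<bullet> z = (z \<bullet> e) * (z \<bullet> e) + (z \<bullet> rot90 e) * (z \<bullet> rot90 e)"
    by (metis inner_add_right inner_scaleR_right)
  ultimately have "(z \<bullet> e)\<^sup>2 + (z \<bullet> rot90 e)\<^sup>2 = 1" by (simp add: power2_eq_square)
  then obtain c where c: "z \<bullet> e = cos c" "z \<bullet> rot90 e = sin c" using sincos_total_2pi by metis
  have "z = cos c *\<^sub>R e + sin c *\<^sub>R rot90 e"
    using plane_frame_expansion[OF e, of z] c by simp
  then have "norm v *\<^sub>R z = cos c *\<^sub>R (norm v *\<^sub>R e) + sin c *\<^sub>R rot90 (norm v *\<^sub>R e)"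
    by (simp add: scaleR_add_right mult.commute)
  moreover have "norm v *\<^sub>R z = w" "norm v *\<^sub>R e = v" using False by (simp_all add: z_def e_def)
  ultimately have "w = cos c *\<^sub>R v + sin c *\<^sub>R rot90 v" by simp
  then show ?thesis using that by blast
qed

text \<open>The class of these curves is closed under differentiation, so the induction runs over
  all \<open>a\<close>, \<open>v\<close>, \<open>w\<close>, \<open>d\<close> at once.\<close>

lemma C_on_trig:
  "C_on k U (\<lambda>t::real. t *\<^sub>R a + cos (c * t) *\<^sub>R v + sin (c * t) *\<^sub>R w + d)"
proof (induction k arbitrary: a v w d)
  case 0
  then show ?case by (auto intro!: continuous_intros)
next
  case (Suc k)
  let ?f = "\<lambda>t::real. t *\<^sub>R a + cos (c * t) *\<^sub>R v + sin (c * t) *\<^sub>R w + d"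
  \<comment> \<open>The derivative is arranged in the shape of the claim, with linear coefficient 0
    and constant term \<open>s *\<^sub>R a\<close>, so that the induction hypothesis applies
    literally.\<close>
  have d: "(?f has_derivative (\<lambda>s. t *\<^sub>R 0 + cos (c * t) *\<^sub>R ((s * c) *\<^sub>R w) + sin (c * t) *\<^sub>R (- (s * c) *\<^sub>R v) + s *\<^sub>R a)) (at t)" for t
    by (auto intro!: derivative_eq_intros simp: algebra_simps)
  have "C_on k U (\<lambda>t. frechet_derivative ?f (at t) s)" for s
    unfolding fun_cong[OF frechet_derivative_at[OF d], symmetric] by (rule Suc.IH)
  then show ?case using d unfolding C_on.simps differentiable_def by blast
qed

section \<open>Explicit curves and the tangent spaces of \<open>Q l\<close>\<close>

lemma Q_iff: "q \<in> Q l \<longleftrightarrow> norm (snd q - fst q) = l"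
  by (auto simp: Q_def split_beta)

text \<open>The back wheel moves with constant velocity \<open>v\<close> while the frame turns at
  constant angular velocity \<open>c\<close>. These curves realize every tangent vector and also
  join any two configurations.\<close>

definition glide :: "plane \<times> plane \<Rightarrow> plane \<Rightarrow> real \<Rightarrow> real \<Rightarrow> plane \<times> plane" where
  "glide q v c t = t *\<^sub>R (v, v) + cos (c * t) *\<^sub>R (0, snd q - fst q) + sin (c * t) *\<^sub>R (0, rot90 (snd q - fst q))
     + (fst q, fst q)"

lemma glide_difference:
  "snd (glide q v c t) - fst (glide q v c t) = cos (c * t) *\<^sub>R (snd q - fst q) + sin (c * t) *\<^sub>R rot90 (snd q - fst q)"
  by (simp add: glide_def)

lemma glide_0: "glide q v c 0 = q"
  by (cases q) (simp add: glide_def)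

lemma norm_rotated: "norm (cos c *\<^sub>R v + sin c *\<^sub>R rot90 v) = norm v"
proof -
  have "(cos c *\<^sub>R v + sin c *\<^sub>R rot90 v) \<bullet> (cos c *\<^sub>R v + sin c *\<^sub>R rot90 v) =
      (cos c * cos c + sin c * sin c) * (v \<bullet> v)"
    by (simp add: inner_add_left inner_add_right algebra_simps del: sin_cos_squared_add3)
  then show ?thesis by (simp add: norm_eq_sqrt_inner)
qed

lemma glide_in_Q: "q \<in> Q l \<Longrightarrow> glide q v c t \<in> Q l"
  by (simp only: Q_iff glide_difference norm_rotated)

lemma glide_has_vector_derivative:
  "(glide q v c has_vector_derivative (v, v + c *\<^sub>R rot90 (snd (glide q v c t) - fst (glide q v c t)))) (at t)"
proof -
  have "(glide q v c has_vector_derivative ((v, v) + (c * - sin (c * t)) *\<^sub>R (0, snd q - fst q)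
     + (c * cos (c * t)) *\<^sub>R (0, rot90 (snd q - fst q)))) (at t)"
    unfolding glide_def[abs_def] has_vector_derivative_def
    by (auto intro!: derivative_eq_intros simp: algebra_simps)
  moreover have "c *\<^sub>R rot90 (snd (glide q v c t) - fst (glide q v c t)) =
      (c * - sin (c * t)) *\<^sub>R d + (c * cos (c * t)) *\<^sub>R rot90 d" if "d = snd q - fst q" for d
    unfolding glide_difference that[symmetric] by (simp add: scaleR_diff_right)
  ultimately show ?thesis by (simp add: add_diff_eq diff_add_eq)
qed

text \<open>Differentiating the constant squared frame length along a curve gives one inclusion; for
  the other, every vector satisfying the equation is the initial velocity of a glide.\<close>

lemma tangent_space_Q:
  assumes "q \<in> Q l" "l > 0"
  shows "tangent_space (Q l) q = {v. (snd v - fst v) \<bullet> (snd q - fst q) = 0}"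
proof (intro subset_antisym subsetI)
  fix v assume "v \<in> tangent_space (Q l) q"
  then obtain \<gamma> e where g: "e > 0" "\<gamma> ` {-e<..<e} \<subseteq> Q l" "\<gamma> (0::real) = q" "(\<gamma> has_vector_derivative v) (at 0)"
    unfolding tangent_space_def by blast
  have "((\<lambda>p. (snd p - fst p) \<bullet> (snd p - fst p)) has_derivative
      (\<lambda>h. (snd q - fst q) \<bullet> (snd h - fst h) + (snd h - fst h) \<bullet> (snd q - fst q))) (at q within Q l)"
    by (auto intro!: derivative_eq_intros)
  from has_derivative_along_curve[OF g(4) this[folded g(3)] open_greaterThanLessThan _ g(2)] g(1)
  have 1: "((\<lambda>s. (snd (\<gamma> s) - fst (\<gamma> s)) \<bullet> (snd (\<gamma> s) - fst (\<gamma> s))) has_vector_derivative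
      (snd q - fst q) \<bullet> (snd v - fst v) + (snd v - fst v) \<bullet> (snd q - fst q)) (at 0)"
    by (simp add: g(3))
  have 2: "((\<lambda>s. l\<^sup>2) has_vector_derivative 0) (at (0::real))" by simp
  have "((\<lambda>s. (snd (\<gamma> s) - fst (\<gamma> s)) \<bullet> (snd (\<gamma> s) - fst (\<gamma> s))) has_vector_derivative 0) (at 0)"
    using 2
  proof (rule has_vector_derivative_transform_within_open[where S = "{-e<..<e}"])
    fix s assume "s \<in> {-e<..<e}"
    then have "\<gamma> s \<in> Q l" using g(2) by blast
    then show "l\<^sup>2 = (snd (\<gamma> s) - fst (\<gamma> s)) \<bullet> (snd (\<gamma> s) - fst (\<gamma> s))"
      by (simp add: Q_iff dot_square_norm)
  qed (use g in auto)
  from vector_derivative_unique_at[OF 1 this]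
  show "v \<in> {v. (snd v - fst v) \<bullet> (snd q - fst q) = 0}" by (simp add: inner_commute)
next
  fix v assume "v \<in> {v. (snd v - fst v) \<bullet> (snd q - fst q) = 0}"
  then have v: "(snd v - fst v) \<bullet> (snd q - fst q) = 0" by simp
  \<comment> \<open>The angular velocity: the relative velocity is \<open>c\<close> times
    \<open>rot90 (snd q - fst q)\<close>, a vector of squared length
    \<open>l\<^sup>2\<close>.\<close>
  define c where "c = ((snd v - fst v) \<bullet> rot90 (snd q - fst q)) / l\<^sup>2"
  define e where "e = (snd q - fst q) /\<^sub>R l"
  have "norm e = 1" using assms by (simp add: Q_iff e_def)
  then have "e \<bullet> e = 1" by (simp add: norm_eq_1)
  from plane_frame_expansion[OF this, of "snd v - fst v"] v
  have "snd v - fst v = c *\<^sub>R rot90 (snd q - fst q)"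
    by (simp add: c_def e_def power2_eq_square divide_inverse ac_simps)
  then have vv: "v = (fst v, fst v + c *\<^sub>R rot90 (snd q - fst q))"
    by (metis add_diff_cancel_left' diff_add_cancel add.commute prod.collapse)
  show "v \<in> tangent_space (Q l) q"
    unfolding tangent_space_def
  proof (intro CollectI exI conjI)
    show "(0::real) < 1" by simp
    show "smooth_on {-1<..<1} (glide q (fst v) c)"
      unfolding smooth_on_def glide_def[abs_def]
      by (intro conjI allI C_on_trig open_greaterThanLessThan)
    show "glide q (fst v) c ` {-1<..<1} \<subseteq> Q l" using glide_in_Q[OF assms(1)] by blast
    show "glide q (fst v) c 0 = q" by (rule glide_0)
    show "(glide q (fst v) c has_vector_derivative v) (at 0)"
      using glide_has_vector_derivative[of q "fst v" c 0] unfolding glide_0 vv[symmetric] .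
  qed
qed

text \<open>The formula is linear on the whole ambient space, so it also applies to tangent vectors,
  where it gives the derivative of the heading.\<close>

definition heading :: "real \<Rightarrow> plane \<times> plane \<Rightarrow> plane" where
  "heading l q = (snd q - fst q) /\<^sub>R l"

lemma bounded_linear_heading: "bounded_linear (heading l)"
  unfolding heading_def[abs_def]
  by (intro bounded_linear_const_scaleR bounded_linear_sub bounded_linear_fst bounded_linear_snd)

lemma heading_unit: "q \<in> Q l \<Longrightarrow> l > 0 \<Longrightarrow> heading l q \<bullet> heading l q = 1"
  by (simp add: heading_def Q_iff dot_square_norm power2_eq_square)

lemma heading_scaled: "l > 0 \<Longrightarrow> l *\<^sub>R heading l q = snd q - fst q"
  by (simp add: heading_def)

text \<open>\<open>X1\<close> rides straight ahead, \<open>X2\<close> turns the frame about the back wheel, and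
  \<open>X0\<close> is their Lie bracket.\<close>

definition X1 :: "real \<Rightarrow> plane \<times> plane \<Rightarrow> plane \<times> plane" where
  "X1 l q = (heading l q, heading l q)"

definition X2 :: "real \<Rightarrow> plane \<times> plane \<Rightarrow> plane \<times> plane" where
  "X2 l q = (0, rot90 (heading l q))"

definition X0 :: "real \<Rightarrow> plane \<times> plane \<Rightarrow> plane \<times> plane" where
  "X0 l q = (- (rot90 (heading l q) /\<^sub>R l), - (rot90 (heading l q) /\<^sub>R l))"

lemma bounded_linear_X: "bounded_linear (X1 l)" "bounded_linear (X2 l)" "bounded_linear (X0 l)"
  unfolding X1_def[abs_def] X2_def[abs_def] X0_def[abs_def]
  by (intro bounded_linear_Pair bounded_linear_heading bounded_linear_zero bounded_linear_minus
      bounded_linear_const_scaleR bounded_linear_compose[OF bounded_linear_rot90])+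

lemma heading_X [simp]:
  "heading l (X1 l q) = 0" "heading l (X2 l q) = rot90 (heading l q) /\<^sub>R l" "heading l (X0 l q) = 0"
  by (auto simp: X1_def X2_def X0_def heading_def)

lemma linear_field_X:
  assumes "l > 0"
  shows "linear_field (Q l) (X1 l)" "linear_field (Q l) (X2 l)" "linear_field (Q l) (X0 l)"
  using assms unfolding linear_field_def
  by (auto simp: bounded_linear_X tangent_space_Q X1_def X2_def X0_def heading_def)

lemma tangent_space_Q_expansion:
  assumes "q \<in> Q l" "l > 0" "v \<in> tangent_space (Q l) q"
  obtains \<alpha> \<beta> \<gamma> where "v = \<alpha> *\<^sub>R X1 l q + \<beta> *\<^sub>R X2 l q + \<gamma> *\<^sub>R X0 l q"
proof -
  let ?e = "heading l q"
  have e: "?e \<bullet> ?e = 1" using assms heading_unit by blast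
  have "(snd v - fst v) \<bullet> ?e = 0" using assms by (simp add: tangent_space_Q heading_def)
  then have "snd v - fst v = ((snd v - fst v) \<bullet> rot90 ?e) *\<^sub>R rot90 ?e" (is "_ = ?b *\<^sub>R _")
    using plane_frame_expansion[OF e, of "snd v - fst v"] by simp
  then have "snd v = fst v + ?b *\<^sub>R rot90 ?e" by (metis add.commute diff_add_cancel)
  moreover obtain a d where "fst v = a *\<^sub>R ?e + d *\<^sub>R rot90 ?e"
    using plane_frame_expansion[OF e, of "fst v"] by blast
  ultimately have "v = (a *\<^sub>R ?e + d *\<^sub>R rot90 ?e, a *\<^sub>R ?e + d *\<^sub>R rot90 ?e + ?b *\<^sub>R rot90 ?e)"
    by (intro prod_eqI) auto
  \<comment> \<open>\<open>X0\<close> is \<open>-1/l\<close> times the unit sideways translation,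
    hence the coefficient \<open>- l * d\<close>.\<close>
  also have "\<dots> = a *\<^sub>R X1 l q + ?b *\<^sub>R X2 l q + (- l * d) *\<^sub>R X0 l q"
    using assms(2) by (simp add: X1_def X2_def X0_def)
  finally show ?thesis using that by blast
qed

text \<open>Any two configurations are joined by a glide of unit duration: the back wheel moves
  along a segment while the frame turns by the angle between the headings. Its velocity is tangent,
  hence a combination of the three fields, and the derivative of \<open>h\<close> along it
  vanishes.\<close>

lemma constant_on_Q:
  assumes "l > 0" "smooth_map (Q l) h"
    and zero: "\<And>q. q \<in> Q l \<Longrightarrow> along (Q l) (X1 l) h q = 0" "\<And>q. q \<in> Q l \<Longrightarrow> along (Q l) (X2 l) h q = 0"
      "\<And>q. q \<in> Q l \<Longrightarrow> along (Q l) (X0 l) h q = 0"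
    and q: "q \<in> Q l" "q' \<in> Q l"
  shows "h q = h q'"
proof -
  note X = linear_field_X[OF assms(1)]
  have h': "h' v = 0" if hv: "(h has_derivative h') (at x within Q l)" "v \<in> tangent_space (Q l) x" "x \<in> Q l" for x v h'
  proof -
    obtain \<alpha> \<beta> \<gamma> where v: "v = \<alpha> *\<^sub>R X1 l x + \<beta> *\<^sub>R X2 l x + \<gamma> *\<^sub>R X0 l x"
      using tangent_space_Q_expansion[OF hv(3) assms(1) hv(2)] .
    have l: "linear h'" using hv(1) has_derivative_linear by blast
    have "h' (X1 l x) = 0" "h' (X2 l x) = 0" "h' (X0 l x) = 0"
      using along_eq[OF _ hv(1)] zero[OF hv(3)] X hv(3) unfolding linear_field_def by metis+
    then show ?thesis by (simp add: v linear_add[OF l] linear_cmul[OF l])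
  qed
  have "norm (snd q - fst q) = norm (snd q' - fst q')" using q by (simp add: Q_iff)
  then obtain c where c: "snd q' - fst q' = cos c *\<^sub>R (snd q - fst q) + sin c *\<^sub>R rot90 (snd q - fst q)"
    by (rule plane_rotation_exists)
  define \<gamma> where "\<gamma> = glide q (fst q' - fst q) c"
  have "\<gamma> 1 = q'"
    using c by (intro prod_eqI) (auto simp: \<gamma>_def glide_def algebra_simps)
  have "((\<lambda>t. h (\<gamma> t)) has_vector_derivative 0) (at t within UNIV)" for t
  proof -
    have in_Q: "\<gamma> t \<in> Q l" unfolding \<gamma>_def using q glide_in_Q by blast
    obtain h' where d: "(h has_derivative h') (at (\<gamma> t) within Q l)"
      using smooth_map_differentiable[OF assms(2) in_Q] unfolding differentiable_def by blast
    let ?v = "fst q' - fst q"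
    have "(?v, ?v + c *\<^sub>R rot90 (snd (\<gamma> t) - fst (\<gamma> t))) \<in> tangent_space (Q l) (\<gamma> t)"
      by (simp add: tangent_space_Q[OF in_Q assms(1)])
    moreover have "\<gamma> ` UNIV \<subseteq> Q l" using glide_in_Q[OF q(1)] by (auto simp: \<gamma>_def)
    ultimately show ?thesis
      using has_derivative_along_curve[OF glide_has_vector_derivative[of q ?v c t, folded \<gamma>_def] d open_UNIV]
        h'[OF d _ in_Q] by simp
  qed
  then obtain k where "\<And>t. h (\<gamma> t) = k"
    using has_vector_derivative_zero_constant[of UNIV "\<lambda>t. h (\<gamma> t)"] by auto
  then show ?thesis using \<open>\<gamma> 1 = q'\<close> glide_0[of q] unfolding \<gamma>_def by metis
qed

lemma along_X_commutators:
  assumes "l > 0" "smooth_map (Q l) h" "q \<in> Q l"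
  shows "along (Q l) (X1 l) (along (Q l) (X2 l) h) q - along (Q l) (X2 l) (along (Q l) (X1 l) h) q
      = along (Q l) (X0 l) h q"
    "along (Q l) (X1 l) (along (Q l) (X0 l) h) q = along (Q l) (X0 l) (along (Q l) (X1 l) h) q"
    "along (Q l) (X2 l) (along (Q l) (X0 l) h) q - along (Q l) (X0 l) (along (Q l) (X2 l) h) q
      = along (Q l) (X1 l) h q /\<^sub>R l\<^sup>2"
proof -
  note X = linear_field_X[OF assms(1)]
  show "along (Q l) (X1 l) (along (Q l) (X2 l) h) q - along (Q l) (X2 l) (along (Q l) (X1 l) h) q
      = along (Q l) (X0 l) h q"
    by (rule along_commutator[OF X(1,2,3) assms(2,3)]) (auto simp: X2_def[of _ "X1 _ _"] X1_def[of _ "X2 _ _"] X0_def zero_prod_def)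
  have l: "linear (frechet_derivative h (at q within Q l))"
    using smooth_map_differentiable[OF assms(2,3)] linear_frechet_derivative by blast
  have z: "linear_field (Q l) (\<lambda>q. 0)"
    using assms(1) by (auto simp: linear_field_def tangent_space_Q bounded_linear_zero)
  have "along (Q l) (X1 l) (along (Q l) (X0 l) h) q - along (Q l) (X0 l) (along (Q l) (X1 l) h) q
     = along (Q l) (\<lambda>q. 0) h q"
    by (rule along_commutator[OF X(1,3) z assms(2,3)]) (auto simp: X1_def[of _ "X0 _ _"] X0_def[of _ "X1 _ _"] zero_prod_def)
  moreover have "along (Q l) (\<lambda>q. 0) h q = 0"
    by (simp add: along_def linear_0[OF l])
  ultimately show "along (Q l) (X1 l) (along (Q l) (X0 l) h) q = along (Q l) (X0 l) (along (Q l) (X1 l) h) q"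
    by simp
  have X1': "linear_field (Q l) (\<lambda>q. X1 l q /\<^sub>R l\<^sup>2)"
    using bounded_linear_const_scaleR[OF bounded_linear_X(1)] assms(1)
    by (auto simp: linear_field_def tangent_space_Q) (simp add: X1_def)
  have "along (Q l) (X2 l) (along (Q l) (X0 l) h) q - along (Q l) (X0 l) (along (Q l) (X2 l) h) q
     = along (Q l) (\<lambda>q. X1 l q /\<^sub>R l\<^sup>2) h q"
    by (rule along_commutator[OF X(2,3) X1' assms(2,3)])
      (auto simp: X2_def[of _ "X0 _ _"] X0_def[of _ "X2 _ _"] X1_def power2_eq_square zero_prod_def)
  moreover have "along (Q l) (\<lambda>q. X1 l q /\<^sub>R l\<^sup>2) h q = along (Q l) (X1 l) h q /\<^sub>R l\<^sup>2"
    by (simp add: along_def linear_cmul[OF l])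
  ultimately show "along (Q l) (X2 l) (along (Q l) (X0 l) h) q - along (Q l) (X0 l) (along (Q l) (X2 l) h) q
      = along (Q l) (X1 l) h q /\<^sub>R l\<^sup>2" by simp
qed

section \<open>The differential of an isometry\<close>

text \<open>The product rule in a moving frame: if \<open>E\<close> turns at rate
  \<open>\<mu>\<close>, then \<open>rot90 E\<close> has derivative \<open>-\<mu> E\<close>, and the
  turning mixes the two coefficients.\<close>

lemma along_rotating_frame:
  assumes X: "linear_field M X" and E: "smooth_map M E" and "smooth_map M \<alpha>" "smooth_map M \<beta>" "q \<in> M"
    and turn: "along M X E q = \<mu> *\<^sub>R rot90 (E q)"
  shows "along M X (\<lambda>x. \<alpha> x *\<^sub>R E x + \<beta> x *\<^sub>R rot90 (E x)) q =
      (along M X \<alpha> q - \<mu> * \<beta> q) *\<^sub>R E q + (along M X \<beta> q + \<mu> * \<alpha> q) *\<^sub>R rot90 (E q)"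
proof -
  have N: "smooth_map M (\<lambda>x. rot90 (E x))" "along M X (\<lambda>x. rot90 (E x)) q = - \<mu> *\<^sub>R E q"
    using smooth_map_bounded_linear[OF bounded_linear_rot90 E]
      along_bounded_linear[OF X bounded_linear_rot90 E assms(5)] turn by auto
  have "along M X (\<lambda>x. \<alpha> x *\<^sub>R E x + \<beta> x *\<^sub>R rot90 (E x)) q =
      along M X (\<lambda>x. \<alpha> x *\<^sub>R E x) q + along M X (\<lambda>x. \<beta> x *\<^sub>R rot90 (E x)) q"
    by (rule along_add[OF X]) (intro smooth_map_scaleR assms N)+
  also have "\<dots> = (along M X \<alpha> q *\<^sub>R E q + \<alpha> q *\<^sub>R along M X E q) +
      (along M X \<beta> q *\<^sub>R rot90 (E q) + \<beta> q *\<^sub>R along M X (\<lambda>x. rot90 (E x)) q)"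
    by (intro arg_cong2[where f = "(+)"] along_scaleR[OF X] assms N)
  finally show ?thesis using turn N by (simp add: algebra_simps)
qed

lemma frame_coefficients_eqD:
  assumes "e \<bullet> e = 1" "a *\<^sub>R e + b *\<^sub>R rot90 e = c *\<^sub>R e + d *\<^sub>R rot90 e"
  shows "a = c" "b = d"
  using arg_cong[OF assms(2), of "\<lambda>v. v \<bullet> e"] arg_cong[OF assms(2), of "\<lambda>v. v \<bullet> rot90 e"] assms(1)
  by (simp_all add: inner_add_left)

text \<open>Differentiating \<open>s * s = 1\<close> gives \<open>s * Xs = 0\<close>, and
  \<open>s\<close> has no zero.\<close>

lemma along_unit_valued:
  assumes X: "linear_field M X" and "smooth_map M s" "q \<in> M" and unit: "\<And>x. x \<in> M \<Longrightarrow> (s x :: real)\<^sup>2 = 1"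
  shows "along M X s q = 0"
proof -
  have "along M X (\<lambda>x. s x * s x) q = along M X (\<lambda>x. 1 :: real) q"
    using unit assms(3) by (intro along_cong) (auto simp: power2_eq_square)
  then have "s q * along M X s q = 0"
    using along_mult[OF X assms(2,2,3)] by (simp add: along_const[OF X assms(3)] mult.commute)
  moreover have "s q \<noteq> 0" using unit[OF assms(3)] by auto
  ultimately show ?thesis by simp
qed

text \<open>\<open>u\<close> and \<open>E\<close> play the role of the front wheel and the heading of the image of a configuration
  under an isometry, \<open>a, b, c, d\<close> that of the matrix of its differential.\<close>

locale isometry_frame =
  fixes l :: real and u E :: "plane \<times> plane \<Rightarrow> plane" and a b c d :: "plane \<times> plane \<Rightarrow> real"
  assumes l: "l > 0"
    and smooth: "smooth_map (Q l) u" "smooth_map (Q l) E" "smooth_map (Q l) a" "smooth_map (Q l) b"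
      "smooth_map (Q l) c" "smooth_map (Q l) d"
    and unit: "\<And>q. q \<in> Q l \<Longrightarrow> E q \<bullet> E q = 1"
    and u1: "\<And>q. q \<in> Q l \<Longrightarrow> along (Q l) (X1 l) u q = a q *\<^sub>R E q + b q *\<^sub>R rot90 (E q)"
    and u2: "\<And>q. q \<in> Q l \<Longrightarrow> along (Q l) (X2 l) u q = d q *\<^sub>R E q + c q *\<^sub>R rot90 (E q)"
    and E1: "\<And>q. q \<in> Q l \<Longrightarrow> along (Q l) (X1 l) E q = (b q / l) *\<^sub>R rot90 (E q)"
    and E2: "\<And>q. q \<in> Q l \<Longrightarrow> along (Q l) (X2 l) E q = (c q / l) *\<^sub>R rot90 (E q)"
    and orthonormal: "\<And>q. q \<in> Q l \<Longrightarrow> (a q)\<^sup>2 + (b q)\<^sup>2 = 1" "\<And>q. q \<in> Q l \<Longrightarrow> (c q)\<^sup>2 + (d q)\<^sup>2 = 1"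
      "\<And>q. q \<in> Q l \<Longrightarrow> a q * d q + b q * c q = 0"
begin

abbreviation "D1 \<equiv> along (Q l) (X1 l)"
abbreviation "D2 \<equiv> along (Q l) (X2 l)"
abbreviation "D0 \<equiv> along (Q l) (X0 l)"

lemmas X = linear_field_X[OF l]
lemmas smooth_intros = smooth smooth_map_add smooth_map_diff smooth_map_minus smooth_map_scaleR smooth_map_mult
  smooth_map_const smooth_map_along[OF X(1)] smooth_map_along[OF X(2)] smooth_map_along[OF X(3)]

text \<open>The determinant of the differential on the distribution, in the frames
  \<open>X1\<close>, \<open>X2\<close> and \<open>E\<close>, \<open>rot90 E\<close>; orthonormality
  makes it a sign.\<close>

definition "\<epsilon> q = a q * c q - b q * d q"
text \<open>\<open>p\<close> and \<open>r\<close> are the coefficients of the commutator of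
  \<open>D1\<close> and \<open>D2\<close> on \<open>u\<close>, up to the part caused by the turning
  of \<open>E\<close>. Moreover \<open>r / l\<close> turns out to be the turning rate of
  \<open>E\<close> along \<open>X0\<close>.\<close>

definition "p q = D1 d q - D2 a q"
definition "r q = D1 c q - D2 b q"

lemma smooth_aux: "smooth_map (Q l) \<epsilon>" "smooth_map (Q l) p" "smooth_map (Q l) r"
  unfolding \<epsilon>_def[abs_def] p_def[abs_def] r_def[abs_def] by (intro smooth_intros)+

text \<open>An orthogonal 2 x 2 matrix with first column \<open>(a, b)\<close> and determinant
  \<open>\<epsilon>\<close> has second column \<open>\<epsilon> (-b, a)\<close>, here
  \<open>(d, c)\<close>.\<close>

lemma c_d:
  assumes "q \<in> Q l"
  shows "c q = \<epsilon> q * a q" "d q = - \<epsilon> q * b q" "(\<epsilon> q)\<^sup>2 = 1"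
proof -
  note o = orthonormal[OF assms]
  have "\<epsilon> q * a q = (a q)\<^sup>2 * c q - b q * (a q * d q)" by (simp add: \<epsilon>_def power2_eq_square algebra_simps)
  also have "\<dots> = ((a q)\<^sup>2 + (b q)\<^sup>2) * c q" using o(3) by (simp add: power2_eq_square algebra_simps) algebra
  finally show c: "c q = \<epsilon> q * a q" using o(1) by simp
  have "- \<epsilon> q * b q = (b q)\<^sup>2 * d q - a q * (b q * c q)" by (simp add: \<epsilon>_def power2_eq_square algebra_simps)
  also have "\<dots> = ((a q)\<^sup>2 + (b q)\<^sup>2) * d q" using o(3) by (simp add: power2_eq_square algebra_simps) algebra
  finally show d: "d q = - \<epsilon> q * b q" using o(1) by simp
  have "(\<epsilon> q)\<^sup>2 * ((a q)\<^sup>2 + (b q)\<^sup>2) = 1"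
    using o(2) unfolding c d by (simp add: power2_eq_square algebra_simps)
  then show "(\<epsilon> q)\<^sup>2 = 1" using o(1) by simp
qed

lemma D_\<epsilon>:
  assumes "q \<in> Q l"
  shows "D1 \<epsilon> q = 0" "D2 \<epsilon> q = 0" "D0 \<epsilon> q = 0"
  using along_unit_valued[OF _ smooth_aux(1) assms c_d(3)] X by auto

text \<open>\<open>X0\<close> is the bracket of \<open>X1\<close> and \<open>X2\<close>. The
  \<open>E\<close>-components of both iterated derivatives equal \<open>- b c / l\<^sup>2\<close>
  and cancel, so only a turning remains.\<close>

lemma E0: "q \<in> Q l \<Longrightarrow> D0 E q = (r q / l) *\<^sub>R rot90 (E q)"
proof -
  assume q: "q \<in> Q l"
  have "D1 (D2 E) q = D1 (\<lambda>x. 0 *\<^sub>R E x + (c x / l) *\<^sub>R rot90 (E x)) q"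
    using q by (intro along_cong) (auto simp: E2)
  also have "\<dots> = (- (b q / l) * (c q / l)) *\<^sub>R E q + (D1 (\<lambda>x. c x / l) q) *\<^sub>R rot90 (E q)"
    using q by (subst along_rotating_frame[OF X(1) smooth(2) _ _ q E1[OF q]])
      (auto simp: along_const[OF X(1)] divide_inverse intro!: smooth_intros)
  finally have 1: "D1 (D2 E) q = \<dots>" .
  have "D2 (D1 E) q = D2 (\<lambda>x. 0 *\<^sub>R E x + (b x / l) *\<^sub>R rot90 (E x)) q"
    using q by (intro along_cong) (auto simp: E1)
  also have "\<dots> = (- (c q / l) * (b q / l)) *\<^sub>R E q + (D2 (\<lambda>x. b x / l) q) *\<^sub>R rot90 (E q)"
    using q by (subst along_rotating_frame[OF X(2) smooth(2) _ _ q E2[OF q]])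
      (auto simp: along_const[OF X(2)] divide_inverse intro!: smooth_intros)
  finally have 2: "D2 (D1 E) q = \<dots>" .
  have 3: "D1 (\<lambda>x. c x / l) q = D1 c q / l" "D2 (\<lambda>x. b x / l) q = D2 b q / l"
    unfolding divide_inverse
    using along_mult[OF X(1) smooth(5) smooth_map_const q] along_mult[OF X(2) smooth(4) smooth_map_const q]
    by (simp_all add: along_const[OF X(1) q] along_const[OF X(2) q])
  show ?thesis
    using along_X_commutators(1)[OF l smooth(2) q, symmetric]
    by (simp add: 1 2 3 r_def diff_divide_distrib scaleR_diff_left)
qed

text \<open>The terms from the turning frame cancel in the \<open>E\<close>-component and combine to
  \<open>(b d - a c) / l = - \<epsilon> / l\<close> in the normal component.\<close>

lemma u0: "q \<in> Q l \<Longrightarrow> D0 u q = p q *\<^sub>R E q + (r q - \<epsilon> q / l) *\<^sub>R rot90 (E q)"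
proof -
  assume q: "q \<in> Q l"
  have "D1 (D2 u) q = D1 (\<lambda>x. d x *\<^sub>R E x + c x *\<^sub>R rot90 (E x)) q"
    using q by (intro along_cong) (auto simp: u2)
  also have "\<dots> = (D1 d q - (b q / l) * c q) *\<^sub>R E q + (D1 c q + (b q / l) * d q) *\<^sub>R rot90 (E q)"
    by (intro along_rotating_frame[OF X(1) smooth(2) _ _ q E1[OF q]] smooth_intros)
  finally have 1: "D1 (D2 u) q = \<dots>" .
  have "D2 (D1 u) q = D2 (\<lambda>x. a x *\<^sub>R E x + b x *\<^sub>R rot90 (E x)) q"
    using q by (intro along_cong) (auto simp: u1)
  also have "\<dots> = (D2 a q - (c q / l) * b q) *\<^sub>R E q + (D2 b q + (c q / l) * a q) *\<^sub>R rot90 (E q)"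
    by (intro along_rotating_frame[OF X(2) smooth(2) _ _ q E2[OF q]] smooth_intros)
  finally have 2: "D2 (D1 u) q = \<dots>" .
  have "D0 u q = (D1 d q - D2 a q) *\<^sub>R E q + (D1 c q - D2 b q - (a q * c q - b q * d q) / l) *\<^sub>R rot90 (E q)"
    using along_X_commutators(1)[OF l smooth(1) q, symmetric]
    by (simp add: 1 2 diff_divide_distrib scaleR_diff_left scaleR_add_left mult.commute)
  then show ?thesis by (simp add: p_def r_def \<epsilon>_def)
qed

text \<open>The two remaining bracket relations, evaluated on \<open>E\<close> and on
  \<open>u\<close> and compared coefficientwise. \<open>E\<close> yields the first two equations;
  inserted into the normal components for \<open>u\<close> they remove all derivatives, which leaves
  the last two, purely algebraic ones. The third is the \<open>E\<close>-component of
  \<open>[X1, X0] u = 0\<close>.\<close>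

lemma structure_equations:
  assumes q: "q \<in> Q l"
  shows "D1 r q = D0 b q" "D2 r q - D0 c q = b q / l\<^sup>2"
    "D1 p q + \<epsilon> q * b q / l\<^sup>2 = D0 a q" "p q * b q = a q * r q" "p q * c q = d q * r q"
proof -
  note e = unit[OF q]
  have div: "D1 (\<lambda>x. f x / l) q = D1 f q / l" "D2 (\<lambda>x. f x / l) q = D2 f q / l" "D0 (\<lambda>x. f x / l) q = D0 f q / l"
    if "smooth_map (Q l) f" for f
    unfolding divide_inverse
    using along_mult[OF X(1) that smooth_map_const q] along_mult[OF X(2) that smooth_map_const q]
      along_mult[OF X(3) that smooth_map_const q] by (simp_all add: X along_const[OF _ q])
  have smdiv: "smooth_map (Q l) (\<lambda>x. f x / l)" if "smooth_map (Q l) f" for f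
    unfolding divide_inverse by (intro smooth_intros that)
  have E_step: "along (Q l) Y (\<lambda>x. (f x / l) *\<^sub>R rot90 (E x)) q =
      (- (\<mu> * f q / l)) *\<^sub>R E q + along (Q l) Y (\<lambda>x. f x / l) q *\<^sub>R rot90 (E q)"
    if "linear_field (Q l) Y" "along (Q l) Y E q = \<mu> *\<^sub>R rot90 (E q)" "smooth_map (Q l) f" for Y \<mu> f
    using along_rotating_frame[OF that(1) smooth(2) smooth_map_const smdiv[OF that(3)] q that(2), of 0]
    by (simp add: along_const[OF that(1) q])
  have DE: "D1 (D0 E) q = (- (b q / l * r q / l)) *\<^sub>R E q + (D1 r q / l) *\<^sub>R rot90 (E q)"
    "D0 (D1 E) q = (- (r q / l * b q / l)) *\<^sub>R E q + (D0 b q / l) *\<^sub>R rot90 (E q)"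
    "D2 (D0 E) q = (- (c q / l * r q / l)) *\<^sub>R E q + (D2 r q / l) *\<^sub>R rot90 (E q)"
    "D0 (D2 E) q = (- (r q / l * c q / l)) *\<^sub>R E q + (D0 c q / l) *\<^sub>R rot90 (E q)"
    using along_cong[of "Q l" "D0 E" _ q, OF E0 q] along_cong[of "Q l" "D1 E" _ q, OF E1 q]
      along_cong[of "Q l" "D2 E" _ q, OF E2 q]
      E_step[OF X(1) E1[OF q] smooth_aux(3)] E_step[OF X(3) E0[OF q] smooth(4)]
      E_step[OF X(2) E2[OF q] smooth_aux(3)] E_step[OF X(3) E0[OF q] smooth(5)]
      div[OF smooth_aux(3)] div[OF smooth(4)] div[OF smooth(5)] by simp_all
  have r\<epsilon>: "smooth_map (Q l) (\<lambda>x. r x - \<epsilon> x / l)" by (intro smooth_intros smdiv smooth_aux)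
  have Dr\<epsilon>: "D1 (\<lambda>x. r x - \<epsilon> x / l) q = D1 r q" "D2 (\<lambda>x. r x - \<epsilon> x / l) q = D2 r q"
    using along_diff[OF X(1) smooth_aux(3) smdiv[OF smooth_aux(1)] q]
      along_diff[OF X(2) smooth_aux(3) smdiv[OF smooth_aux(1)] q] div[OF smooth_aux(1)] D_\<epsilon>[OF q] by simp_all
  have Du: "D1 (D0 u) q = (D1 p q - b q / l * (r q - \<epsilon> q / l)) *\<^sub>R E q + (D1 r q + b q / l * p q) *\<^sub>R rot90 (E q)"
    "D2 (D0 u) q = (D2 p q - c q / l * (r q - \<epsilon> q / l)) *\<^sub>R E q + (D2 r q + c q / l * p q) *\<^sub>R rot90 (E q)"
    "D0 (D1 u) q = (D0 a q - r q / l * b q) *\<^sub>R E q + (D0 b q + r q / l * a q) *\<^sub>R rot90 (E q)"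
    "D0 (D2 u) q = (D0 d q - r q / l * c q) *\<^sub>R E q + (D0 c q + r q / l * d q) *\<^sub>R rot90 (E q)"
    using along_cong[of "Q l" "D0 u" _ q, OF u0 q] along_cong[of "Q l" "D1 u" _ q, OF u1 q]
      along_cong[of "Q l" "D2 u" _ q, OF u2 q]
      along_rotating_frame[OF X(1) smooth(2) smooth_aux(2) r\<epsilon> q E1[OF q]]
      along_rotating_frame[OF X(2) smooth(2) smooth_aux(2) r\<epsilon> q E2[OF q]]
      along_rotating_frame[OF X(3) smooth(2) smooth(3,4) q E0[OF q]]
      along_rotating_frame[OF X(3) smooth(2) smooth(6,5) q E0[OF q]] Dr\<epsilon> by simp_all
  have "D1 r q / l = D0 b q / l"
    using frame_coefficients_eqD(2)[OF e along_X_commutators(2)[OF l smooth(2) q, unfolded DE]] .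
  then show 1: "D1 r q = D0 b q" using l by simp
  have "(- (c q / l * r q / l)) *\<^sub>R E q + (D2 r q / l) *\<^sub>R rot90 (E q)
      = (- (r q / l * c q / l)) *\<^sub>R E q + (D0 c q / l + b q / l / l\<^sup>2) *\<^sub>R rot90 (E q)"
    using along_X_commutators(3)[OF l smooth(2) q, unfolded DE E1[OF q]]
    by (simp add: diff_eq_eq scaleR_add_left divide_inverse mult.commute)
  from frame_coefficients_eqD(2)[OF e this]
  have "l * (D2 r q / l) = l * (D0 c q / l + b q / l / l\<^sup>2)" by simp
  then show 2: "D2 r q - D0 c q = b q / l\<^sup>2" using l by (simp add: distrib_left)
  note u10 = frame_coefficients_eqD[OF e along_X_commutators(2)[OF l smooth(1) q, unfolded Du]]
  show "D1 p q + \<epsilon> q * b q / l\<^sup>2 = D0 a q"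
    using u10(1) by (simp add: right_diff_distrib power2_eq_square mult.commute)
  have "b q * p q = a q * r q" using u10(2) 1 l by (simp add: field_simps)
  then show "p q * b q = a q * r q" by (simp add: mult.commute)
  have "(D2 p q - c q / l * (r q - \<epsilon> q / l)) *\<^sub>R E q + (D2 r q + c q / l * p q) *\<^sub>R rot90 (E q)
     = (D0 d q - r q / l * c q + a q / l\<^sup>2) *\<^sub>R E q + (D0 c q + r q / l * d q + b q / l\<^sup>2) *\<^sub>R rot90 (E q)"
    using along_X_commutators(3)[OF l smooth(1) q, unfolded Du u1[OF q]]
    by (simp add: diff_eq_eq scaleR_add_left divide_inverse mult.commute scaleR_add_right)
  from frame_coefficients_eqD(2)[OF e this] have "c q / l * p q = r q / l * d q" using 2 by (simp add: diff_eq_eq)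
  then show "p q * c q = d q * r q" using l by (simp add: field_simps)
qed

text \<open>With \<open>c = \<epsilon> a\<close> and \<open>d = - \<epsilon> b\<close> the algebraic
  structure equations become the homogeneous system \<open>a p + b r = 0\<close>,
  \<open>b p - a r = 0\<close>, whose determinant is \<open>-1\<close>.\<close>

lemma p_r_zero:
  assumes q: "q \<in> Q l"
  shows "p q = 0" "r q = 0"
proof -
  note s = structure_equations(4,5)[OF q] and o = orthonormal(1)[OF q] and cd = c_d[OF q]
  have "\<epsilon> q * (p q * a q) = \<epsilon> q * (- b q * r q)" using s(2) cd by (simp add: algebra_simps)
  then have pa: "p q * a q = - b q * r q" using cd(3) by (metis mult_cancel_left power_zero_numeral zero_neq_one)
  have "p q = p q * ((a q)\<^sup>2 + (b q)\<^sup>2)" "r q = r q * ((a q)\<^sup>2 + (b q)\<^sup>2)" using o by auto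
  moreover have "p q * ((a q)\<^sup>2 + (b q)\<^sup>2) = (p q * a q) * a q + (p q * b q) * b q"
    by (simp add: power2_eq_square algebra_simps)
  moreover have "r q * ((a q)\<^sup>2 + (b q)\<^sup>2) = (a q * r q) * a q - (- b q * r q) * b q"
    by (simp add: power2_eq_square algebra_simps)
  moreover have "(- b q * r q) * a q + (a q * r q) * b q = 0" "(p q * b q) * a q - (p q * a q) * b q = 0"
    by simp_all
  ultimately show "p q = 0" "r q = 0" using s(1) pa by auto
qed

text \<open>Once \<open>p = r = 0\<close>, the structure equations for \<open>u\<close> and for \<open>E\<close> give \<open>D0 a = \<epsilon> b / l\<^sup>2\<close> and
  \<open>D0 a = - \<epsilon> b / l\<^sup>2\<close>.\<close>

lemma b_d_zero:
  assumes q: "q \<in> Q l"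
  shows "b q = 0" "d q = 0" "(a q)\<^sup>2 = 1"
proof -
  have "D2 r q = 0" "D1 p q = 0"
    using along_cong[of "Q l" r "\<lambda>x. 0" q] along_cong[of "Q l" p "\<lambda>x. 0" q] p_r_zero q
    by (auto simp: along_const[OF _ q] X)
  then have 1: "- D0 c q = b q / l\<^sup>2" "D0 a q = \<epsilon> q * b q / l\<^sup>2"
    using structure_equations[OF q] by auto
  have "D0 c q = D0 (\<lambda>x. \<epsilon> x * a x) q" using c_d q by (intro along_cong) auto
  then have "D0 c q = \<epsilon> q * D0 a q"
    using along_mult[OF X(3) smooth_aux(1) smooth(3) q] D_\<epsilon>[OF q] by simp
  then have "D0 c q = (\<epsilon> q)\<^sup>2 * b q / l\<^sup>2" using 1 by (simp add: power2_eq_square)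
  then show "b q = 0" using 1 c_d(3)[OF q] l by (simp add: field_simps)
  then show "d q = 0" "(a q)\<^sup>2 = 1" using c_d(2)[OF q] orthonormal(1)[OF q] by auto
qed

lemma D_a:
  assumes "q \<in> Q l"
  shows "D1 a q = 0" "D2 a q = 0" "D0 a q = 0"
  using along_unit_valued[OF _ smooth(3) assms b_d_zero(3)] X by auto

lemma a_constant: "q \<in> Q l \<Longrightarrow> q' \<in> Q l \<Longrightarrow> a q = a q'"
  using constant_on_Q[OF l smooth(3) D_a] .

end

context isometry_frame begin

text \<open>\<open>W\<close> is the candidate for the linear part of the Euclidean motion: it carries the frame of \<open>q\<close>
  to the frame of its image, up to the signs \<open>a\<close> and \<open>\<epsilon>\<close>.\<close>

definition W :: "plane \<Rightarrow> plane \<times> plane \<Rightarrow> plane" where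
  "W w q = ((w \<bullet> heading l q) * a q) *\<^sub>R E q + ((w \<bullet> rot90 (heading l q)) * \<epsilon> q) *\<^sub>R rot90 (E q)"

lemma bounded_linear_coordinates:
  "bounded_linear (\<lambda>q. w \<bullet> heading l q)" "bounded_linear (\<lambda>q. w \<bullet> rot90 (heading l q))"
  by (intro bounded_linear_compose[OF bounded_linear_inner_right] bounded_linear_heading
      bounded_linear_compose[OF bounded_linear_rot90])+

lemma smooth_coordinates:
  "smooth_map (Q l) (\<lambda>q. (w \<bullet> heading l q) * a q)"
  "smooth_map (Q l) (\<lambda>q. (w \<bullet> rot90 (heading l q)) * \<epsilon> q)"
  by (intro smooth_map_mult smooth smooth_aux smooth_map_linear bounded_linear_coordinates)+

lemma smooth_W: "smooth_map (Q l) (W w)"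
  unfolding W_def[abs_def]
  by (intro smooth_coordinates smooth_intros smooth_map_bounded_linear[OF bounded_linear_rot90])

lemma D_E:
  assumes q: "q \<in> Q l"
  shows "D1 E q = 0 *\<^sub>R rot90 (E q)" "D2 E q = (\<epsilon> q * a q / l) *\<^sub>R rot90 (E q)" "D0 E q = 0 *\<^sub>R rot90 (E q)"
  using E1[OF q] E2[OF q] E0[OF q] b_d_zero[OF q] p_r_zero[OF q] c_d[OF q] by simp_all

lemma along_W:
  assumes Y: "linear_field (Q l) Y" and q: "q \<in> Q l"
    and turn: "along (Q l) Y E q = \<mu> *\<^sub>R rot90 (E q)" "along (Q l) Y a q = 0" "along (Q l) Y \<epsilon> q = 0"
  shows "along (Q l) Y (W w) q =
     ((w \<bullet> heading l (Y q)) * a q - \<mu> * ((w \<bullet> rot90 (heading l q)) * \<epsilon> q)) *\<^sub>R E q +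
     ((w \<bullet> rot90 (heading l (Y q))) * \<epsilon> q + \<mu> * ((w \<bullet> heading l q) * a q)) *\<^sub>R rot90 (E q)"
proof -
  have "along (Q l) Y (\<lambda>q. (w \<bullet> heading l q) * a q) q = (w \<bullet> heading l (Y q)) * a q"
    using along_mult[OF Y smooth_map_linear[OF bounded_linear_coordinates(1)] smooth(3) q] turn
      along_linear[OF Y bounded_linear_coordinates(1) q] by simp
  moreover have "along (Q l) Y (\<lambda>q. (w \<bullet> rot90 (heading l q)) * \<epsilon> q) q = (w \<bullet> rot90 (heading l (Y q))) * \<epsilon> q"
    using along_mult[OF Y smooth_map_linear[OF bounded_linear_coordinates(2)] smooth_aux(1) q] turn
      along_linear[OF Y bounded_linear_coordinates(2) q] by simp
  ultimately show ?thesis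
    unfolding W_def[abs_def]
    using along_rotating_frame[OF Y smooth(2) smooth_coordinates q turn(1)] by simp
qed

text \<open>Along \<open>X1\<close> and \<open>X0\<close> neither frame turns. Along
  \<open>X2\<close> the frame of \<open>q\<close> turns at rate \<open>1 / l\<close> and that of the
  image at rate \<open>\<epsilon> a / l\<close>; the signs in \<open>W\<close> make the two effects
  cancel because \<open>\<epsilon>\<close> and \<open>a\<close> square to 1.\<close>

lemma W_constant:
  assumes "q \<in> Q l" "q' \<in> Q l"
  shows "W w q = W w q'"
proof (rule constant_on_Q[OF l smooth_W _ _ _ assms])
  fix q assume q: "q \<in> Q l"
  show "D1 (W w) q = 0" "D0 (W w) q = 0"
    using along_W[OF X(1) q D_E(1)[OF q] D_a(1)[OF q] D_\<epsilon>(1)[OF q]]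
      along_W[OF X(3) q D_E(3)[OF q] D_a(3)[OF q] D_\<epsilon>(3)[OF q]] by simp_all
  have "(w \<bullet> heading l (X2 l q)) * a q - \<epsilon> q * a q / l * ((w \<bullet> rot90 (heading l q)) * \<epsilon> q)
      = (w \<bullet> rot90 (heading l q)) / l * a q * (1 - (\<epsilon> q)\<^sup>2)"
    "(w \<bullet> rot90 (heading l (X2 l q))) * \<epsilon> q + \<epsilon> q * a q / l * ((w \<bullet> heading l q) * a q)
      = (w \<bullet> heading l q) / l * \<epsilon> q * ((a q)\<^sup>2 - 1)"
    by (simp_all add: power2_eq_square divide_inverse algebra_simps)
  then show "D2 (W w) q = 0"
    unfolding along_W[OF X(2) q D_E(2)[OF q] D_a(2)[OF q] D_\<epsilon>(2)[OF q]]
    using c_d(3)[OF q] b_d_zero(3)[OF q] by simp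
qed

lemma inner_W:
  assumes q: "q \<in> Q l"
  shows "W v q \<bullet> W w q = v \<bullet> w"
proof -
  note e = heading_unit[OF q l]
  have "W v q \<bullet> W w q = (v \<bullet> heading l q) * (w \<bullet> heading l q) * (a q)\<^sup>2
      + (v \<bullet> rot90 (heading l q)) * (w \<bullet> rot90 (heading l q)) * (\<epsilon> q)\<^sup>2"
    using unit[OF q] by (simp add: W_def inner_add_left inner_add_right power2_eq_square)
  also have "\<dots> = (v \<bullet> heading l q) * (w \<bullet> heading l q) + (v \<bullet> rot90 (heading l q)) * (w \<bullet> rot90 (heading l q))"
    using b_d_zero(3)[OF q] c_d(3)[OF q] by simp
  also have "\<dots> = v \<bullet> w"
    using arg_cong[OF plane_frame_expansion[OF e, of w], of "\<lambda>z. v \<bullet> z"]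
    by (simp add: inner_add_right mult.commute)
  finally show ?thesis .
qed

lemma Q_nonempty: "(0, l *\<^sub>R axis 1 1) \<in> Q l"
  using l by (simp add: Q_iff)

text \<open>\<open>R\<close> is \<open>W\<close> at one chosen configuration and \<open>s\<close>
  the constant sign \<open>a\<close>. The factor \<open>(s - 1) * l\<close> vanishes for
  \<open>s = 1\<close>; for \<open>s = -1\<close> it replaces the front wheel \<open>f\<close> by
  \<open>f - 2 l e = 2 b - f\<close>, the effect of \<open>Phi\<close>.\<close>

lemma rigid_form:
  "\<exists>R t s. orthogonal_transformation R \<and> (s = 1 \<or> s = (-1::real)) \<and>
    (\<forall>q\<in>Q l. E q = s *\<^sub>R R (heading l q) \<and>
       u q = R (snd q) + ((s - 1) * l) *\<^sub>R R (heading l q) + t)"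
proof -
  define q0 :: "plane \<times> plane" where "q0 = (0, l *\<^sub>R axis 1 1)"
  have q0: "q0 \<in> Q l" unfolding q0_def by (rule Q_nonempty)
  define R where "R w = W w q0" for w
  define s where "s = a q0"
  have RW: "R w = W w q" if "q \<in> Q l" for w q unfolding R_def by (rule W_constant[OF q0 that])
  have a: "a q = s" if "q \<in> Q l" for q unfolding s_def by (rule a_constant[OF that q0])
  have lin: "linear R"
    by (intro linearI) (simp_all add: R_def W_def inner_add_left algebra_simps)
  then have orth: "orthogonal_transformation R"
    using inner_W[OF q0] by (simp add: orthogonal_transformation_def R_def)
  have bl: "bounded_linear R" using lin linear_conv_bounded_linear by blast
  have s2: "s * s = 1" using b_d_zero(3)[OF q0] by (simp add: s_def power2_eq_square)
  then have s: "s = 1 \<or> s = -1" by algebra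
  have Re: "R (heading l q) = s *\<^sub>R E q" "R (rot90 (heading l q)) = \<epsilon> q *\<^sub>R rot90 (E q)" if "q \<in> Q l" for q
    using RW[OF that] heading_unit[OF that l] a[OF that] by (simp_all add: W_def)
  \<comment> \<open>The candidate for the translation part; its derivatives along the three fields
    vanish, so it is constant.\<close>
  define T where "T q = u q - (R (snd q) + ((s - 1) * l) *\<^sub>R R (heading l q))" for q
  have blT: "bounded_linear (\<lambda>q. R (snd q) + ((s - 1) * l) *\<^sub>R R (heading l q))"
    by (intro bounded_linear_add bounded_linear_const_scaleR bounded_linear_compose[OF bl]
        bounded_linear_snd bounded_linear_heading)
  have smT: "smooth_map (Q l) T"
    unfolding T_def[abs_def] by (intro smooth_map_diff smooth smooth_map_linear blT)
  have DT: "along (Q l) Y T q = along (Q l) Y u q - (R (snd (Y q)) + ((s - 1) * l) *\<^sub>R R (heading l (Y q)))"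
    if "linear_field (Q l) Y" "q \<in> Q l" for Y q
    unfolding T_def[abs_def] using along_diff[OF that(1) smooth(1) smooth_map_linear[OF blT] that(2)]
      along_linear[OF that(1) blT that(2)] by simp
  have T: "T q = T q0" if "q \<in> Q l" for q
  proof (rule constant_on_Q[OF l smT _ _ _ that q0])
    fix q assume q: "q \<in> Q l"
    show "D1 T q = 0"
      using u1[OF q] b_d_zero[OF q] Re[OF q] a[OF q] linear_0[OF lin]
      by (simp add: DT[OF X(1) q]) (simp add: X1_def)
    have "D2 T q = (\<epsilon> q * s) *\<^sub>R rot90 (E q) - (\<epsilon> q *\<^sub>R rot90 (E q) + (s - 1) *\<^sub>R \<epsilon> q *\<^sub>R rot90 (E q))"
      using u2[OF q] b_d_zero[OF q] c_d[OF q] Re[OF q] a[OF q] linear_cmul[OF lin] l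
      by (simp add: DT[OF X(2) q]) (simp add: X2_def)
    then show "D2 T q = 0" by (simp add: algebra_simps)
    show "D0 T q = 0"
      using u0[OF q] p_r_zero[OF q] Re[OF q] linear_cmul[OF lin] linear_neg[OF lin] linear_0[OF lin]
      by (simp add: DT[OF X(3) q]) (simp add: X0_def divide_inverse mult.commute)
  qed
  show ?thesis
  proof (intro exI conjI ballI)
    fix q assume q: "q \<in> Q l"
    show "E q = s *\<^sub>R R (heading l q)" using Re[OF q] s2 by simp
    show "u q = R (snd q) + ((s - 1) * l) *\<^sub>R R (heading l q) + T q0"
      using T[OF q] unfolding T_def[of q] by (simp add: algebra_simps)
  qed (use orth s in auto)
qed

end

section \<open>The image frame of an isometry and the classification\<close>

lemma bicycle_simps [simp]:
  "pts (bicycle l) = Q l" "met (bicycle l) q v w = snd v \<bullet> snd w"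
  "distr (bicycle l) q = {v \<in> tangent_space (Q l) q. \<exists>c. fst v = c *\<^sub>R (snd q - fst q)}"
  by (simp_all add: bicycle_def)

lemma X_in_distr:
  assumes "q \<in> Q l" "l > 0"
  shows "X1 l q \<in> distr (bicycle l) q" "X2 l q \<in> distr (bicycle l) q"
  using linear_field_X[OF assms(2)] assms(1)
  by (auto simp: linear_field_def X1_def X2_def heading_def intro: exI[of _ "1 / l"] exI[of _ 0])

text \<open>The back wheel does not move sideways, so the frame is turned only by the sideways
  velocity of the front wheel, at radius \<open>l\<close>.\<close>

lemma heading_of_horizontal:
  assumes "q \<in> Q l" "l > 0" "w \<in> distr (bicycle l) q"
  shows "heading l w = ((snd w \<bullet> rot90 (heading l q)) / l) *\<^sub>R rot90 (heading l q)"
proof -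
  note e = heading_unit[OF assms(1,2)]
  obtain k where k: "fst w = k *\<^sub>R (snd q - fst q)" using assms(3) by auto
  have "(snd w - fst w) \<bullet> (snd q - fst q) = 0" using assms by (simp add: tangent_space_Q)
  then have 1: "heading l w \<bullet> heading l q = 0" by (simp add: heading_def)
  have "fst w \<bullet> rot90 (heading l q) = 0"
    by (simp add: k heading_scaled[OF assms(2), symmetric])
  then have "heading l w \<bullet> rot90 (heading l q) = (snd w \<bullet> rot90 (heading l q)) / l"
    by (simp add: heading_def[of l w] inner_diff_left divide_inverse)
  then show ?thesis using plane_frame_expansion[OF e, of "heading l w"] 1 by simp
qed

text \<open>The differential maps \<open>X1\<close> and \<open>X2\<close> to horizontal vectors at
  \<open>F q\<close>, where the no-skid condition gives the turning rates of \<open>E\<close>;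
  preservation of the inner product gives the orthonormality relations.\<close>

lemma isometry_frame_of_isometry:
  assumes l: "l > 0" and F: "sr_isometry (bicycle l) (bicycle l) F"
  defines "u \<equiv> \<lambda>q. snd (F q)" and "E \<equiv> \<lambda>q. heading l (F q)"
  shows "isometry_frame l u E (\<lambda>q. along (Q l) (X1 l) u q \<bullet> E q) (\<lambda>q. along (Q l) (X1 l) u q \<bullet> rot90 (E q))
    (\<lambda>q. along (Q l) (X2 l) u q \<bullet> rot90 (E q)) (\<lambda>q. along (Q l) (X2 l) u q \<bullet> E q)"
proof -
  note X = linear_field_X[OF l]
  have sF: "smooth_map (Q l) F" using F by (simp add: sr_isometry_def diffeo_def)
  have FQ: "F q \<in> Q l" if "q \<in> Q l" for q
    using F that by (auto simp: sr_isometry_def diffeo_def bij_betw_def)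
  have su: "smooth_map (Q l) u" "smooth_map (Q l) E"
    unfolding u_def E_def
    by (intro smooth_map_bounded_linear[OF bounded_linear_snd sF]
        smooth_map_bounded_linear[OF bounded_linear_heading sF])+
  have sN: "smooth_map (Q l) (\<lambda>q. rot90 (E q))"
    by (rule smooth_map_bounded_linear[OF bounded_linear_rot90 su(2)])
  have unit: "E q \<bullet> E q = 1" if "q \<in> Q l" for q
    unfolding E_def using heading_unit FQ that l by blast
  have D: "along (Q l) (X1 l) E q = ((along (Q l) (X1 l) u q \<bullet> rot90 (E q)) / l) *\<^sub>R rot90 (E q) \<and>
      along (Q l) (X2 l) E q = ((along (Q l) (X2 l) u q \<bullet> rot90 (E q)) / l) *\<^sub>R rot90 (E q) \<and>
      along (Q l) (X1 l) u q \<bullet> along (Q l) (X1 l) u q = 1 \<and>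
      along (Q l) (X2 l) u q \<bullet> along (Q l) (X2 l) u q = 1 \<and>
      along (Q l) (X1 l) u q \<bullet> along (Q l) (X2 l) u q = 0" if q: "q \<in> Q l" for q
  proof -
    obtain F' where F': "(F has_derivative F') (at q within Q l)"
      "F' ` distr (bicycle l) q = distr (bicycle l) (F q)"
      "\<And>v w. v \<in> distr (bicycle l) q \<Longrightarrow> w \<in> distr (bicycle l) q \<Longrightarrow> snd (F' v) \<bullet> snd (F' w) = snd v \<bullet> snd w"
      using F q unfolding sr_isometry_def bicycle_simps(1,2) by meson
    have "along (Q l) Y F q = F' (Y q)" if "linear_field (Q l) Y" for Y
      using along_eq[OF _ F'(1)] that q unfolding linear_field_def by blast
    then have Du: "along (Q l) Y u q = snd (F' (Y q))" "along (Q l) Y E q = heading l (F' (Y q))"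
      if "linear_field (Q l) Y" for Y
      unfolding u_def E_def using along_bounded_linear[OF that bounded_linear_snd sF q]
        along_bounded_linear[OF that bounded_linear_heading sF q] that by simp_all
    note d = X_in_distr[OF q l]
    have "F' (X1 l q) \<in> distr (bicycle l) (F q)" "F' (X2 l q) \<in> distr (bicycle l) (F q)"
      using F'(2) d by blast+
    from this[THEN heading_of_horizontal[OF FQ[OF q] l]]
    show ?thesis
      unfolding Du[OF X(1)] Du[OF X(2)] using F'(3)[OF d(1,1)] F'(3)[OF d(2,2)] F'(3)[OF d] heading_unit[OF q l]
      by (simp add: E_def X1_def X2_def)
  qed
  have expand: "(v \<bullet> E q) * (w \<bullet> E q) + (v \<bullet> rot90 (E q)) * (w \<bullet> rot90 (E q)) = v \<bullet> w" if "q \<in> Q l" for v w q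
    using arg_cong[OF plane_frame_expansion[OF unit[OF that], of w], of "\<lambda>z. v \<bullet> z"]
    by (simp add: inner_add_right mult.commute)
  show ?thesis
  proof
    fix q assume q: "q \<in> Q l"
    show "along (Q l) (X1 l) u q = (along (Q l) (X1 l) u q \<bullet> E q) *\<^sub>R E q + (along (Q l) (X1 l) u q \<bullet> rot90 (E q)) *\<^sub>R rot90 (E q)"
      "along (Q l) (X2 l) u q = (along (Q l) (X2 l) u q \<bullet> E q) *\<^sub>R E q + (along (Q l) (X2 l) u q \<bullet> rot90 (E q)) *\<^sub>R rot90 (E q)"
      by (rule plane_frame_expansion[OF unit[OF q]])+
    show "(along (Q l) (X1 l) u q \<bullet> E q)\<^sup>2 + (along (Q l) (X1 l) u q \<bullet> rot90 (E q))\<^sup>2 = 1"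
      "(along (Q l) (X2 l) u q \<bullet> rot90 (E q))\<^sup>2 + (along (Q l) (X2 l) u q \<bullet> E q)\<^sup>2 = 1"
      "(along (Q l) (X1 l) u q \<bullet> E q) * (along (Q l) (X2 l) u q \<bullet> E q) +
       (along (Q l) (X1 l) u q \<bullet> rot90 (E q)) * (along (Q l) (X2 l) u q \<bullet> rot90 (E q)) = 0"
      using D[OF q] expand[OF q] by (simp_all add: power2_eq_square add.commute)
  qed (use l su sN unit D smooth_map_inner smooth_map_along[OF X(1) su(1)] smooth_map_along[OF X(2) su(1)] in auto)
qed

text \<open>Since the back wheel is \<open>snd (F q) - l *\<^sub>R heading l (F q)\<close>, the sign
  \<open>s\<close> drops out of its formula: \<open>(s - 1) * l - l * s = - l\<close>. It survives
  only in the front wheel, separating motions from motions preceded by \<open>Phi\<close>.\<close>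

theorem isometry_classification:
  assumes l: "l > 0" and F: "sr_isometry (bicycle l) (bicycle l) F"
  obtains R t where "orthogonal_transformation R"
    "(\<forall>q\<in>Q l. F q = (R (fst q) + t, R (snd q) + t)) \<or>
     (\<forall>q\<in>Q l. F q = (R (fst q) + t, R (2 *\<^sub>R fst q - snd q) + t))"
proof -
  interpret isometry_frame l "\<lambda>q. snd (F q)" "\<lambda>q. heading l (F q)"
    "\<lambda>q. along (Q l) (X1 l) (\<lambda>q. snd (F q)) q \<bullet> heading l (F q)"
    "\<lambda>q. along (Q l) (X1 l) (\<lambda>q. snd (F q)) q \<bullet> rot90 (heading l (F q))"
    "\<lambda>q. along (Q l) (X2 l) (\<lambda>q. snd (F q)) q \<bullet> rot90 (heading l (F q))"
    "\<lambda>q. along (Q l) (X2 l) (\<lambda>q. snd (F q)) q \<bullet> heading l (F q)"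
    using isometry_frame_of_isometry[OF assms] .
  obtain R t s where R: "orthogonal_transformation R" "s = 1 \<or> s = (-1::real)"
    "\<And>q. q \<in> Q l \<Longrightarrow> heading l (F q) = s *\<^sub>R R (heading l q)"
    "\<And>q. q \<in> Q l \<Longrightarrow> snd (F q) = R (snd q) + ((s - 1) * l) *\<^sub>R R (heading l q) + t"
    using rigid_form by blast
  have lin: "linear R" using R(1) orthogonal_transformation_linear by blast
  have lR: "l *\<^sub>R R (heading l q) = R (snd q) - R (fst q)" for q
    using linear_cmul[OF lin, of l "heading l q"] heading_scaled[OF l, of q] linear_diff[OF lin] by simp
  have f: "fst (F q) = R (fst q) + t" if q: "q \<in> Q l" for q
  proof -
    have "fst (F q) = snd (F q) - l *\<^sub>R heading l (F q)" by (simp add: heading_scaled[OF l])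
    also have "\<dots> = R (snd q) - l *\<^sub>R R (heading l q) + t"
      unfolding R(3,4)[OF q] by (simp add: algebra_simps)
    finally show ?thesis by (simp add: lR)
  qed
  have R2: "R (2 *\<^sub>R fst q - snd q) = R (snd q) - 2 *\<^sub>R (R (snd q) - R (fst q))" for q
    by (simp add: linear_diff[OF lin] linear_cmul[OF lin]) (simp add: scaleR_2)
  show ?thesis
    using R(2)
  proof
    assume "s = 1"
    then show ?thesis using that[OF R(1), of t] f R(4) by (simp add: prod_eq_iff)
  next
    assume s: "s = -1"
    have "snd (F q) = R (2 *\<^sub>R fst q - snd q) + t" if "q \<in> Q l" for q
      using R(4)[OF that] unfolding R2 lR[symmetric] by (simp add: s)
    then show ?thesis using that[OF R(1), of t] f by (simp add: prod_eq_iff)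
  qed
qed

section \<open>Euclidean motions as isometries\<close>

lemma rigid_apply: "rigid p x = fst p *v x + snd p"
  by (simp add: rigid_def)

lemma inj_rigid: "inj rigid"
proof (rule injI)
  fix p q assume pq: "rigid p = rigid q"
  have "snd p = snd q" using fun_cong[OF pq, of 0] by (simp add: rigid_apply)
  moreover have "fst p *v x = fst q *v x" for x
    using fun_cong[OF pq, of x] \<open>snd p = snd q\<close> by (simp add: rigid_apply)
  then have "fst p = fst q" by (simp add: matrix_eq)
  ultimately show "p = q" by (simp add: prod_eq_iff)
qed

lemma rigid_comp: "rigid p \<circ> rigid q = rigid (fst p ** fst q, fst p *v snd q + snd p)"
  by (auto simp: rigid_apply fun_eq_iff matrix_vector_mul_assoc matrix_vector_right_distrib)

lemma rigid_id: "rigid (mat 1, 0) = id"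
  by (auto simp: rigid_apply)

lemma norm_orthogonal_matrix: "orthogonal_matrix A \<Longrightarrow> norm (A *v x) = norm (x :: real^'n)"
  using orthogonal_transformation_matrix[of "(*v) A"] orthogonal_transformation_norm by auto

lemma inner_orthogonal_matrix: "orthogonal_matrix A \<Longrightarrow> (A *v x) \<bullet> (A *v y) = x \<bullet> (y :: real^'n)"
  using orthogonal_transformation_matrix[of "(*v) A"] by (auto simp: orthogonal_transformation_def)

lemma rigid_inverse:
  assumes "orthogonal_matrix (fst p)"
  defines "q \<equiv> (transpose (fst p), - (transpose (fst p) *v snd p))"
  shows "rigid p \<circ> rigid q = id" "rigid q \<circ> rigid p = id" "orthogonal_matrix (fst q)"
  using assms(1) unfolding rigid_comp rigid_id[symmetric]
  by (simp_all add: q_def orthogonal_matrix_def vec.neg matrix_vector_mul_assoc del: transpose_matrix_vector)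

text \<open>Subtracting \<open>g 0\<close> leaves a distance-preserving map that fixes the origin,
  and such a map is linear and orthogonal.\<close>

lemma E2_iff: "g \<in> carrier E2 \<longleftrightarrow> (\<exists>p. orthogonal_matrix (fst p) \<and> g = rigid p)"
proof
  assume "g \<in> carrier E2"
  then have g: "\<And>x y. dist (g x) (g y) = dist x y" by (simp add: E2_def)
  define R where "R x = g x - g 0" for x
  have "R 0 = 0 \<and> (\<forall>x y. dist (R x) (R y) = dist x y)"
    using g by (simp add: R_def dist_norm)
  then have R: "linear R" "orthogonal_matrix (matrix R)"
    using orthogonal_transformation_isometry[of R] orthogonal_transformation_matrix[of R] by auto
  have "g = rigid (matrix R, g 0)"
    using R(1) by (auto simp: fun_eq_iff rigid_apply) (simp add: R_def)
  then show "\<exists>p. orthogonal_matrix (fst p) \<and> g = rigid p" using R(2) by (metis fst_conv)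
next
  assume "\<exists>p. orthogonal_matrix (fst p) \<and> g = rigid p"
  then obtain p where p: "orthogonal_matrix (fst p)" "g = rigid p" by blast
  have "bij g" using rigid_inverse[OF p(1)] p(2) o_bij by blast
  moreover have "dist (g x) (g y) = dist x y" for x y
    using norm_orthogonal_matrix[OF p(1), of "x - y"]
    by (simp add: p(2) rigid_apply dist_norm matrix_vector_mult_diff_distrib)
  ultimately show "g \<in> carrier E2" by (simp add: E2_def)
qed

lemma Bij_UNIV: "Bij UNIV = {g. bij g}"
  by (auto simp: Bij_def)

lemma E2_mult: "g \<in> carrier E2 \<Longrightarrow> h \<in> carrier E2 \<Longrightarrow> g \<otimes>\<^bsub>E2\<^esub> h = g \<circ> h"
  by (auto simp: E2_def BijGroup_def Bij_UNIV compose_def)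

lemma E2_one: "\<one>\<^bsub>E2\<^esub> = id"
  by (auto simp: E2_def BijGroup_def)

lemma group_E2: "group E2"
proof (rule groupI)
  fix g h assume "g \<in> carrier E2" "h \<in> carrier E2"
  then show "g \<otimes>\<^bsub>E2\<^esub> h \<in> carrier E2"
    by (simp add: E2_mult) (auto simp: E2_def bij_comp)
next
  fix g assume g: "g \<in> carrier E2"
  then obtain p where "orthogonal_matrix (fst p)" "g = rigid p" using E2_iff by blast
  with rigid_inverse[OF this(1)] obtain h where "h \<in> carrier E2" "h \<circ> g = id"
    using E2_iff by blast
  then show "\<exists>h\<in>carrier E2. h \<otimes>\<^bsub>E2\<^esub> g = \<one>\<^bsub>E2\<^esub>" using g E2_mult E2_one by auto
next
  fix f g h assume "f \<in> carrier E2" "g \<in> carrier E2" "h \<in> carrier E2"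
  moreover from this have "f \<circ> g \<in> carrier E2" "g \<circ> h \<in> carrier E2" by (auto simp: E2_def bij_comp)
  ultimately show "f \<otimes>\<^bsub>E2\<^esub> g \<otimes>\<^bsub>E2\<^esub> h = f \<otimes>\<^bsub>E2\<^esub> (g \<otimes>\<^bsub>E2\<^esub> h)" by (simp add: E2_mult comp_assoc)
next
  show one: "\<one>\<^bsub>E2\<^esub> \<in> carrier E2" by (simp add: E2_one) (simp add: E2_def)
  fix g assume "g \<in> carrier E2"
  then show "\<one>\<^bsub>E2\<^esub> \<otimes>\<^bsub>E2\<^esub> g = g" using E2_mult[OF one] by (simp add: E2_one)
qed

interpretation E2: group E2 by (rule group_E2)

lemma E2_inv: "g \<in> carrier E2 \<Longrightarrow> h \<in> carrier E2 \<Longrightarrow> h \<circ> g = id \<Longrightarrow> inv\<^bsub>E2\<^esub> g = h"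
  by (rule E2.inv_equality) (auto simp: E2_mult E2_one)

lemma SE2_iff: "g \<in> carrier SE2 \<longleftrightarrow> (\<exists>p. orthogonal_matrix (fst p) \<and> det (fst p) > 0 \<and> g = rigid p)"
  unfolding SE2_def using E2_iff injD[OF inj_rigid] by fastforce

lemma rigid_in_SE2: "rigid p \<in> carrier SE2 \<longleftrightarrow> orthogonal_matrix (fst p) \<and> det (fst p) > 0"
  using SE2_iff injD[OF inj_rigid] by metis

lemma rigid_in_E2: "rigid p \<in> carrier E2 \<longleftrightarrow> orthogonal_matrix (fst p)"
  using E2_iff injD[OF inj_rigid] by metis

lemma subgroup_SE2: "subgroup (carrier SE2) E2"
proof (rule E2.subgroupI)
  show "carrier SE2 \<subseteq> carrier E2" by (auto simp: SE2_def)
  show "carrier SE2 \<noteq> {}" using rigid_in_SE2[of "(mat 1, 0)"] orthogonal_matrix_id by auto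
next
  fix g assume "g \<in> carrier SE2"
  then obtain p where p: "orthogonal_matrix (fst p)" "det (fst p) > 0" "g = rigid p"
    using SE2_iff by blast
  note i = rigid_inverse[OF p(1)]
  have "inv\<^bsub>E2\<^esub> g = rigid (transpose (fst p), - (transpose (fst p) *v snd p))"
    using i p by (intro E2_inv) (auto simp: rigid_in_E2)
  then show "inv\<^bsub>E2\<^esub> g \<in> carrier SE2" using p by (simp add: rigid_in_SE2)
next
  fix g h assume gh: "g \<in> carrier SE2" "h \<in> carrier SE2"
  then obtain p q where "orthogonal_matrix (fst p)" "det (fst p) > 0" "g = rigid p"
    "orthogonal_matrix (fst q)" "det (fst q) > 0" "h = rigid q" using SE2_iff by metis
  then show "g \<otimes>\<^bsub>E2\<^esub> h \<in> carrier SE2"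
    by (simp add: E2_mult rigid_in_E2 rigid_comp rigid_in_SE2 orthogonal_matrix_mul det_mul)
qed

lemma SE2_simps [simp]: "mult SE2 = mult E2" "\<one>\<^bsub>SE2\<^esub> = \<one>\<^bsub>E2\<^esub>"
  by (simp_all add: SE2_def)

lemma SE2_eq: "SE2 = E2\<lparr>carrier := carrier SE2\<rparr>"
  by (simp add: SE2_def)

lemma group_SE2: "group SE2"
  using E2.subgroup_imp_group[OF subgroup_SE2] SE2_eq by simp

lemma SE2_subset_E2: "carrier SE2 \<subseteq> carrier E2"
  using subgroup.subset[OF subgroup_SE2] .

section \<open>Isometries given by affine maps\<close>

lemma tangent_space_affine:
  assumes "bounded_linear L" "\<And>y. y \<in> M \<Longrightarrow> L y + c \<in> N" "v \<in> tangent_space M x"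
  shows "L v \<in> tangent_space N (L x + c)"
proof -
  obtain \<gamma> e where g: "e > 0" "smooth_on {-e<..<e} \<gamma>" "\<gamma> ` {-e<..<e} \<subseteq> M" "\<gamma> (0::real) = x"
    "(\<gamma> has_vector_derivative v) (at 0)"
    using assms(3) unfolding tangent_space_def by blast
  have "smooth_on {-e<..<e} (\<lambda>t. L (\<gamma> t) + c)"
    using g(2) unfolding smooth_on_def
    by (auto intro!: C_on_add C_on_bounded_linear[OF _ assms(1)] C_on_const)
  moreover have "((\<lambda>t. L (\<gamma> t) + c) has_vector_derivative L v) (at 0)"
    using bounded_linear.has_vector_derivative[OF assms(1) g(5)] by (simp add: has_vector_derivative_add_const)
  moreover have "(\<lambda>t. L (\<gamma> t) + c) ` {-e<..<e} \<subseteq> N" using g(3) assms(2) by auto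
  ultimately show ?thesis unfolding tangent_space_def using g(1,4) by blast
qed

text \<open>Bicycle maps, orbit maps and left translations are all restrictions of affine maps whose
  inverse is also affine; the linear part is then the differential. The map \<open>L'\<close> is
  required to invert \<open>L\<close> only on the manifolds and the distributions, as suits the
  orbit map between ambient spaces of dimensions 6 and 4.\<close>

lemma sr_isometry_affine:
  assumes L: "bounded_linear L" "bounded_linear L'"
    and F: "\<And>x. x \<in> pts S \<Longrightarrow> F x = L x + c" "\<And>x. x \<in> pts S \<Longrightarrow> F x \<in> pts T"
    and F': "\<And>y. y \<in> pts T \<Longrightarrow> L' y + c' \<in> pts S" "\<And>y. y \<in> pts T \<Longrightarrow> F (L' y + c') = y"
      "\<And>x. x \<in> pts S \<Longrightarrow> L' (F x) + c' = x"
    and distr: "\<And>x v. x \<in> pts S \<Longrightarrow> v \<in> distr S x \<Longrightarrow> L v \<in> distr T (F x)"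
      "\<And>x w. x \<in> pts S \<Longrightarrow> w \<in> distr T (F x) \<Longrightarrow> L' w \<in> distr S x \<and> L (L' w) = w"
    and met: "\<And>x v w. x \<in> pts S \<Longrightarrow> v \<in> distr S x \<Longrightarrow> w \<in> distr S x \<Longrightarrow> met T (F x) (L v) (L w) = met S x v w"
  shows "sr_isometry S T F"
proof -
  have bij: "bij_betw F (pts S) (pts T)"
    by (rule bij_betw_byWitness[where f' = "\<lambda>y. L' y + c'"]) (use F F' in auto)
  have inv: "inv_into (pts S) F y = L' y + c'" if "y \<in> pts T" for y
    by (rule inv_into_f_eq) (use bij F' that in \<open>auto simp: bij_betw_def\<close>)
  have "smooth_map (pts S) F" "smooth_map (pts T) (inv_into (pts S) F)"
    by (rule smooth_map_cong[OF _ smooth_map_add[OF smooth_map_linear[OF L(1)] smooth_map_const, of _ c]],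
        simp add: F(1),
        rule smooth_map_cong[OF _ smooth_map_add[OF smooth_map_linear[OF L(2)] smooth_map_const, of _ c']],
        simp add: inv)
  then have "diffeo (pts S) (pts T) F" using bij by (simp add: diffeo_def)
  moreover have "\<exists>F'. (F has_derivative F') (at x within pts S) \<and> F' ` distr S x = distr T (F x) \<and>
        (\<forall>u\<in>distr S x. \<forall>v\<in>distr S x. met T (F x) (F' u) (F' v) = met S x u v)" if x: "x \<in> pts S" for x
  proof (intro exI[of _ L] conjI ballI)
    have "((\<lambda>x. L x + c) has_derivative L) (at x within pts S)"
      using has_derivative_add[OF bounded_linear_imp_has_derivative[OF L(1)] has_derivative_const] by simp
    then show "(F has_derivative L) (at x within pts S)"
      by (rule has_derivative_transform[OF x, rotated]) (rule F(1))
    show "L ` distr S x = distr T (F x)"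
    proof (intro subset_antisym subsetI)
      fix w assume "w \<in> distr T (F x)"
      then show "w \<in> L ` distr S x" using distr(2)[OF x] by (metis imageI)
    qed (use distr(1)[OF x] in auto)
  qed (use met[OF x] in auto)
  ultimately show ?thesis unfolding sr_isometry_def by blast
qed

text \<open>\<open>\<sigma> = 1\<close> is the action of a Euclidean motion, \<open>\<sigma> = -1\<close> its composition with \<^const>\<open>Phi\<close>.\<close>

definition bike_map :: "(real^2^2) \<times> plane \<Rightarrow> real \<Rightarrow> plane \<times> plane \<Rightarrow> plane \<times> plane" where
  "bike_map p \<sigma> q = (rigid p (fst q), rigid p (fst q + \<sigma> *\<^sub>R (snd q - fst q)))"

lemma rigid_diff: "rigid p x - rigid p y = fst p *v (x - y)"
  by (simp add: rigid_apply matrix_vector_mult_diff_distrib)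

lemma bike_map_difference: "snd (bike_map p \<sigma> q) - fst (bike_map p \<sigma> q) = \<sigma> *\<^sub>R (fst p *v (snd q - fst q))"
  by (simp add: bike_map_def rigid_diff scaleR_matrix_vector_assoc[symmetric] matrix_vector_mult_scaleR)

lemma bike_map_in_Q:
  assumes "orthogonal_matrix (fst p)" "\<sigma> = 1 \<or> \<sigma> = -1" "q \<in> Q l"
  shows "bike_map p \<sigma> q \<in> Q l"
  using assms norm_orthogonal_matrix[OF assms(1), of "snd q - fst q"]
  unfolding Q_iff bike_map_difference by auto

definition bike_linear :: "real^2^2 \<Rightarrow> real \<Rightarrow> plane \<times> plane \<Rightarrow> plane \<times> plane" where
  "bike_linear A \<sigma> v = (A *v fst v, A *v (fst v + \<sigma> *\<^sub>R (snd v - fst v)))"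

lemma bounded_linear_bike_linear: "bounded_linear (bike_linear A \<sigma>)"
  unfolding bike_linear_def[abs_def]
  by (intro bounded_linear_Pair bounded_linear_compose[OF matrix_vector_mul_bounded_linear]
      bounded_linear_add bounded_linear_const_scaleR bounded_linear_sub bounded_linear_fst bounded_linear_snd)

lemma bike_linear_comp: "bike_linear A \<sigma> (bike_linear B \<tau> v) = bike_linear (A ** B) (\<sigma> * \<tau>) v"
  by (simp add: bike_linear_def matrix_vector_mul_assoc[symmetric] matrix_vector_mult_scaleR
      matrix_vector_right_distrib matrix_vector_mult_diff_distrib)

lemma bike_map_affine: "bike_map p \<sigma> q = bike_linear (fst p) \<sigma> q + (snd p, snd p)"
  by (simp add: bike_map_def bike_linear_def rigid_apply)

lemma bike_linear_distr:
  assumes "orthogonal_matrix (fst p)" "\<sigma> = 1 \<or> \<sigma> = -1" "q \<in> Q l" "v \<in> distr (bicycle l) q"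
  shows "bike_linear (fst p) \<sigma> v \<in> distr (bicycle l) (bike_map p \<sigma> q)"
proof -
  obtain c where c: "fst v = c *\<^sub>R (snd q - fst q)" and v: "v \<in> tangent_space (Q l) q" using assms(4) by auto
  have "bike_linear (fst p) \<sigma> v \<in> tangent_space (Q l) (bike_map p \<sigma> q)"
    unfolding bike_map_affine
    by (rule tangent_space_affine[OF bounded_linear_bike_linear _ v])
      (use bike_map_in_Q[OF assms(1,2)] in \<open>simp flip: bike_map_affine\<close>)
  \<comment> \<open>Since \<open>\<sigma>\<close> is a sign, the multiplier
    \<open>c * \<sigma>\<close> undoes the factor \<open>\<sigma>\<close> in the image
    frame.\<close>
  moreover have "fst (bike_linear (fst p) \<sigma> v) = (c * \<sigma>) *\<^sub>R (snd (bike_map p \<sigma> q) - fst (bike_map p \<sigma> q))"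
    using assms(2) c by (auto simp: bike_map_difference) (auto simp: bike_linear_def matrix_vector_mult_scaleR)
  ultimately show ?thesis by auto
qed

text \<open>For a horizontal vector the front velocity is the sum of the rolling part
  \<open>fst v\<close>, along the frame, and the turning part \<open>snd v - fst v\<close>, normal
  to it. The sign affects only the latter, so mixed terms vanish and the others keep their
  value.\<close>

lemma bike_linear_met:
  assumes "orthogonal_matrix A" "\<sigma> = 1 \<or> \<sigma> = -1" "q \<in> Q l" "l > 0"
    "v \<in> distr (bicycle l) q" "w \<in> distr (bicycle l) q"
  shows "snd (bike_linear A \<sigma> v) \<bullet> snd (bike_linear A \<sigma> w) = snd v \<bullet> snd w"
proof -
  obtain c d where cd: "fst v = c *\<^sub>R (snd q - fst q)" "fst w = d *\<^sub>R (snd q - fst q)" using assms by auto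
  have "(snd v - fst v) \<bullet> (snd q - fst q) = 0" "(snd w - fst w) \<bullet> (snd q - fst q) = 0"
    using assms by (auto simp: tangent_space_Q)
  then have z: "fst v \<bullet> (snd w - fst w) = 0" "(snd v - fst v) \<bullet> fst w = 0"
    unfolding cd by (simp_all add: inner_commute)
  have "(fst v + \<sigma> *\<^sub>R (snd v - fst v)) \<bullet> (fst w + \<sigma> *\<^sub>R (snd w - fst w)) =
      fst v \<bullet> fst w + \<sigma> * \<sigma> * ((snd v - fst v) \<bullet> (snd w - fst w))"
    using z by (simp only: inner_add_left inner_add_right inner_scaleR_left inner_scaleR_right) simp
  also have "\<dots> = (fst v + (snd v - fst v)) \<bullet> (fst w + (snd w - fst w))"
    using z assms(2) by (simp only: inner_add_left inner_add_right) auto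
  finally show ?thesis by (simp add: bike_linear_def inner_orthogonal_matrix[OF assms(1)])
qed

lemma rigid_combination: "rigid p (x + c *\<^sub>R (y - x)) = rigid p x + c *\<^sub>R (rigid p y - rigid p x)"
  by (simp add: rigid_apply matrix_vector_right_distrib matrix_vector_mult_diff_distrib matrix_vector_mult_scaleR)

text \<open>Affine maps preserve \<open>x + \<sigma> (y - x)\<close>, so the sign passes through the
  motion and the two data multiply independently. This is why \<open>Phi\<close> is central.\<close>

lemma bike_map_comp:
  "bike_map p \<sigma> (bike_map p' \<sigma>' q) = bike_map (fst p ** fst p', fst p *v snd p' + snd p) (\<sigma> * \<sigma>') q"
proof -
  have "rigid p (rigid p' x) = rigid (fst p ** fst p', fst p *v snd p' + snd p) x" for x
    using fun_cong[OF rigid_comp, of p p' x] by simp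
  then show ?thesis
    by (simp add: bike_map_def rigid_combination)
qed

text \<open>The inverse is the bicycle map of the inverse motion with the same sign, so preservation
  of the distribution, applied to \<open>p'\<close>, also gives surjectivity onto the
  fibres.\<close>

lemma bike_map_isometry:
  assumes p: "orthogonal_matrix (fst p)" and \<sigma>: "\<sigma> = 1 \<or> \<sigma> = -1" and l: "l > 0"
    and F: "\<And>q. q \<in> Q l \<Longrightarrow> F q = bike_map p \<sigma> q"
  shows "sr_isometry (bicycle l) (bicycle l) F"
proof -
  define p' where "p' = (transpose (fst p), - (transpose (fst p) *v snd p))"
  have p': "orthogonal_matrix (fst p')" using p by (simp add: p'_def)
  have inv: "bike_map p \<sigma> (bike_map p' \<sigma> q) = q" "bike_map p' \<sigma> (bike_map p \<sigma> q) = q" for q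
    using \<sigma> rigid_inverse(1,2)[OF p] unfolding bike_map_comp rigid_comp p'_def
    by (auto simp: bike_map_def)
  have "fst p ** fst p' = mat 1" using p by (simp add: p'_def orthogonal_matrix_def)
  then have lin: "bike_linear (fst p) \<sigma> (bike_linear (fst p') \<sigma> v) = v" for v
    using \<sigma> by (auto simp: bike_linear_comp) (auto simp: bike_linear_def)
  show ?thesis
  proof (rule sr_isometry_affine[OF bounded_linear_bike_linear bounded_linear_bike_linear,
        of _ F "fst p" \<sigma> "(snd p, snd p)" _ "fst p'" \<sigma> "(snd p', snd p')"])
    fix q assume q: "q \<in> pts (bicycle l)"
    then have q': "q \<in> Q l" by simp
    show "F q = bike_linear (fst p) \<sigma> q + (snd p, snd p)" using F[OF q'] by (simp add: bike_map_affine)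
    show "F q \<in> pts (bicycle l)" using F[OF q'] bike_map_in_Q[OF p \<sigma> q'] by simp
    show "bike_linear (fst p') \<sigma> q + (snd p', snd p') \<in> pts (bicycle l)"
      using bike_map_in_Q[OF p' \<sigma> q'] by (simp add: bike_map_affine)
    then show "F (bike_linear (fst p') \<sigma> q + (snd p', snd p')) = q"
      unfolding bicycle_simps bike_map_affine[symmetric] using F inv by simp
    show "bike_linear (fst p') \<sigma> (F q) + (snd p', snd p') = q"
      unfolding bike_map_affine[symmetric] using F[OF q'] inv by simp
    show "bike_linear (fst p) \<sigma> v \<in> distr (bicycle l) (F q)" if "v \<in> distr (bicycle l) q" for v
      using bike_linear_distr[OF p \<sigma> q' that] F[OF q'] by simp
    show "bike_linear (fst p') \<sigma> w \<in> distr (bicycle l) q \<and> bike_linear (fst p) \<sigma> (bike_linear (fst p') \<sigma> w) = w"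
      if "w \<in> distr (bicycle l) (F q)" for w
      using bike_linear_distr[OF p' \<sigma> bike_map_in_Q[OF p \<sigma> q'], of w] that lin inv F[OF q'] by simp
    show "met (bicycle l) (F q) (bike_linear (fst p) \<sigma> v) (bike_linear (fst p) \<sigma> w) = met (bicycle l) q v w"
      if "v \<in> distr (bicycle l) q" "w \<in> distr (bicycle l) q" for v w
      using bike_linear_met[OF p \<sigma> q' l that] by simp
  qed
qed

lemma isometry_iff_bike_map:
  assumes "l > 0"
  shows "sr_isometry (bicycle l) (bicycle l) F \<longleftrightarrow>
    (\<exists>p \<sigma>. orthogonal_matrix (fst p) \<and> (\<sigma> = 1 \<or> \<sigma> = -1) \<and> (\<forall>q\<in>Q l. F q = bike_map p \<sigma> q))"
proof
  assume "sr_isometry (bicycle l) (bicycle l) F"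
  then obtain R t where R: "orthogonal_transformation R"
    "(\<forall>q\<in>Q l. F q = (R (fst q) + t, R (snd q) + t)) \<or>
     (\<forall>q\<in>Q l. F q = (R (fst q) + t, R (2 *\<^sub>R fst q - snd q) + t))"
    by (rule isometry_classification[OF assms])
  then have m: "linear R" "orthogonal_matrix (matrix R)" by (auto simp: orthogonal_transformation_matrix)
  have "R x + t = rigid (matrix R, t) x" for x using m by (simp add: rigid_apply)
  with R(2) have "(\<forall>q\<in>Q l. F q = bike_map (matrix R, t) 1 q) \<or> (\<forall>q\<in>Q l. F q = bike_map (matrix R, t) (-1) q)"
    by (simp add: bike_map_def scaleR_2)
  then show "\<exists>p \<sigma>. orthogonal_matrix (fst p) \<and> (\<sigma> = 1 \<or> \<sigma> = -1) \<and> (\<forall>q\<in>Q l. F q = bike_map p \<sigma> q)"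
    using m(2) by (metis fst_conv)
qed (use bike_map_isometry assms in blast)

section \<open>The group of isometries\<close>

text \<open>The matrix of multiplication by the complex number \<open>z\<close>: a rotation when
  \<open>z\<close> has norm 1, and linear in \<open>z\<close>, so that the rotations become a circle
  in a plane of matrices.\<close>

definition turn :: "plane \<Rightarrow> real^2^2" where
  "turn z = (\<chi> i j. if i = j then z $ 1 else if i = 1 then - z $ 2 else z $ 2)"

lemma turn_nth [simp]: "turn z $ 1 $ 1 = z $ 1" "turn z $ 1 $ 2 = - z $ 2"
    "turn z $ 2 $ 1 = z $ 2" "turn z $ 2 $ 2 = z $ 1"
  by (simp_all add: turn_def)

lemma turn_apply: "turn z *v x = z $ 1 *\<^sub>R x + z $ 2 *\<^sub>R rot90 x"
  by (simp add: plane_eq_iff matrix_vector_mult_def sum_2)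

lemma matrix22_eq_iff: "(A :: real^2^2) = B \<longleftrightarrow>
    A $ 1 $ 1 = B $ 1 $ 1 \<and> A $ 1 $ 2 = B $ 1 $ 2 \<and> A $ 2 $ 1 = B $ 2 $ 1 \<and> A $ 2 $ 2 = B $ 2 $ 2"
  by (auto simp: vec_eq_iff forall_2)

lemma orthogonal_matrix_22: "orthogonal_matrix (A :: real^2^2) \<longleftrightarrow>
    A $ 1 $ 1 * A $ 1 $ 1 + A $ 2 $ 1 * A $ 2 $ 1 = 1 \<and>
    A $ 1 $ 1 * A $ 1 $ 2 + A $ 2 $ 1 * A $ 2 $ 2 = 0 \<and>
    A $ 1 $ 2 * A $ 1 $ 2 + A $ 2 $ 2 * A $ 2 $ 2 = 1"
  unfolding orthogonal_matrix matrix22_eq_iff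
  by (auto simp: matrix_matrix_mult_def transpose_def mat_def sum_2 mult.commute)

lemma orthogonal_det_pos_iff:
  "orthogonal_matrix A \<and> det A > 0 \<longleftrightarrow> (\<exists>z. z \<bullet> z = 1 \<and> A = turn z)"
proof
  assume A: "orthogonal_matrix A \<and> det A > 0"
  define a b c d where "a = A $ 1 $ 1" "b = A $ 1 $ 2" "c = A $ 2 $ 1" "d = A $ 2 $ 2"
  note abcd = this
  have "det A = 1" using A det_orthogonal_matrix[of A] by auto
  then have dt: "a * d - b * c = 1" by (simp add: det_2 abcd)
  have o: "a * a + c * c = 1" "a * b + c * d = 0" using A by (auto simp: orthogonal_matrix_22 abcd)
  have "d = a" using dt o by algebra
  moreover have "b = - c" using dt o by algebra
  ultimately show "\<exists>z. z \<bullet> z = 1 \<and> A = turn z"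
    using o by (intro exI[of _ "\<chi> i. if i = 1 then a else c"]) (simp add: plane_inner matrix22_eq_iff abcd)
next
  assume "\<exists>z. z \<bullet> z = 1 \<and> A = turn z"
  then show "orthogonal_matrix A \<and> det A > 0"
    by (auto simp: orthogonal_matrix_22 plane_inner det_2)
qed

lemma SE2_turn: "g \<in> carrier SE2 \<longleftrightarrow> (\<exists>z t. z \<bullet> z = 1 \<and> g = rigid (turn z, t))"
proof -
  have "g \<in> carrier SE2 \<longleftrightarrow> (\<exists>A t. (orthogonal_matrix A \<and> det A > 0) \<and> g = rigid (A, t))"
    by (auto simp: SE2_iff)
  then show ?thesis unfolding orthogonal_det_pos_iff by blast
qed

lemma turn_unique:
  assumes "turn z *v x = turn w *v x" "x \<noteq> 0"
  shows "z = w"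
proof -
  have "(z $ 1 - w $ 1) *\<^sub>R x + (z $ 2 - w $ 2) *\<^sub>R rot90 x = 0"
    using assms(1) by (simp add: turn_apply scaleR_diff_left) (simp add: algebra_simps)
  from arg_cong[OF this, of "\<lambda>v. v \<bullet> x"] arg_cong[OF this, of "\<lambda>v. v \<bullet> rot90 x"]
  have "(z $ 1 - w $ 1) * (x \<bullet> x) = 0" "(z $ 2 - w $ 2) * (x \<bullet> x) = 0"
    by (simp_all add: inner_add_left)
  then have "z $ 1 = w $ 1" "z $ 2 = w $ 2" using assms(2) by auto
  then show ?thesis by (simp add: plane_eq_iff)
qed

lemma id_in_E2: "id \<in> carrier E2"
  using E2.one_closed E2_one by simp

abbreviation P2 :: "((plane \<Rightarrow> plane) \<times> int) monoid" where
  "P2 \<equiv> E2 \<times>\<times> Z2"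

lemma Z2_carrier: "carrier Z2 = {0, 1}"
  by (auto simp: carrier_integer_mod_group)

lemma group_P2: "group P2"
  by (rule DirProd_group[OF group_E2 group_integer_mod_group])

text \<open>The isometry \<open>act l g\<close> composed with the \<open>k\<close>-th power of
  \<open>Phi\<close>, the residues 0 and 1 becoming the signs 1 and -1. By the classification it
  maps the direct product \<open>P2\<close> bijectively onto the isometries, and the group
  statements are transported along it.\<close>

definition iso_map :: "real \<Rightarrow> (plane \<Rightarrow> plane) \<times> int \<Rightarrow> plane \<times> plane \<Rightarrow> plane \<times> plane" where
  "iso_map l x = (\<lambda>q\<in>Q l. (fst x (fst q), fst x (fst q + (if snd x = 0 then 1 else -1) *\<^sub>R (snd q - fst q))))"

lemma iso_map_rigid: "iso_map l (rigid p, k) = restrict (bike_map p (if k = 0 then 1 else -1)) (Q l)"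
  by (auto simp: iso_map_def bike_map_def restrict_def fun_eq_iff)

lemma act_eq_iso_map: "act l g = iso_map l (g, 0)"
  by (auto simp: act_def iso_map_def split_beta)

lemma Phi_eq_iso_map: "Phi l = iso_map l (id, 1)"
  by (auto simp: Phi_def iso_map_def split_beta scaleR_2)

lemma IsomQ_simps [simp]:
  "carrier (IsomQ l) = {F \<in> extensional (Q l). sr_isometry (bicycle l) (bicycle l) F}"
  "mult (IsomQ l) = mult (BijGroup (Q l))" "\<one>\<^bsub>IsomQ l\<^esub> = \<one>\<^bsub>BijGroup (Q l)\<^esub>"
  by (simp_all add: IsomQ_def)

context
  fixes l :: real
  assumes l: "l > 0"
begin

lemma iso_map_image: "iso_map l ` carrier P2 = carrier (IsomQ l)"
proof (intro subset_antisym subsetI)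
  fix F assume "F \<in> iso_map l ` carrier P2"
  then obtain p k where p: "orthogonal_matrix (fst p)" "F = iso_map l (rigid p, k)"
    by (auto simp: DirProd_def E2_iff)
  then have "sr_isometry (bicycle l) (bicycle l) F"
    by (intro bike_map_isometry[OF p(1) _ l, of "if k = 0 then 1 else -1"]) (auto simp: iso_map_rigid)
  then show "F \<in> carrier (IsomQ l)" by (simp add: p(2) iso_map_rigid)
next
  fix F assume "F \<in> carrier (IsomQ l)"
  then have "F \<in> extensional (Q l)" "sr_isometry (bicycle l) (bicycle l) F" by simp_all
  then obtain p \<sigma> where p: "F \<in> extensional (Q l)" "orthogonal_matrix (fst p)" "\<sigma> = 1 \<or> \<sigma> = -1"
    "\<forall>q\<in>Q l. F q = bike_map p \<sigma> q" using isometry_iff_bike_map[OF l, THEN iffD1] by blast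
  define k :: int where "k = (if \<sigma> = 1 then 0 else 1)"
  have "F = iso_map l (rigid p, k)"
    unfolding iso_map_rigid using p by (intro extensionalityI[of _ "Q l"]) (auto simp: k_def)
  moreover have "(rigid p, k) \<in> carrier P2" using p by (auto simp: rigid_in_E2 Z2_carrier k_def)
  ultimately show "F \<in> iso_map l ` carrier P2" by blast
qed

lemma IsomQ_subset_Bij: "carrier (IsomQ l) \<subseteq> Bij (Q l)"
  by (auto simp: Bij_def sr_isometry_def diffeo_def)

text \<open>The target is the group of all bijections, where composition is already a group law. The
  isometries then form a group as the image of a homomorphism, with no chain rule and no separate
  treatment of inverses.\<close>

lemma iso_map_hom: "iso_map l \<in> hom P2 (BijGroup (Q l))"
proof (rule homI)
  fix x assume "x \<in> carrier P2"
  then show B: "iso_map l x \<in> carrier (BijGroup (Q l))"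
    using iso_map_image IsomQ_subset_Bij by (auto simp: BijGroup_def)
  fix y assume y: "y \<in> carrier P2"
  then have B': "iso_map l y \<in> carrier (BijGroup (Q l))"
    using iso_map_image IsomQ_subset_Bij by (auto simp: BijGroup_def)
  obtain p k where p: "orthogonal_matrix (fst p)" "x = (rigid p, k)" "k \<in> {0, 1}"
    using \<open>x \<in> carrier P2\<close> by (auto simp: E2_iff Z2_carrier)
  obtain p' k' where p': "orthogonal_matrix (fst p')" "y = (rigid p', k')" "k' \<in> {0, 1}"
    using y by (auto simp: E2_iff Z2_carrier)
  have "x \<otimes>\<^bsub>P2\<^esub> y = (rigid (fst p ** fst p', fst p *v snd p' + snd p), (k + k') mod 2)"
    using p p' by (simp add: E2_mult rigid_in_E2 rigid_comp)
  moreover have "compose (Q l) (iso_map l x) (iso_map l y)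
      = iso_map l (rigid (fst p ** fst p', fst p *v snd p' + snd p), (k + k') mod 2)"
    using p p' bike_map_in_Q[OF p'(1), of "if k' = 0 then 1 else -1" _ l]
    by (intro ext) (auto simp: iso_map_rigid compose_def bike_map_comp)
  ultimately show "iso_map l (x \<otimes>\<^bsub>P2\<^esub> y) = iso_map l x \<otimes>\<^bsub>BijGroup (Q l)\<^esub> iso_map l y"
    using B B' by (simp add: BijGroup_def)
qed

lemma iso_map_inj: "inj_on (iso_map l) (carrier P2)"
proof (rule inj_onI)
  fix x y assume x: "x \<in> carrier P2" and y: "y \<in> carrier P2" and eq: "iso_map l x = iso_map l y"
  \<comment> \<open>The back wheel takes every position in the plane and its image is independent of
    the sign, so \<open>fst x\<close> is recovered; one configuration then tells the two signs
    apart.\<close>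
  have q: "(b, b + l *\<^sub>R axis 1 1) \<in> Q l" for b using l by (simp add: Q_iff)
  have "fst (iso_map l x (b, b + l *\<^sub>R axis 1 1)) = fst x b"
    "fst (iso_map l y (b, b + l *\<^sub>R axis 1 1)) = fst y b" for b
    using q by (simp_all add: iso_map_def)
  then have f: "fst x = fst y" using eq by (simp add: fun_eq_iff)
  have "inj (fst x)" using x by (auto simp: E2_def bij_def)
  moreover have "snd (iso_map l x (0, 0 + l *\<^sub>R axis 1 1)) = fst x ((if snd x = 0 then 1 else -1) *\<^sub>R l *\<^sub>R axis 1 1)"
    "snd (iso_map l y (0, 0 + l *\<^sub>R axis 1 1)) = fst y ((if snd y = 0 then 1 else -1) *\<^sub>R l *\<^sub>R axis 1 1)"
    using q[of 0] by (simp_all add: iso_map_def)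
  ultimately have "(if snd x = 0 then 1 else -1) *\<^sub>R l *\<^sub>R (axis 1 1 :: plane)
      = (if snd y = 0 then 1 else -1) *\<^sub>R l *\<^sub>R axis 1 1"
    using eq f by (metis injD)
  then have "snd x = 0 \<longleftrightarrow> snd y = 0" using l by (auto split: if_splits simp: axis_def vec_eq_iff)
  then have "snd x = snd y" using x y by (auto simp: Z2_carrier)
  then show "x = y" using f by (simp add: prod_eq_iff)
qed

lemma group_IsomQ: "group (IsomQ l)"
proof -
  interpret group_hom P2 "BijGroup (Q l)" "iso_map l"
    using group_P2 group_BijGroup iso_map_hom by (simp add: group_hom_def group_hom_axioms_def)
  have "IsomQ l = BijGroup (Q l)\<lparr>carrier := iso_map l ` carrier P2\<rparr>"
    unfolding iso_map_image by (simp add: IsomQ_def)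
  then show ?thesis using H.subgroup_imp_group[OF img_is_subgroup] by simp
qed

lemma iso_map_iso: "iso_map l \<in> iso P2 (IsomQ l)"
  using iso_map_hom iso_map_inj iso_map_image
  by (auto simp: iso_def bij_betw_def hom_def Pi_iff simp del: IsomQ_simps(1))

lemma iso_map_mult:
  assumes "g \<in> carrier E2" "h \<in> carrier E2" "j \<in> carrier Z2" "k \<in> carrier Z2"
  shows "iso_map l (g, j) \<otimes>\<^bsub>IsomQ l\<^esub> iso_map l (h, k) = iso_map l (g \<circ> h, (j + k) mod 2)"
  using hom_mult[OF iso_map_hom, of "(g, j)" "(h, k)"] assms by (simp add: E2_mult)

lemma iso_map_closed: "g \<in> carrier E2 \<Longrightarrow> k \<in> carrier Z2 \<Longrightarrow> iso_map l (g, k) \<in> carrier (IsomQ l)"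
  using iso_map_image by fastforce

lemma iso_map_eq_iff:
  assumes "g \<in> carrier E2" "h \<in> carrier E2" "j \<in> carrier Z2" "k \<in> carrier Z2"
  shows "iso_map l (g, j) = iso_map l (h, k) \<longleftrightarrow> g = h \<and> j = k"
  using inj_on_eq_iff[OF iso_map_inj, of "(g, j)" "(h, k)"] assms by simp

lemma IsomQ_cases:
  assumes "x \<in> carrier (IsomQ l)"
  shows "\<exists>g k. g \<in> carrier E2 \<and> k \<in> carrier Z2 \<and> x = iso_map l (g, k)"
  using assms unfolding iso_map_image[symmetric] by auto

lemma IsomQ_one: "\<one>\<^bsub>IsomQ l\<^esub> = iso_map l (id, 0)"
  using hom_one[OF iso_map_hom group_P2 group_BijGroup]
  by (simp add: E2_one)

text \<open>Elements of \<open>Z2\<close> are represented by the integers 0 and 1, so only these two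
  exponents occur.\<close>

lemma pow_involution:
  assumes "x \<in> carrier (IsomQ l)" "k \<in> carrier Z2"
  shows "x [^]\<^bsub>IsomQ l\<^esub> (k :: int) = (if k = 0 then \<one>\<^bsub>IsomQ l\<^esub> else x)"
proof -
  interpret group "IsomQ l" by (rule group_IsomQ)
  show ?thesis using assms int_pow_1[OF assms(1)] int_pow_0 by (auto simp: Z2_carrier simp del: IsomQ_simps)
qed

lemma Phi_closed: "Phi l \<in> carrier (IsomQ l)"
  unfolding Phi_eq_iso_map by (rule iso_map_closed[OF id_in_E2]) (simp add: Z2_carrier)

lemma Phi_pow: "k \<in> carrier Z2 \<Longrightarrow> Phi l [^]\<^bsub>IsomQ l\<^esub> (k :: int) = iso_map l (id, k)"
  using pow_involution[OF Phi_closed] by (auto simp: Z2_carrier Phi_eq_iso_map IsomQ_one simp del: IsomQ_simps)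

lemma act_Phi_pow:
  assumes "g \<in> carrier E2" "k \<in> carrier Z2"
  shows "act l g \<otimes>\<^bsub>IsomQ l\<^esub> Phi l [^]\<^bsub>IsomQ l\<^esub> (k :: int) = iso_map l (g, k)"
  using iso_map_mult[OF assms(1) id_in_E2 _ assms(2), of 0] assms
  by (auto simp: Phi_pow act_eq_iso_map Z2_carrier simp del: IsomQ_simps)

lemma Phi_involution: "Phi l \<otimes>\<^bsub>IsomQ l\<^esub> Phi l = \<one>\<^bsub>IsomQ l\<^esub>"
  using iso_map_mult[OF id_in_E2 id_in_E2, of 1 1]
  by (simp add: Z2_carrier Phi_eq_iso_map IsomQ_one del: IsomQ_simps)

lemma Phi_pow_mon: "(\<lambda>k. Phi l [^]\<^bsub>IsomQ l\<^esub> k) \<in> mon Z2 (IsomQ l)"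
proof -
  have "(\<lambda>k. Phi l [^]\<^bsub>IsomQ l\<^esub> k) \<in> hom Z2 (IsomQ l)"
  proof (rule homI)
    fix j k assume jk: "j \<in> carrier Z2" "k \<in> carrier Z2"
    then have "(j + k) mod 2 \<in> carrier Z2" by (auto simp: Z2_carrier)
    then show "Phi l [^]\<^bsub>IsomQ l\<^esub> (j \<otimes>\<^bsub>Z2\<^esub> k) = Phi l [^]\<^bsub>IsomQ l\<^esub> j \<otimes>\<^bsub>IsomQ l\<^esub> Phi l [^]\<^bsub>IsomQ l\<^esub> k"
      using iso_map_mult[OF id_in_E2 id_in_E2 jk] jk by (simp add: Phi_pow del: IsomQ_simps)
  qed (use iso_map_closed[OF id_in_E2] in \<open>simp add: Phi_pow del: IsomQ_simps\<close>)
  moreover have "inj_on (\<lambda>k. Phi l [^]\<^bsub>IsomQ l\<^esub> k) (carrier Z2)"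
    using iso_map_eq_iff[OF id_in_E2 id_in_E2] by (intro inj_onI) (simp add: Phi_pow del: IsomQ_simps)
  ultimately show ?thesis by (simp add: mon_def)
qed

lemma card_generate_Phi: "card (generate (IsomQ l) {Phi l}) = 2"
proof -
  have hom: "(\<lambda>k. Phi l [^]\<^bsub>IsomQ l\<^esub> k) \<in> hom Z2 (IsomQ l)" using Phi_pow_mon by (simp add: mon_def)
  interpret group_hom Z2 "IsomQ l" "\<lambda>k. Phi l [^]\<^bsub>IsomQ l\<^esub> k"
    using group_IsomQ hom by (simp add: group_hom_def group_hom_axioms_def)
  have img: "(\<lambda>k. Phi l [^]\<^bsub>IsomQ l\<^esub> k) ` carrier Z2 = {\<one>\<^bsub>IsomQ l\<^esub>, Phi l}"
    using Phi_pow by (auto simp: Z2_carrier Phi_eq_iso_map IsomQ_one simp del: IsomQ_simps)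
  have "generate (IsomQ l) {Phi l} = {\<one>\<^bsub>IsomQ l\<^esub>, Phi l}"
  proof (rule subset_antisym)
    show "generate (IsomQ l) {Phi l} \<subseteq> {\<one>\<^bsub>IsomQ l\<^esub>, Phi l}"
      unfolding img[symmetric] by (rule H.generate_subgroup_incl[OF _ img_is_subgroup]) (simp add: img)
    show "{\<one>\<^bsub>IsomQ l\<^esub>, Phi l} \<subseteq> generate (IsomQ l) {Phi l}"
      by (intro insert_subsetI empty_subsetI generate.one generate.incl singletonI)
  qed
  moreover have "\<one>\<^bsub>IsomQ l\<^esub> \<noteq> Phi l"
    using iso_map_eq_iff[OF id_in_E2 id_in_E2, of 0 1]
    by (simp add: Z2_carrier Phi_eq_iso_map IsomQ_one del: IsomQ_simps)
  ultimately show ?thesis by simp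
qed

lemma act_mon: "act l \<in> mon E2 (IsomQ l)"
proof -
  have "act l \<in> hom E2 (IsomQ l)"
  proof (rule homI)
    fix g h assume "g \<in> carrier E2" "h \<in> carrier E2"
    then show "act l (g \<otimes>\<^bsub>E2\<^esub> h) = act l g \<otimes>\<^bsub>IsomQ l\<^esub> act l h"
      using iso_map_mult[of g h 0 0] by (simp add: act_eq_iso_map E2_mult Z2_carrier del: IsomQ_simps)
  qed (use iso_map_closed in \<open>simp add: act_eq_iso_map Z2_carrier del: IsomQ_simps\<close>)
  moreover have "inj_on (act l) (carrier E2)"
    using iso_map_eq_iff[of _ _ 0 0] by (intro inj_onI) (simp add: act_eq_iso_map Z2_carrier)
  ultimately show ?thesis by (simp add: mon_def)
qed

text \<open>The two components of the inverse \<open>\<psi>\<close> of \<open>iso_map l\<close> are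
  the quotient maps of the two extensions. The explicit values of \<open>\<psi>\<close> are kept
  because they show that both extensions split.\<close>

lemma extensions:
  "\<exists>\<psi>. group_extension Z2 (IsomQ l) E2 (\<lambda>k. Phi l [^]\<^bsub>IsomQ l\<^esub> k) (\<lambda>x. fst (\<psi> x)) \<and>
    group_extension E2 (IsomQ l) Z2 (act l) (\<lambda>x. snd (\<psi> x)) \<and>
    (\<forall>g\<in>carrier E2. \<forall>k\<in>carrier Z2. \<psi> (iso_map l (g, k)) = (g, k))"
proof -
  define \<psi> where "\<psi> = inv_into (carrier P2) (iso_map l)"
  have \<psi>: "\<psi> (iso_map l (g, k)) = (g, k)" if "g \<in> carrier E2" "k \<in> carrier Z2" for g k
    unfolding \<psi>_def using inv_into_f_f[OF iso_map_inj, of "(g, k)"] that by simp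
  have zero: "0 \<in> carrier Z2" by simp
  have fst_hom: "(\<lambda>x. fst (\<psi> x)) \<in> hom (IsomQ l) E2"
  proof (rule homI)
    fix x y assume "x \<in> carrier (IsomQ l)" "y \<in> carrier (IsomQ l)"
    then obtain g k h j where "g \<in> carrier E2" "k \<in> carrier Z2" "x = iso_map l (g, k)"
      "h \<in> carrier E2" "j \<in> carrier Z2" "y = iso_map l (h, j)" by (meson IsomQ_cases)
    then show "fst (\<psi> (x \<otimes>\<^bsub>IsomQ l\<^esub> y)) = fst (\<psi> x) \<otimes>\<^bsub>E2\<^esub> fst (\<psi> y)"
      using iso_map_mult[of g h k j] \<psi>[of "g \<circ> h" "(k + j) mod 2"] E2.m_closed[of g h]
      by (auto simp: \<psi> E2_mult Z2_carrier simp del: IsomQ_simps)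
  next
    fix x assume "x \<in> carrier (IsomQ l)"
    then show "fst (\<psi> x) \<in> carrier E2" by (metis IsomQ_cases \<psi> fst_conv)
  qed
  have snd_hom: "(\<lambda>x. snd (\<psi> x)) \<in> hom (IsomQ l) Z2"
  proof (rule homI)
    fix x y assume "x \<in> carrier (IsomQ l)" "y \<in> carrier (IsomQ l)"
    then obtain g k h j where "g \<in> carrier E2" "k \<in> carrier Z2" "x = iso_map l (g, k)"
      "h \<in> carrier E2" "j \<in> carrier Z2" "y = iso_map l (h, j)" by (meson IsomQ_cases)
    then show "snd (\<psi> (x \<otimes>\<^bsub>IsomQ l\<^esub> y)) = snd (\<psi> x) \<otimes>\<^bsub>Z2\<^esub> snd (\<psi> y)"
      using iso_map_mult[of g h k j] \<psi>[of "g \<circ> h" "(k + j) mod 2"] E2.m_closed[of g h]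
      by (auto simp: \<psi> E2_mult Z2_carrier simp del: IsomQ_simps)
  next
    fix x assume "x \<in> carrier (IsomQ l)"
    then show "snd (\<psi> x) \<in> carrier Z2" by (metis IsomQ_cases \<psi> snd_conv)
  qed
  have E2_surj: "g \<in> (\<lambda>x. fst (\<psi> x)) ` carrier (IsomQ l)" if "g \<in> carrier E2" for g
    using iso_map_closed[OF that zero] \<psi>[OF that zero] by (metis fst_conv image_eqI)
  have Z2_surj: "k \<in> (\<lambda>x. snd (\<psi> x)) ` carrier (IsomQ l)" if "k \<in> carrier Z2" for k
    using iso_map_closed[OF id_in_E2 that] \<psi>[OF id_in_E2 that] by (metis snd_conv image_eqI)
  have "kernel (IsomQ l) E2 (\<lambda>x. fst (\<psi> x)) = (\<lambda>k. Phi l [^]\<^bsub>IsomQ l\<^esub> k) ` carrier Z2"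
  proof (intro subset_antisym subsetI)
    fix x assume x: "x \<in> kernel (IsomQ l) E2 (\<lambda>x. fst (\<psi> x))"
    then have "x \<in> carrier (IsomQ l)" by (simp add: kernel_def)
    then obtain g k where "g \<in> carrier E2" "k \<in> carrier Z2" "x = iso_map l (g, k)"
      by (meson IsomQ_cases)
    then show "x \<in> (\<lambda>k. Phi l [^]\<^bsub>IsomQ l\<^esub> k) ` carrier Z2"
      using x \<psi> Phi_pow by (auto simp: kernel_def E2_one simp del: IsomQ_simps)
  next
    fix x assume "x \<in> (\<lambda>k. Phi l [^]\<^bsub>IsomQ l\<^esub> k) ` carrier Z2"
    then show "x \<in> kernel (IsomQ l) E2 (\<lambda>x. fst (\<psi> x))"
      using Phi_pow \<psi>[OF id_in_E2] iso_map_closed[OF id_in_E2]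
      by (auto simp: kernel_def E2_one simp del: IsomQ_simps)
  qed
  moreover have "kernel (IsomQ l) Z2 (\<lambda>x. snd (\<psi> x)) = act l ` carrier E2"
  proof (intro subset_antisym subsetI)
    fix x assume x: "x \<in> kernel (IsomQ l) Z2 (\<lambda>x. snd (\<psi> x))"
    then have "x \<in> carrier (IsomQ l)" by (simp add: kernel_def)
    then obtain g k where "g \<in> carrier E2" "k \<in> carrier Z2" "x = iso_map l (g, k)"
      by (meson IsomQ_cases)
    then show "x \<in> act l ` carrier E2"
      using x \<psi> by (auto simp: kernel_def act_eq_iso_map simp del: IsomQ_simps)
  next
    fix x assume "x \<in> act l ` carrier E2"
    then show "x \<in> kernel (IsomQ l) Z2 (\<lambda>x. snd (\<psi> x))"
      using \<psi>[OF _ zero] iso_map_closed[OF _ zero]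
      by (auto simp: kernel_def act_eq_iso_map simp del: IsomQ_simps)
  qed
  moreover have "(\<lambda>x. fst (\<psi> x)) \<in> epi (IsomQ l) E2" "(\<lambda>x. snd (\<psi> x)) \<in> epi (IsomQ l) Z2"
    using fst_hom snd_hom E2_surj Z2_surj by (auto simp: epi_iff_subset simp del: IsomQ_simps)
  ultimately show ?thesis
    using Phi_pow_mon act_mon group_IsomQ group_E2 \<psi>
    by (intro exI[of _ \<psi>]) (simp add: group_extension_def del: IsomQ_simps)
qed

text \<open>\<open>Phi\<close> commutes with all motions, so the action is trivial and the
  semidirect product is the direct one. The restriction to the carrier is the extensional identity,
  the unit of \<open>AutoGroup E2\<close>.\<close>

lemma semidirect_E2:
  defines "\<theta> \<equiv> \<lambda>k::int. \<lambda>g\<in>carrier E2. g"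
  shows "\<theta> \<in> hom Z2 (AutoGroup E2)"
    "(\<lambda>(g, k). act l g \<otimes>\<^bsub>IsomQ l\<^esub> Phi l [^]\<^bsub>IsomQ l\<^esub> k) \<in> iso (semidirect E2 Z2 \<theta>) (IsomQ l)"
proof -
  show "\<theta> \<in> hom Z2 (AutoGroup E2)"
    using E2.id_in_auto id_Bij[of "carrier E2"]
    by (auto intro!: homI simp: \<theta>_def AutoGroup_def BijGroup_def compose_def)
  let ?f = "\<lambda>(g, k). act l g \<otimes>\<^bsub>IsomQ l\<^esub> Phi l [^]\<^bsub>IsomQ l\<^esub> k"
  have car: "carrier (semidirect E2 Z2 \<theta>) = carrier P2" by (simp add: semidirect_def)
  have f: "?f x = iso_map l x" if "x \<in> carrier P2" for x
    using act_Phi_pow that by (auto simp del: IsomQ_simps)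
  have mlt: "x \<otimes>\<^bsub>semidirect E2 Z2 \<theta>\<^esub> y = x \<otimes>\<^bsub>P2\<^esub> y" if "x \<in> carrier P2" "y \<in> carrier P2" for x y
    using that by (auto simp: semidirect_def \<theta>_def)
  have "bij_betw ?f (carrier P2) (carrier (IsomQ l))"
    using iso_map_iso f by (subst bij_betw_cong[where g = "iso_map l"]) (auto simp: iso_def simp del: IsomQ_simps)
  moreover have "?f \<in> hom (semidirect E2 Z2 \<theta>) (IsomQ l)"
  proof (rule homI, unfold car)
    fix x assume x: "x \<in> carrier P2"
    show "?f x \<in> carrier (IsomQ l)" unfolding f[OF x] using x iso_map_image by blast
    fix y assume y: "y \<in> carrier P2"
    have "x \<otimes>\<^bsub>P2\<^esub> y \<in> carrier P2" by (rule monoid.m_closed[OF group.is_monoid[OF group_P2] x y])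
    then show "?f (x \<otimes>\<^bsub>semidirect E2 Z2 \<theta>\<^esub> y) = ?f x \<otimes>\<^bsub>IsomQ l\<^esub> ?f y"
      unfolding mlt[OF x y] f[OF x] f[OF y] using f hom_mult[OF iso_map_hom x y] by simp
  qed
  ultimately show "?f \<in> iso (semidirect E2 Z2 \<theta>) (IsomQ l)"
    unfolding iso_def car by blast
qed

end

section \<open>A reflection and the splitting over the orientation-preserving motions\<close>

definition flip_matrix :: "real^2^2" where
  "flip_matrix = (\<chi> i j. if i = j then (if i = 1 then 1 else -1) else 0)"

text \<open>What matters about this reflection is that it reverses orientation and has order
  two.\<close>

definition flip :: "plane \<Rightarrow> plane" where
  "flip = rigid (flip_matrix, 0)"

lemma flip_matrix: "orthogonal_matrix flip_matrix" "det flip_matrix = -1" "flip_matrix ** flip_matrix = mat 1"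
  by (simp_all add: flip_matrix_def orthogonal_matrix_22 det_2 matrix22_eq_iff matrix_matrix_mult_def sum_2 mat_def)

lemma flip_flip: "flip \<circ> flip = id"
  by (simp add: flip_def rigid_comp rigid_id flip_matrix)

lemma flip_in_E2: "flip \<in> carrier E2"
  by (simp add: flip_def rigid_in_E2 flip_matrix)

lemma comp_flip_in_SE2_iff: "g \<in> carrier E2 \<Longrightarrow> g \<circ> flip \<in> carrier SE2 \<longleftrightarrow> g \<notin> carrier SE2"
  and flip_comp_in_SE2_iff: "g \<in> carrier E2 \<Longrightarrow> flip \<circ> g \<in> carrier SE2 \<longleftrightarrow> g \<notin> carrier SE2"
proof -
  assume "g \<in> carrier E2"
  then obtain p where p: "orthogonal_matrix (fst p)" "g = rigid p" using E2_iff by blast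
  then have "det (fst p) = 1 \<or> det (fst p) = -1" using det_orthogonal_matrix by blast
  then show "g \<circ> flip \<in> carrier SE2 \<longleftrightarrow> g \<notin> carrier SE2" "flip \<circ> g \<in> carrier SE2 \<longleftrightarrow> g \<notin> carrier SE2"
    using p by (auto simp: flip_def rigid_comp rigid_in_SE2 det_mul flip_matrix orthogonal_matrix_mul)
qed

lemma flip_notin_SE2: "flip \<notin> carrier SE2"
  by (simp add: flip_def rigid_in_SE2 flip_matrix)

lemma E2_comp_closed: "g \<in> carrier E2 \<Longrightarrow> h \<in> carrier E2 \<Longrightarrow> g \<circ> h \<in> carrier E2"
  using E2.m_closed by (simp add: E2_mult)

definition flip_pow :: "int \<Rightarrow> plane \<Rightarrow> plane" where
  "flip_pow j = (if j = 0 then id else flip)"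

lemma flip_pow_in_E2: "flip_pow j \<in> carrier E2"
  using flip_in_E2 id_in_E2 by (simp add: flip_pow_def)

lemma flip_pow_add:
  "i \<in> carrier Z2 \<Longrightarrow> j \<in> carrier Z2 \<Longrightarrow> flip_pow i \<circ> flip_pow j = flip_pow ((i + j) mod 2)"
  by (auto simp: Z2_carrier flip_pow_def flip_flip)

lemma flip_pow_cancel [simp]: "flip_pow j (flip_pow j x) = x"
  using fun_cong[OF flip_flip] by (simp add: flip_pow_def)

text \<open>The action of the Klein four-group on \<open>SE2\<close>: the first factor conjugates by
  the reflection, which is its own inverse; the second stands for \<open>Phi\<close> and acts
  trivially. The restriction to the carrier is there because automorphisms are taken
  extensional.\<close>

definition flip_conj :: "int \<times> int \<Rightarrow> (plane \<Rightarrow> plane) \<Rightarrow> plane \<Rightarrow> plane" where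
  "flip_conj h = (\<lambda>g\<in>carrier SE2. flip_pow (fst h) \<circ> g \<circ> flip_pow (fst h))"

lemma flip_conj_closed: "g \<in> carrier SE2 \<Longrightarrow> flip_conj h g \<in> carrier SE2"
  using comp_flip_in_SE2_iff[of "flip \<circ> g"] flip_comp_in_SE2_iff[of g] SE2_subset_E2
    E2_comp_closed[OF flip_in_E2, of g]
  by (auto simp: flip_conj_def flip_pow_def)

lemma flip_conj_inverse: "g \<in> carrier SE2 \<Longrightarrow> flip_conj h (flip_conj h g) = g"
  using flip_conj_closed[of g h] by (auto simp: flip_conj_def fun_eq_iff)

lemma flip_conj_auto: "flip_conj h \<in> auto SE2"
proof -
  have "bij_betw (flip_conj h) (carrier SE2) (carrier SE2)"
    by (rule bij_betw_byWitness[where f' = "flip_conj h"]) (auto simp: flip_conj_inverse flip_conj_closed)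
  moreover have "flip_conj h \<in> hom SE2 SE2"
  proof (rule homI)
    fix f g assume fg: "f \<in> carrier SE2" "g \<in> carrier SE2"
    have "f \<circ> g \<in> carrier SE2"
      using group.is_monoid[OF group_SE2] fg monoid.m_closed[of SE2 f g] SE2_subset_E2 by (auto simp: E2_mult subset_iff)
    then show "flip_conj h (f \<otimes>\<^bsub>SE2\<^esub> g) = flip_conj h f \<otimes>\<^bsub>SE2\<^esub> flip_conj h g"
      using fg SE2_subset_E2 flip_conj_closed[OF fg(1), of h] flip_conj_closed[OF fg(2), of h]
      by (simp add: E2_mult subset_iff) (auto simp: flip_conj_def fun_eq_iff)
  qed (rule flip_conj_closed)
  ultimately show ?thesis by (simp add: auto_def Bij_def flip_conj_def)
qed

lemma flip_conj_hom: "flip_conj \<in> hom (Z2 \<times>\<times> Z2) (AutoGroup SE2)"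
proof (rule homI)
  fix x y assume xy: "x \<in> carrier (Z2 \<times>\<times> Z2)" "y \<in> carrier (Z2 \<times>\<times> Z2)"
  \<comment> \<open>Both orders occur: in the double conjugation the left factors appear as
    \<open>x\<close>, \<open>y\<close> and the right factors as \<open>y\<close>,
    \<open>x\<close>.\<close>
  then have "flip_pow (fst x) \<circ> flip_pow (fst y) = flip_pow (fst (x \<otimes>\<^bsub>Z2 \<times>\<times> Z2\<^esub> y))"
    "flip_pow (fst y) \<circ> flip_pow (fst x) = flip_pow (fst (x \<otimes>\<^bsub>Z2 \<times>\<times> Z2\<^esub> y))"
    using flip_pow_add by (auto simp: add.commute)
  then have "compose (carrier SE2) (flip_conj x) (flip_conj y) = flip_conj (x \<otimes>\<^bsub>Z2 \<times>\<times> Z2\<^esub> y)"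
    using flip_conj_closed[of _ y] unfolding flip_conj_def[of x] flip_conj_def[of "x \<otimes>\<^bsub>Z2 \<times>\<times> Z2\<^esub> y"] compose_def
    by (intro restrict_ext) (auto simp: flip_conj_def fun_eq_iff)
  then show "flip_conj (x \<otimes>\<^bsub>Z2 \<times>\<times> Z2\<^esub> y) = flip_conj x \<otimes>\<^bsub>AutoGroup SE2\<^esub> flip_conj y"
    using flip_conj_auto by (simp add: AutoGroup_def BijGroup_def auto_def)
qed (simp add: AutoGroup_def flip_conj_auto)

context
  fixes l :: real
  assumes l: "l > 0"
begin

lemma act_flip_Phi:
  assumes "g \<in> carrier E2" "j \<in> carrier Z2" "k \<in> carrier Z2"
  shows "act l g \<otimes>\<^bsub>IsomQ l\<^esub> act l flip [^]\<^bsub>IsomQ l\<^esub> j \<otimes>\<^bsub>IsomQ l\<^esub> Phi l [^]\<^bsub>IsomQ l\<^esub> k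
    = iso_map l (g \<circ> flip_pow j, k)"
proof -
  have z: "0 \<in> carrier Z2" by simp
  have "act l flip \<in> carrier (IsomQ l)"
    unfolding act_eq_iso_map by (rule iso_map_closed[OF l flip_in_E2 z])
  then have "act l flip [^]\<^bsub>IsomQ l\<^esub> j = iso_map l (flip_pow j, 0)"
    using pow_involution[OF l _ assms(2)] IsomQ_one[OF l]
    by (simp add: flip_pow_def act_eq_iso_map del: IsomQ_simps)
  then have "act l g \<otimes>\<^bsub>IsomQ l\<^esub> act l flip [^]\<^bsub>IsomQ l\<^esub> j = act l (g \<circ> flip_pow j)"
    using iso_map_mult[OF l assms(1) flip_pow_in_E2 z z] by (simp add: act_eq_iso_map del: IsomQ_simps)
  then show ?thesis
    using act_Phi_pow[OF l E2_comp_closed[OF assms(1) flip_pow_in_E2] assms(3)] by simp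
qed

text \<open>Every motion is uniquely \<open>g \<circ> flip_pow j\<close> with \<open>g\<close>
  orientation preserving, where \<open>j\<close> is read off from its orientation; together with the
  factor \<open>Phi\<close> this gives bijectivity.\<close>

lemma semidirect_SE2:
  "(\<lambda>(g, j, k). act l g \<otimes>\<^bsub>IsomQ l\<^esub> act l flip [^]\<^bsub>IsomQ l\<^esub> j \<otimes>\<^bsub>IsomQ l\<^esub> Phi l [^]\<^bsub>IsomQ l\<^esub> k)
    \<in> iso (semidirect SE2 (Z2 \<times>\<times> Z2) flip_conj) (IsomQ l)" (is "?f \<in> iso ?S _")
proof -
  have SE: "g \<in> carrier E2" if "g \<in> carrier SE2" for g using that SE2_subset_E2 by blast
  have f: "?f (g, j, k) = iso_map l (g \<circ> flip_pow j, k)"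
    if "g \<in> carrier SE2" "j \<in> carrier Z2" "k \<in> carrier Z2" for g j k
    using act_flip_Phi[OF SE[OF that(1)] that(2,3)] by (simp del: IsomQ_simps)
  have car: "x \<in> carrier ?S \<longleftrightarrow> (\<exists>g j k. x = (g, j, k) \<and> g \<in> carrier SE2 \<and> j \<in> carrier Z2 \<and> k \<in> carrier Z2)" for x
    by (cases x) (auto simp: semidirect_def)
  have "?f \<in> hom ?S (IsomQ l)"
  proof (rule homI)
    fix x assume "x \<in> carrier ?S"
    then obtain g j k where x: "x = (g, j, k)" "g \<in> carrier SE2" "j \<in> carrier Z2" "k \<in> carrier Z2"
      using car by blast
    then show "?f x \<in> carrier (IsomQ l)"
      using f iso_map_closed[OF l E2_comp_closed[OF SE flip_pow_in_E2]] by (simp del: IsomQ_simps)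
    fix y assume "y \<in> carrier ?S"
    then obtain g' j' k' where y: "y = (g', j', k')" "g' \<in> carrier SE2" "j' \<in> carrier Z2" "k' \<in> carrier Z2"
      using car by blast
    have c: "flip_conj (j, k) g' \<in> carrier SE2" by (rule flip_conj_closed[OF y(2)])
    have gc: "g \<circ> flip_conj (j, k) g' \<in> carrier SE2"
      using monoid.m_closed[OF group.is_monoid[OF group_SE2] x(2) c] SE[OF x(2)] SE[OF c] by (simp add: E2_mult)
    have jk: "(j + j') mod 2 \<in> carrier Z2" "(k + k') mod 2 \<in> carrier Z2" using x y by (auto simp: Z2_carrier)
    have "x \<otimes>\<^bsub>?S\<^esub> y = (g \<circ> flip_conj (j, k) g', (j + j') mod 2, (k + k') mod 2)"
      using x y SE[OF x(2)] SE[OF c] by (simp add: semidirect_def E2_mult)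
    then have "?f (x \<otimes>\<^bsub>?S\<^esub> y) = iso_map l (g \<circ> flip_conj (j, k) g' \<circ> flip_pow ((j + j') mod 2), (k + k') mod 2)"
      using f[OF gc jk] by (simp del: IsomQ_simps)
    \<comment> \<open>The right half of the conjugation cancels against the
      \<open>flip_pow j\<close> contained in \<open>flip_pow ((j + j') mod 2)\<close>, which is the
      point of twisting the product.\<close>
    also have "g \<circ> flip_conj (j, k) g' \<circ> flip_pow ((j + j') mod 2) = (g \<circ> flip_pow j) \<circ> (g' \<circ> flip_pow j')"
      using y(2) by (simp add: flip_pow_add[OF x(3) y(3), symmetric] flip_conj_def fun_eq_iff)
    also have "iso_map l (\<dots>, (k + k') mod 2) = ?f x \<otimes>\<^bsub>IsomQ l\<^esub> ?f y"
      unfolding x(1) y(1) f[OF x(2-4)] f[OF y(2-4)]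
      by (rule iso_map_mult[OF l E2_comp_closed[OF SE[OF x(2)] flip_pow_in_E2]
            E2_comp_closed[OF SE[OF y(2)] flip_pow_in_E2] x(4) y(4), symmetric])
    finally show "?f (x \<otimes>\<^bsub>?S\<^esub> y) = ?f x \<otimes>\<^bsub>IsomQ l\<^esub> ?f y" .
  qed
  moreover have "inj_on ?f (carrier ?S)"
  proof (rule inj_onI)
    fix x y assume "x \<in> carrier ?S" "y \<in> carrier ?S" and eq: "?f x = ?f y"
    then obtain g j k g' j' k' where x: "x = (g, j, k)" "g \<in> carrier SE2" "j \<in> carrier Z2" "k \<in> carrier Z2"
      and y: "y = (g', j', k')" "g' \<in> carrier SE2" "j' \<in> carrier Z2" "k' \<in> carrier Z2" using car by meson
    have "iso_map l (g \<circ> flip_pow j, k) = iso_map l (g' \<circ> flip_pow j', k')"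
      using eq f[OF x(2-4)] f[OF y(2-4)] by (simp add: x(1) y(1) del: IsomQ_simps)
    then have gk: "g \<circ> flip_pow j = g' \<circ> flip_pow j'" "k = k'"
      using iso_map_eq_iff[OF l E2_comp_closed[OF SE flip_pow_in_E2] E2_comp_closed[OF SE flip_pow_in_E2]]
        x(2,4) y(2,4) by blast+
    \<comment> \<open>The common motion preserves orientation exactly when \<open>j\<close> is 0,
      and likewise exactly when \<open>j'\<close> is 0.\<close>
    have "j = j'"
      using gk(1) x(2,3) y(2,3) comp_flip_in_SE2_iff[OF SE[OF x(2)]] comp_flip_in_SE2_iff[OF SE[OF y(2)]]
      by (auto simp: Z2_carrier flip_pow_def)
    moreover have "g = g \<circ> flip_pow j \<circ> flip_pow j" "g' = g' \<circ> flip_pow j' \<circ> flip_pow j'"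
      by (simp_all add: fun_eq_iff)
    ultimately show "x = y" using gk x(1) y(1) by metis
  qed
  moreover have "carrier (IsomQ l) \<subseteq> ?f ` carrier ?S"
  proof
    fix F assume "F \<in> carrier (IsomQ l)"
    then obtain h k where h: "h \<in> carrier E2" "k \<in> carrier Z2" "F = iso_map l (h, k)"
      using IsomQ_cases[OF l] by blast
    define j :: int where "j = (if h \<in> carrier SE2 then 0 else 1)"
    have j: "j \<in> carrier Z2" by (simp add: j_def Z2_carrier)
    have g: "h \<circ> flip_pow j \<in> carrier SE2"
      using comp_flip_in_SE2_iff[OF h(1)] by (simp add: j_def flip_pow_def)
    have "h \<circ> flip_pow j \<circ> flip_pow j = h" by (simp add: fun_eq_iff)
    then have "F = ?f (h \<circ> flip_pow j, j, k)" using f[OF g j h(2)] h(3) by simp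
    moreover have "(h \<circ> flip_pow j, j, k) \<in> carrier ?S" using car g j h(2) by blast
    ultimately show "F \<in> ?f ` carrier ?S" by blast
  qed
  ultimately show ?thesis
    unfolding iso_def bij_betw_def hom_def by blast
qed

section \<open>The action of \<open>SE2\<close> on \<open>Q l\<close>\<close>

lemma act_apply: "(b, f) \<in> Q l \<Longrightarrow> act l g (b, f) = (g b, g f)"
  by (simp add: act_def)

lemma act_transitive: "transitive_action SE2 (Q l) (act l)"
proof -
  have "act l \<in> hom SE2 (BijGroup (Q l))"
  proof (rule homI)
    fix g h assume gh: "g \<in> carrier SE2" "h \<in> carrier SE2"
    then have gh': "g \<in> carrier E2" "h \<in> carrier E2" using SE2_subset_E2 by auto
    have hom: "act l \<in> hom E2 (IsomQ l)" using act_mon[OF l] by (simp add: mon_def)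
    show "act l g \<in> carrier (BijGroup (Q l))"
      using hom_in_carrier[OF hom gh'(1)] IsomQ_subset_Bij[OF l] by (auto simp: BijGroup_def)
    show "act l (g \<otimes>\<^bsub>SE2\<^esub> h) = act l g \<otimes>\<^bsub>BijGroup (Q l)\<^esub> act l h"
      using hom_mult[OF hom gh'] by simp
  qed
  then have "group_action SE2 (Q l) (act l)"
    using group_SE2 group_BijGroup by (simp add: group_action_def group_hom_def group_hom_axioms_def)
  moreover have "\<exists>g\<in>carrier SE2. act l g x = y" if xy: "x \<in> Q l" "y \<in> Q l" for x y
  proof -
    have "norm (snd x - fst x) = norm (snd y - fst y)" using xy by (simp add: Q_iff)
    then obtain c where c: "snd y - fst y = cos c *\<^sub>R (snd x - fst x) + sin c *\<^sub>R rot90 (snd x - fst x)"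
      by (rule plane_rotation_exists)
    \<comment> \<open>The rotation by \<open>c\<close> as a complex number; the back wheel then
      fixes the translation.\<close>
    define z :: plane where "z = (\<chi> i. if i = 1 then cos c else sin c)"
    have z: "z \<bullet> z = 1" "turn z *v (snd x - fst x) = snd y - fst y"
      by (simp_all add: c turn_apply plane_inner z_def)
    define g where "g = rigid (turn z, fst y - turn z *v fst x)"
    have "g \<in> carrier SE2" using z(1) unfolding g_def SE2_turn by blast
    moreover have "act l g x = y"
      using xy(1) z(2) by (cases x; cases y)
        (simp add: act_apply g_def rigid_apply matrix_vector_mult_diff_distrib algebra_simps)
    ultimately show ?thesis by blast
  qed
  ultimately show ?thesis by (simp add: transitive_action_def transitive_action_axioms_def)
qed

text \<open>A motion fixing both wheels has a rotation part fixing the nonzero vector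
  \<open>f - b\<close>; that part is the identity, and then the translation vanishes.\<close>

lemma act_free:
  assumes "q \<in> Q l"
  shows "stabilizer SE2 (act l) q = {\<one>\<^bsub>SE2\<^esub>}"
proof (intro subset_antisym subsetI)
  fix g assume "g \<in> stabilizer SE2 (act l) q"
  then have g: "g \<in> carrier SE2" "act l g q = q" by (auto simp: stabilizer_def)
  obtain b f where q: "q = (b, f)" by fastforce
  have bf: "(b, f) \<in> Q l" "f - b \<noteq> 0" using assms l by (auto simp: q Q_iff)
  obtain z t where z: "g = rigid (turn z, t)" using g(1) SE2_turn by blast
  have gb: "g b = b" "g f = f" using g(2) bf(1) by (simp_all add: q act_apply)
  \<comment> \<open>The complex number 1, for which \<open>turn w\<close> is the identity
    matrix.\<close>
  define w :: plane where "w = (\<chi> i. if i = 1 then 1 else 0)"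
  have w: "turn w = mat 1" by (simp add: matrix22_eq_iff w_def mat_def)
  have "turn z *v (f - b) = turn w *v (f - b)"
    using rigid_diff[of "(turn z, t)" f b] gb unfolding z by (simp add: w)
  then have "turn z = mat 1" using turn_unique bf(2) w by metis
  moreover have "t = 0" using gb(1) unfolding z calculation by (simp add: rigid_apply)
  ultimately show "g \<in> {\<one>\<^bsub>SE2\<^esub>}" by (simp add: z E2_one rigid_id)
next
  fix g assume "g \<in> {\<one>\<^bsub>SE2\<^esub>}"
  then have "g = id" by (simp add: E2_one)
  moreover have "id \<in> carrier SE2" using subgroup.one_closed[OF subgroup_SE2] by (simp add: E2_one)
  ultimately show "g \<in> stabilizer SE2 (act l) q" using assms by (cases q) (simp add: stabilizer_def act_apply)
qed

end

section \<open>The identity component\<close>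

text \<open>The whole function set is itself subbasic, from \<open>K = U = {}\<close>.\<close>

lemma topspace_compact_open: "topspace (compact_open M \<F>) = \<F>"
proof -
  have "\<F> = {F \<in> \<F>. F ` {} \<subseteq> {}}" by simp
  then have "\<F> \<in> {{F \<in> \<F>. F ` K \<subseteq> U} |K U. compact K \<and> K \<subseteq> M \<and> openin (top_of_set M) U}"
    by (intro CollectI exI[of _ "{}"]) auto
  then show ?thesis unfolding compact_open_def topology_generated_by_topspace by blast
qed

lemma continuous_map_evaluation:
  fixes M :: "'a::topological_space set"
  assumes "q \<in> M" "\<And>F. F \<in> \<F> \<Longrightarrow> F q \<in> M"
  shows "continuous_map (compact_open M \<F>) euclidean (\<lambda>F. F q)"
proof -
  have "openin (compact_open M \<F>) {F \<in> \<F>. F q \<in> V}" if "open V" for V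
  proof -
    have "{F \<in> \<F>. F q \<in> V} = {F \<in> \<F>. F ` {q} \<subseteq> M \<inter> V}" using assms by auto
    moreover have "compact {q}" "{q} \<subseteq> M" "openin (top_of_set M) (M \<inter> V)"
      using assms(1) that by (simp_all add: openin_open_Int)
    ultimately have "\<exists>K U. {F \<in> \<F>. F q \<in> V} = {F \<in> \<F>. F ` K \<subseteq> U} \<and> compact K \<and> K \<subseteq> M \<and>
        openin (top_of_set M) U"
      by blast
    then show ?thesis unfolding compact_open_def by (intro topology_generated_by_Basis CollectI)
  qed
  then show ?thesis by (simp add: continuous_map_def topspace_compact_open)
qed

text \<open>Currying of a jointly continuous map. The parameters whose maps fail to send
  \<open>K\<close> into \<open>U\<close> form the projection, along the compact set
  \<open>K\<close>, of a closed set, and such projections are closed.\<close>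

lemma continuous_map_into_compact_open:
  fixes Z :: "'z::euclidean_space set" and M :: "'a::euclidean_space set" and ev :: "'z \<Rightarrow> 'a \<Rightarrow> 'a"
  assumes "continuous_on UNIV (\<lambda>p. ev (fst p) (snd p))"
    and \<Phi>: "\<And>z. z \<in> Z \<Longrightarrow> \<Phi> z \<in> \<F>" "\<And>z q. z \<in> Z \<Longrightarrow> q \<in> M \<Longrightarrow> \<Phi> z q = ev z q"
    "\<And>z q. z \<in> Z \<Longrightarrow> q \<in> M \<Longrightarrow> \<Phi> z q \<in> M"
  shows "continuous_map (top_of_set Z) (compact_open M \<F>) \<Phi>"
  unfolding compact_open_def
proof (rule continuous_on_generated_topo)
  fix B assume "B \<in> {{F \<in> \<F>. F ` K \<subseteq> U} |K U. compact K \<and> K \<subseteq> M \<and> openin (top_of_set M) U}"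
  then obtain K U where B: "B = {F \<in> \<F>. F ` K \<subseteq> U}" and K: "compact K" "K \<subseteq> M" "openin (top_of_set M) U"
    by blast
  then obtain V where V: "open V" "U = M \<inter> V" by (auto simp: openin_open)
  define C where "C = (\<lambda>(q, z). ev z q) -` (- V)"
  have "continuous_on UNIV (\<lambda>(q, z). ev z q)"
    using continuous_on_compose2[OF assms(1) continuous_on_swap] by (simp add: prod.swap_def split_beta)
  then have "closed C" unfolding C_def using V(1) by (intro closed_vimage) (simp_all add: closed_Compl)
  then have "closed {z. \<exists>q. q \<in> K \<and> (q, z) \<in> C}" by (rule closed_compact_projection[OF K(1)])
  then have "open (- {z. \<exists>q. q \<in> K \<and> (q, z) \<in> C})" by (rule open_Compl)
  moreover have "\<Phi> -` B \<inter> Z = Z \<inter> - {z. \<exists>q. q \<in> K \<and> (q, z) \<in> C}"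
    using \<Phi> K(2) unfolding B V(2) C_def by (auto simp: image_subset_iff subset_iff)
  ultimately show "openin (top_of_set Z) (\<Phi> -` B \<inter> topspace (top_of_set Z))"
    by (simp add: openin_open_Int)
next
  have "\<Union> {{F \<in> \<F>. F ` K \<subseteq> U} |K U. compact K \<and> K \<subseteq> M \<and> openin (top_of_set M) U} = \<F>"
    using topspace_compact_open[of M \<F>] unfolding compact_open_def topology_generated_by_topspace .
  then show "\<Phi> ` topspace (top_of_set Z) \<subseteq> \<Union> {{F \<in> \<F>. F ` K \<subseteq> U} |K U. compact K \<and> K \<subseteq> M \<and> openin (top_of_set M) U}"
    using \<Phi>(1) by auto
qed

lemma continuous_map_binary:
  fixes h :: "'a::topological_space \<Rightarrow> 'b::topological_space \<Rightarrow> 'c::topological_space"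
  assumes "continuous_map X euclidean f" "continuous_map X euclidean g"
    "continuous_on UNIV (\<lambda>p. h (fst p) (snd p))"
  shows "continuous_map X euclidean (\<lambda>x. h (f x) (g x))"
proof -
  have "continuous_map X euclidean (\<lambda>x. (f x, g x))"
    using continuous_map_pairedI[OF assms(1,2)] by simp
  moreover have "continuous_map euclidean euclidean (\<lambda>p. h (fst p) (snd p))" using assms(3) by simp
  ultimately have "continuous_map X euclidean ((\<lambda>p. h (fst p) (snd p)) \<circ> (\<lambda>x. (f x, g x)))"
    by (rule continuous_map_compose)
  then show ?thesis by (simp add: o_def)
qed

lemma connectedin_positive:
  fixes f :: "'a \<Rightarrow> real"
  assumes "continuous_map X euclidean f" "connectedin X T" "x \<in> T" "y \<in> T" "f x > 0"
    "\<And>z. z \<in> T \<Longrightarrow> f z \<noteq> 0"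
  shows "f y > 0"
proof (rule ccontr)
  assume "\<not> f y > 0"
  moreover have "connected (f ` T)" using connectedin_continuous_map_image[OF assms(1,2)] by simp
  then have "\<And>c. f y \<le> c \<Longrightarrow> c \<le> f x \<Longrightarrow> c \<in> f ` T"
    using assms(3,4) unfolding connected_iff_interval by blast
  ultimately have "0 \<in> f ` T" using assms(5) by simp
  then show False using assms(6) by auto
qed

text \<open>The copy of \<open>SE2\<close> is connected as a continuous image of a circle times a
  plane. It fills the component because two continuous, nowhere vanishing functions of an isometry
  detect by their signs the factor \<open>Phi\<close> and the orientation.\<close>

lemma identity_component:
  assumes l: "l > 0"
  shows "connected_component_of_set (compact_open (Q l) (carrier (IsomQ l))) \<one>\<^bsub>IsomQ l\<^esub> = act l ` carrier SE2"
    (is "connected_component_of_set ?X _ = _")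
proof -
  have into: "F q \<in> Q l" if "F \<in> carrier (IsomQ l)" "q \<in> Q l" for F q
    using that IsomQ_subset_Bij[OF l] by (auto simp: Bij_def bij_betw_def)
  have id_SE2: "id \<in> carrier SE2" using subgroup.one_closed[OF subgroup_SE2] by (simp add: E2_one)
  have one: "\<one>\<^bsub>IsomQ l\<^esub> = act l id" using IsomQ_one[OF l] by (simp add: act_eq_iso_map)
  have "connectedin ?X (act l ` carrier SE2)"
  proof -
    define Z :: "(plane \<times> plane) set" where "Z = sphere 0 1 \<times> UNIV"
    define m where "m w = rigid (turn (fst w), snd w)" for w :: "plane \<times> plane"
    have Z: "w \<in> Z \<longleftrightarrow> fst w \<bullet> fst w = 1" for w by (simp add: Z_def mem_Times_iff norm_eq_1)
    have m: "m w \<in> carrier SE2" if "w \<in> Z" for w using that unfolding Z m_def SE2_turn by blast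
    have closed: "act l (m w) \<in> carrier (IsomQ l)" if "w \<in> Z" for w
    proof (rule hom_in_carrier[of "act l" E2])
      show "act l \<in> hom E2 (IsomQ l)" using act_mon[OF l] by (simp add: mon_def)
      show "m w \<in> carrier E2" using m[OF that] SE2_subset_E2 by blast
    qed
    have "connected Z" unfolding Z_def by (intro connected_Times connected_sphere connected_UNIV) simp
    moreover have "continuous_map (top_of_set Z) ?X (\<lambda>w. act l (m w))"
    proof (rule continuous_map_into_compact_open[where ev = "\<lambda>w q. (m w (fst q), m w (snd q))"])
      show "continuous_on UNIV (\<lambda>p. (m (fst p) (fst (snd p)), m (fst p) (snd (snd p))))"
        unfolding m_def rigid_apply fst_conv snd_conv turn_apply
        by (intro continuous_intros bounded_linear.continuous_on[OF bounded_linear_rot90])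
      fix w q assume w: "w \<in> Z"
      show "act l (m w) \<in> carrier (IsomQ l)" by (rule closed[OF w])
      assume q: "q \<in> Q l"
      show "act l (m w) q = (m w (fst q), m w (snd q))" using q by (cases q) (simp add: act_def)
      show "act l (m w) q \<in> Q l" by (rule into[OF closed[OF w] q])
    qed
    moreover have "act l ` carrier SE2 = (\<lambda>w. act l (m w)) ` Z"
    proof -
      have "g \<in> m ` Z" if g: "g \<in> carrier SE2" for g
      proof -
        obtain z t where "z \<bullet> z = 1" "g = rigid (turn z, t)" using g SE2_turn by blast
        then show ?thesis by (intro image_eqI[of _ _ "(z, t)"]) (simp_all add: m_def Z)
      qed
      then have "carrier SE2 = m ` Z" using m by blast
      then show ?thesis by (simp add: image_image)
    qed
    ultimately show ?thesis
      using connectedin_continuous_map_image[of "top_of_set Z" ?X "\<lambda>w. act l (m w)" Z] by simp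
  qed
  moreover have "y \<in> act l ` carrier SE2" if T: "connectedin ?X T" "\<one>\<^bsub>IsomQ l\<^esub> \<in> T" "y \<in> T" for T y
  proof -
    define e1 e2 :: plane where "e1 = axis 1 1" "e2 = axis 2 1"
    define q1 q2 q3 :: "plane \<times> plane" where "q1 = (0, l *\<^sub>R e1)" "q2 = (0, l *\<^sub>R e2)" "q3 = (e1, e1 + l *\<^sub>R e1)"
    have e: "e1 \<bullet> e1 = 1" "norm e1 = 1" "norm e2 = 1" by (simp_all add: e1_e2_def inner_axis_axis)
    have q: "q1 \<in> Q l" "q2 \<in> Q l" "q3 \<in> Q l" using l e by (simp_all add: Q_iff q1_q2_q3_def)
    have cont: "continuous_map ?X euclidean (\<lambda>F. F q1)" "continuous_map ?X euclidean (\<lambda>F. F q2)"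
      "continuous_map ?X euclidean (\<lambda>F. F q3)"
      by (rule continuous_map_evaluation[OF q(1)] continuous_map_evaluation[OF q(2)] continuous_map_evaluation[OF q(3)],
          rule into, assumption, rule q)+
    \<comment> \<open>\<open>q1\<close> and \<open>q3\<close> differ by a translation by
      \<open>e1\<close>. The back wheels of their images reveal the image of \<open>e1\<close>; its
      product with the image frame of \<open>q1\<close> is \<open>l\<close> or \<open>- l\<close>
      according to the absence or presence of \<open>Phi\<close>.\<close>
    define c1 where "c1 F = (fst (F q3) - fst (F q1)) \<bullet> (snd (F q1) - fst (F q1))" for F :: "plane \<times> plane \<Rightarrow> plane \<times> plane"
    \<comment> \<open>The frames at \<open>q1\<close> and \<open>q2\<close> are orthogonal; the
      signed area of their images is \<open>l\<^sup>2\<close> times the determinant, since the sign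
      of \<open>Phi\<close> enters twice.\<close>
    define c2 where "c2 F = rot90 (snd (F q1) - fst (F q1)) \<bullet> (snd (F q2) - fst (F q2))" for F :: "plane \<times> plane \<Rightarrow> plane \<times> plane"
    have c1_cont: "continuous_map ?X euclidean c1"
      unfolding c1_def[abs_def] by (intro continuous_map_binary[OF cont(3,1)] continuous_intros)
    have c2_cont: "continuous_map ?X euclidean c2"
      unfolding c2_def[abs_def]
      by (intro continuous_map_binary[OF cont(1,2)] continuous_intros bounded_linear.continuous_on[OF bounded_linear_rot90])
    have c: "c1 (iso_map l (rigid p, k)) = (if k = 0 then l else - l)"
      "c2 (iso_map l (rigid p, k)) = l\<^sup>2 * det (fst p)" if p: "orthogonal_matrix (fst p)" for p k
    proof -
      define \<sigma> :: real where "\<sigma> = (if k = 0 then 1 else -1)"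
      have F: "iso_map l (rigid p, k) q = bike_map p \<sigma> q" if "q \<in> Q l" for q
        using that by (simp add: iso_map_rigid \<sigma>_def)
      have "fst (bike_map p \<sigma> q3) - fst (bike_map p \<sigma> q1) = fst p *v e1"
        by (simp add: bike_map_def q1_q2_q3_def rigid_diff)
      moreover have d: "snd (bike_map p \<sigma> q1) - fst (bike_map p \<sigma> q1) = (\<sigma> * l) *\<^sub>R (fst p *v e1)"
        "snd (bike_map p \<sigma> q2) - fst (bike_map p \<sigma> q2) = (\<sigma> * l) *\<^sub>R (fst p *v e2)"
        unfolding bike_map_difference by (simp_all add: q1_q2_q3_def matrix_vector_mult_scaleR)
      ultimately show "c1 (iso_map l (rigid p, k)) = (if k = 0 then l else - l)"
        using inner_orthogonal_matrix[OF p, of e1 e1] e by (simp add: c1_def F q \<sigma>_def)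
      have "rot90 (fst p *v e1) \<bullet> (fst p *v e2) = det (fst p)"
        by (simp add: det_2 plane_inner e1_e2_def matrix_vector_mult_def sum_2 axis_def)
      moreover have "\<sigma> * l * (\<sigma> * l) = l\<^sup>2" by (simp add: \<sigma>_def power2_eq_square)
      ultimately show "c2 (iso_map l (rigid p, k)) = l\<^sup>2 * det (fst p)"
        by (simp add: c2_def F q d)
    qed
    have rep: "\<exists>p k. orthogonal_matrix (fst p) \<and> k \<in> carrier Z2 \<and> x = iso_map l (rigid p, k)" if "x \<in> T" for x
    proof -
      have "x \<in> carrier (IsomQ l)"
        using that connectedin_subset_topspace[OF T(1)] topspace_compact_open by blast
      then show ?thesis using IsomQ_cases[OF l] E2_iff by metis
    qed
    have nz: "c1 x \<noteq> 0" "c2 x \<noteq> 0" if x: "x \<in> T" for x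
    proof -
      obtain p k where p: "orthogonal_matrix (fst p)" "x = iso_map l (rigid p, k)" using rep[OF x] by blast
      have "det (fst p) \<noteq> 0" using det_orthogonal_matrix[OF p(1)] by auto
      then show "c1 x \<noteq> 0" "c2 x \<noteq> 0" using c[OF p(1), of k] l by (auto simp: p(2))
    qed
    have "\<one>\<^bsub>IsomQ l\<^esub> = iso_map l (rigid (mat 1, 0), 0)" using IsomQ_one[OF l] rigid_id by simp
    then have "c1 \<one>\<^bsub>IsomQ l\<^esub> = l" "c2 \<one>\<^bsub>IsomQ l\<^esub> = l\<^sup>2"
      using c[of "(mat 1, 0)" 0] orthogonal_matrix_id by simp_all
    then have pos: "c1 y > 0" "c2 y > 0"
      using connectedin_positive[OF c1_cont T _ nz(1)] connectedin_positive[OF c2_cont T _ nz(2)] l by simp_all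
    obtain p k where p: "orthogonal_matrix (fst p)" "k \<in> carrier Z2" "y = iso_map l (rigid p, k)"
      using rep[OF T(3)] by blast
    have "k = 0" "det (fst p) > 0"
      using pos c[OF p(1), of k] l p(3) by (auto split: if_splits simp: zero_less_mult_iff)
    then show ?thesis using p rigid_in_SE2 by (auto simp: act_eq_iso_map)
  qed
  ultimately show ?thesis
    using id_SE2 one unfolding connected_component_of_def by (auto simp del: IsomQ_simps)
qed

section \<open>The left-invariant structure on the motion group\<close>

lemma motion_coords_rigid: "motion_coords (rigid p) = p"
  by (simp add: motion_coords_def inj_rigid)

lemma SE2_mfd_iff: "p \<in> SE2_mfd \<longleftrightarrow> (\<exists>z. z \<bullet> z = 1 \<and> fst p = turn z)"
  by (simp add: SE2_mfd_def rigid_in_SE2 orthogonal_det_pos_iff)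

lemma bounded_linear_turn: "bounded_linear turn"
  by (intro linear_conv_bounded_linear[THEN iffD1] linearI) (auto simp: matrix22_eq_iff)

lemma bounded_linear_matrix_vector_left: "bounded_linear (\<lambda>A :: real^2^2. A *v x)"
  by (intro linear_conv_bounded_linear[THEN iffD1] linearI)
    (auto simp: matrix_vector_mult_add_rdistrib scaleR_matrix_vector_assoc)

text \<open>\<open>orbit_map q\<close> extends \<open>p \<mapsto> rigid p \<cdot> q\<close> to a linear map, and \<open>orbit_inv\<close> is a linear
  right inverse of it, which inverts it on the manifold of motions.\<close>

definition orbit_map :: "plane \<times> plane \<Rightarrow> (real^2^2) \<times> plane \<Rightarrow> plane \<times> plane" where
  "orbit_map q p = (rigid p (fst q), rigid p (snd q))"

text \<open>The heading of \<open>x\<close> as a complex number relative to that of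
  \<open>q\<close>: for \<open>x\<close> in \<open>Q l\<close> its \<open>turn\<close> is the
  rotation carrying the frame of \<open>q\<close> to the frame of \<open>x\<close>.\<close>

definition rel_heading :: "real \<Rightarrow> plane \<times> plane \<Rightarrow> plane \<times> plane \<Rightarrow> plane" where
  "rel_heading l q x = (\<chi> i. heading l x \<bullet> (if i = 1 then heading l q else rot90 (heading l q)))"

definition orbit_inv :: "real \<Rightarrow> plane \<times> plane \<Rightarrow> plane \<times> plane \<Rightarrow> (real^2^2) \<times> plane" where
  "orbit_inv l q x = (turn (rel_heading l q x), fst x - turn (rel_heading l q x) *v fst q)"

lemma rel_heading_nth [simp]:
  "rel_heading l q x $ 1 = heading l x \<bullet> heading l q"
  "rel_heading l q x $ 2 = heading l x \<bullet> rot90 (heading l q)"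
  by (simp_all add: rel_heading_def)

lemma matrix22_mult_nth: "((A :: real^2^2) ** B) $ i $ j = A $ i $ 1 * B $ 1 $ j + A $ i $ 2 * B $ 2 $ j"
  by (simp add: matrix_matrix_mult_def sum_2)

lemma turn_mult: "turn y ** turn x = turn (turn y *v x)"
  by (simp add: matrix22_eq_iff matrix22_mult_nth turn_apply)

context
  fixes l :: real and q :: "plane \<times> plane"
  assumes l: "l > 0" and q: "q \<in> Q l"
begin

lemma bounded_linear_orbit_map: "bounded_linear (orbit_map q)"
  unfolding orbit_map_def[abs_def] rigid_apply
  by (intro bounded_linear_Pair bounded_linear_add bounded_linear_snd
      bounded_linear_compose[OF bounded_linear_matrix_vector_left bounded_linear_fst])

lemma bounded_linear_orbit_inv: "bounded_linear (orbit_inv l q)"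
proof -
  have "linear (rel_heading l q)"
    by (intro linearI) (simp_all add: plane_eq_iff inner_add_left
        linear_add[OF bounded_linear.linear[OF bounded_linear_heading]]
        linear_cmul[OF bounded_linear.linear[OF bounded_linear_heading]])
  then have "bounded_linear (\<lambda>x. turn (rel_heading l q x))"
    by (intro bounded_linear_compose[OF bounded_linear_turn]) (simp add: linear_conv_bounded_linear)
  then show ?thesis
    unfolding orbit_inv_def[abs_def]
    by (intro bounded_linear_Pair bounded_linear_sub bounded_linear_fst
        bounded_linear_compose[OF bounded_linear_matrix_vector_left])
qed

lemma turn_rel_heading: "turn (rel_heading l q x) *v (snd q - fst q) = snd x - fst x"
proof -
  have "turn (rel_heading l q x) *v heading l q = heading l x"
    using plane_frame_expansion[OF heading_unit[OF q l], of "heading l x"] by (simp add: turn_apply)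
  then have "l *\<^sub>R (turn (rel_heading l q x) *v heading l q) = snd x - fst x"
    by (simp add: heading_scaled[OF l])
  then show ?thesis
    by (simp add: heading_scaled[OF l, symmetric] matrix_vector_mult_scaleR)
qed

lemma orbit_map_inv: "orbit_map q (orbit_inv l q x) = x"
  using turn_rel_heading[of x]
  by (simp add: orbit_map_def orbit_inv_def rigid_apply matrix_vector_mult_diff_distrib
      prod_eq_iff algebra_simps)

text \<open>Covers all matrices \<open>turn w\<close>, not only rotations: tangent vectors of the
  group have such matrix parts, and left invariance applies the identity to them.\<close>

lemma orbit_inv_map_turn: "orbit_inv l q (orbit_map q (turn w, t)) = (turn w, t)"
proof -
  have h: "heading l (orbit_map q (turn w, t)) = turn w *v heading l q"
    using rigid_diff[of "(turn w, t)" "snd q" "fst q"]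
    by (simp add: orbit_map_def heading_def matrix_vector_mult_scaleR)
  have "rel_heading l q (orbit_map q (turn w, t)) = w"
    by (rule plane_eq_iff[THEN iffD2]) (simp add: h heading_unit[OF q l] turn_apply inner_add_left)
  then show ?thesis
    by (simp add: orbit_inv_def) (simp add: orbit_map_def rigid_apply)
qed

lemma orbit_inv_map: "p \<in> SE2_mfd \<Longrightarrow> orbit_inv l q (orbit_map q p) = p"
  using orbit_inv_map_turn SE2_mfd_iff by (metis prod.collapse)

lemma orbit_map_in_Q: "p \<in> SE2_mfd \<Longrightarrow> orbit_map q p \<in> Q l"
  using q norm_orthogonal_matrix[of "fst p" "snd q - fst q"]
  by (simp add: Q_iff orbit_map_def rigid_diff SE2_mfd_def rigid_in_SE2)

lemma orbit_inv_in_SE2_mfd: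
  assumes "x \<in> Q l"
  shows "orbit_inv l q x \<in> SE2_mfd"
proof -
  have "rel_heading l q x \<bullet> rel_heading l q x = heading l x \<bullet> heading l x"
    using arg_cong[OF plane_frame_expansion[OF heading_unit[OF q l], of "heading l x"], of "\<lambda>v. heading l x \<bullet> v"]
    unfolding plane_inner[of "rel_heading l q x"] by (simp add: inner_add_right)
  then show ?thesis
    using heading_unit[OF assms l] unfolding SE2_mfd_iff by (auto simp: orbit_inv_def)
qed

text \<open>The structure that makes the orbit map an isometry. The orbit map is linear and hence
  its own differential; it is not injective on the ambient space, so the distribution is carried
  back by \<open>orbit_inv\<close>, while the inner product is pulled back directly.\<close>

definition pulled_back :: "((real^2^2) \<times> plane) sub_riem" where
  "pulled_back = \<lparr>pts = SE2_mfd,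
     distr = (\<lambda>p. orbit_inv l q ` distr (bicycle l) (orbit_map q p)),
     met = (\<lambda>p v w. met (bicycle l) (orbit_map q p) (orbit_map q v) (orbit_map q w))\<rparr>"

lemma pulled_back_simps:
  "pts pulled_back = SE2_mfd"
  "distr pulled_back p = orbit_inv l q ` distr (bicycle l) (orbit_map q p)"
  "met pulled_back p v w = snd (orbit_map q v) \<bullet> snd (orbit_map q w)"
  by (simp_all add: pulled_back_def)

lemma orbit_map_isometry:
  assumes "\<And>p. p \<in> SE2_mfd \<Longrightarrow> F p = orbit_map q p"
  shows "sr_isometry pulled_back (bicycle l) F"
proof (rule sr_isometry_affine[OF bounded_linear_orbit_map bounded_linear_orbit_inv, where c = 0 and c' = 0])
  fix p v assume "p \<in> pts pulled_back" "v \<in> distr pulled_back p"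
  then show "orbit_map q v \<in> distr (bicycle l) (F p)"
    using assms by (auto simp: pulled_back_simps orbit_map_inv simp del: bicycle_simps)
next
  fix p w assume "p \<in> pts pulled_back" "w \<in> distr (bicycle l) (F p)"
  then show "orbit_inv l q w \<in> distr pulled_back p \<and> orbit_map q (orbit_inv l q w) = w"
    using assms by (auto simp: pulled_back_simps orbit_map_inv simp del: bicycle_simps)
qed (use assms orbit_map_in_Q orbit_inv_in_SE2_mfd orbit_map_inv orbit_inv_map in \<open>simp_all add: pulled_back_simps\<close>)

lemma distr_bicycle_span:
  assumes "x \<in> Q l"
  shows "distr (bicycle l) x = span {X1 l x, X2 l x}"
proof (intro subset_antisym subsetI)
  fix v assume v: "v \<in> distr (bicycle l) x"
  then obtain c where c: "fst v = c *\<^sub>R (snd x - fst x)" by auto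
  have "snd v - fst v = l *\<^sub>R heading l v" by (simp add: heading_scaled[OF l])
  also have "\<dots> = (snd v \<bullet> rot90 (heading l x)) *\<^sub>R rot90 (heading l x)"
    using heading_of_horizontal[OF assms l v] l by simp
  finally have "snd v = (c * l) *\<^sub>R heading l x + (snd v \<bullet> rot90 (heading l x)) *\<^sub>R rot90 (heading l x)"
    using c heading_scaled[OF l, of x] by (metis add.commute diff_add_cancel scaleR_scaleR)
  moreover have "fst v = (c * l) *\<^sub>R heading l x" using c heading_scaled[OF l, of x] by (metis scaleR_scaleR)
  ultimately have "v = (c * l) *\<^sub>R X1 l x + (snd v \<bullet> rot90 (heading l x)) *\<^sub>R X2 l x"
    by (simp add: X1_def X2_def prod_eq_iff)
  then show "v \<in> span {X1 l x, X2 l x}"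
    by (metis insertI1 insertI2 singletonI span_add span_base span_scale)
next
  fix v assume "v \<in> span {X1 l x, X2 l x}"
  moreover have "subspace (distr (bicycle l) x)"
    using assms l by (auto simp: subspace_def tangent_space_Q inner_add_left scaleR_add_left[symmetric]
        scaleR_diff_right[symmetric] add_diff_add intro: exI[of _ 0])
  ultimately show "v \<in> distr (bicycle l) x"
    using X_in_distr[OF assms l] span_minimal[of "{X1 l x, X2 l x}" "distr (bicycle l) x"] by blast
qed

definition frame :: "nat \<Rightarrow> (real^2^2) \<times> plane \<Rightarrow> (real^2^2) \<times> plane" where
  "frame i p = orbit_inv l q ((if i = 0 then X1 l else X2 l) (orbit_map q p))"

lemma distr_pulled_back_span:
  assumes "p \<in> SE2_mfd"
  shows "distr pulled_back p = span {frame 0 p, frame 1 p}"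
  unfolding pulled_back_simps distr_bicycle_span[OF orbit_map_in_Q[OF assms]]
  using linear_span_image[OF bounded_linear.linear[OF bounded_linear_orbit_inv], of "{X1 l (orbit_map q p), X2 l (orbit_map q p)}"]
  by (simp add: frame_def)

lemma orbit_map_frame: "orbit_map q (frame i p) = (if i = 0 then X1 l else X2 l) (orbit_map q p)"
  by (simp add: frame_def orbit_map_inv)

lemma frame_orthonormal:
  assumes "p \<in> SE2_mfd"
  shows "met pulled_back p (frame i p) (frame j p) = (if (i = 0) = (j = 0) then 1 else 0)"
  using heading_unit[OF orbit_map_in_Q[OF assms] l]
  by (auto simp: pulled_back_simps orbit_map_frame X1_def X2_def)

text \<open>The fields \<open>frame 0\<close> and \<open>frame 1\<close> form a global orthonormal
  frame that is linear in \<open>p\<close>, so its fields are smooth and their inner products are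
  constants.\<close>

lemma sub_riemannian_pulled_back: "sub_riemannian 2 pulled_back"
  unfolding sub_riemannian_def
proof (intro conjI ballI allI)
  fix p assume "p \<in> pts pulled_back"
  then have p: "p \<in> SE2_mfd" by (simp add: pulled_back_simps)
  note lin = bounded_linear.linear[OF bounded_linear_orbit_map]
  note add = linear_add[OF lin] and cmul = linear_cmul[OF lin]
  have ortho: "snd (orbit_map q (frame 0 p)) \<bullet> snd (orbit_map q (frame 0 p)) = 1"
    "snd (orbit_map q (frame 1 p)) \<bullet> snd (orbit_map q (frame 1 p)) = 1"
    "snd (orbit_map q (frame 0 p)) \<bullet> snd (orbit_map q (frame 1 p)) = 0"
    using frame_orthonormal[OF p, of 0 0] frame_orthonormal[OF p, of 1 1] frame_orthonormal[OF p, of 0 1]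
    by (simp_all add: pulled_back_simps)
  show "subspace (distr pulled_back p)" unfolding distr_pulled_back_span[OF p] by simp
  show "dim (distr pulled_back p) = 2"
  proof -
    have "frame 0 p \<notin> span {frame 1 p}"
    proof
      assume "frame 0 p \<in> span {frame 1 p}"
      then obtain k where "frame 0 p = k *\<^sub>R frame 1 p" by (auto simp: span_singleton)
      then show False using ortho by (simp add: cmul)
    qed
    moreover have "frame 1 p \<noteq> 0" using ortho linear_0[OF lin] by auto
    ultimately have "independent {frame 0 p, frame 1 p}" "frame 0 p \<noteq> frame 1 p"
      by (auto simp: independent_insert dependent_single intro: span_base)
    then show ?thesis
      unfolding distr_pulled_back_span[OF p] by (simp add: dim_span dim_eq_card_independent)
  qed
  show "distr pulled_back p \<subseteq> tangent_space (pts pulled_back) p"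
  proof
    fix v assume "v \<in> distr pulled_back p"
    then obtain w where w: "w \<in> tangent_space (Q l) (orbit_map q p)" "v = orbit_inv l q w"
      by (auto simp: pulled_back_simps)
    show "v \<in> tangent_space (pts pulled_back) p"
      using tangent_space_affine[OF bounded_linear_orbit_inv _ w(1), of 0 SE2_mfd] orbit_inv_in_SE2_mfd
        orbit_inv_map[OF p] w(2) by (simp add: pulled_back_simps)
  qed
  fix u v w and a b :: real assume u: "u \<in> distr pulled_back p"
  show "met pulled_back p u v = met pulled_back p v u" by (simp add: pulled_back_simps inner_commute)
  show "met pulled_back p (a *\<^sub>R u + b *\<^sub>R v) w = a * met pulled_back p u w + b * met pulled_back p v w"
    by (simp add: pulled_back_simps add cmul inner_add_left)
  show "u \<noteq> 0 \<longrightarrow> met pulled_back p u u > 0"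
  proof
    assume "u \<noteq> 0"
    obtain a b where ab: "u = a *\<^sub>R frame 0 p + b *\<^sub>R frame 1 p"
      using u unfolding distr_pulled_back_span[OF p] by (auto simp: span_insert span_singleton algebra_simps)
    have "met pulled_back p u u = a * a + b * b"
      using ortho by (simp add: ab pulled_back_simps add cmul inner_add_left inner_add_right inner_commute)
    moreover have "a \<noteq> 0 \<or> b \<noteq> 0" using ab \<open>u \<noteq> 0\<close> by auto
    ultimately show "met pulled_back p u u > 0"
      by (metis add_nonneg_pos add_pos_nonneg not_real_square_gt_zero zero_le_square)
  qed
next
  fix p assume "p \<in> pts pulled_back"
  have bl: "bounded_linear (frame i)" for i
  proof -
    have "bounded_linear (if i = 0 then X1 l else X2 l)" by (simp add: bounded_linear_X)
    then show ?thesis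
      unfolding frame_def[abs_def]
      by (rule bounded_linear_compose[OF bounded_linear_orbit_inv
            bounded_linear_compose[OF _ bounded_linear_orbit_map]])
  qed
  have "smooth_map (UNIV \<inter> pts pulled_back) (frame i)" for i by (rule smooth_map_linear[OF bl])
  moreover have "smooth_map (UNIV \<inter> pts pulled_back) (\<lambda>y. met pulled_back y (frame i y) (frame j y))" for i j
    by (rule smooth_map_cong[OF _ smooth_map_const[of _ "if (i = 0) = (j = 0) then 1 else 0"]])
      (use frame_orthonormal in \<open>auto simp: pulled_back_simps\<close>)
  moreover have "{..<2::nat} = {0, 1}" by auto
  then have "distr pulled_back y = span ((\<lambda>i. frame i y) ` {..<2})" if "y \<in> UNIV \<inter> pts pulled_back" for y
    using distr_pulled_back_span that by (simp add: pulled_back_simps)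
  ultimately show "\<exists>U (X :: nat \<Rightarrow> _). open U \<and> p \<in> U \<and> (\<forall>i<2. smooth_map (U \<inter> pts pulled_back) (X i)) \<and>
      (\<forall>y\<in>U \<inter> pts pulled_back. distr pulled_back y = span ((\<lambda>i. X i y) ` {..<2})) \<and>
      (\<forall>i<2. \<forall>j<2. smooth_map (U \<inter> pts pulled_back) (\<lambda>y. met pulled_back y (X i y) (X j y)))"
    by (intro exI[of _ UNIV] exI[of _ frame] conjI open_UNIV UNIV_I allI impI ballI)
qed

lemma left_translation_affine:
  "motion_coords (rigid s \<circ> rigid p) = (fst s ** fst p, fst s *v snd p) + (0, snd s)"
  by (simp add: rigid_comp motion_coords_rigid)

text \<open>Equivariance: the orbit map intertwines left translation by \<open>s\<close> with the
  motion \<open>s\<close> acting on \<open>Q l\<close>.\<close>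

lemma orbit_map_translation: "orbit_map q (motion_coords (rigid s \<circ> rigid p)) = bike_map s 1 (orbit_map q p)"
  by (simp add: rigid_comp motion_coords_rigid orbit_map_def bike_map_def rigid_apply
      matrix_vector_mul_assoc[symmetric] matrix_vector_right_distrib add.assoc)

lemma orbit_map_translation_linear:
  "orbit_map q (fst s ** fst v, fst s *v snd v) = bike_linear (fst s) 1 (orbit_map q v)"
  by (simp add: orbit_map_def bike_linear_def rigid_apply matrix_vector_mul_assoc matrix_vector_right_distrib)

text \<open>Left translations correspond under the orbit map to Euclidean motions of
  \<open>Q l\<close>, which preserve the distribution and the inner product.\<close>

lemma left_invariant_pulled_back: "left_invariant pulled_back"
  unfolding left_invariant_def
proof (intro conjI ballI)
  fix g assume "g \<in> carrier SE2"
  then obtain s where s: "orthogonal_matrix (fst s)" "det (fst s) > 0" "g = rigid s" using SE2_iff by blast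
  define s' where "s' = (transpose (fst s), - (transpose (fst s) *v snd s))"
  have s': "orthogonal_matrix (fst s')" "rigid s' \<circ> rigid s = id" "rigid s \<circ> rigid s' = id"
    using rigid_inverse[OF s(1)] by (simp_all add: s'_def)
  have closed: "motion_coords (rigid t \<circ> rigid p) \<in> SE2_mfd"
    if "orthogonal_matrix (fst t)" "det (fst t) > 0" "p \<in> SE2_mfd" for t p
    using that by (simp add: rigid_comp motion_coords_rigid SE2_mfd_def rigid_in_SE2 orthogonal_matrix_mul det_mul)
  have det': "det (fst s') > 0" using s by (simp add: s'_def)
  have bl: "bounded_linear (\<lambda>v :: (real^2^2) \<times> plane. (fst t ** fst v, fst t *v snd v))" for t :: "(real^2^2) \<times> plane"
    by (intro linear_conv_bounded_linear[THEN iffD1] linearI)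
      (auto simp: matrix_vector_right_distrib matrix_vector_mult_scaleR matrix22_eq_iff
        matrix22_mult_nth algebra_simps)
  have cancel: "motion_coords (rigid s \<circ> rigid (motion_coords (rigid s' \<circ> rigid p))) = p"
    "motion_coords (rigid s' \<circ> rigid (motion_coords (rigid s \<circ> rigid p))) = p" for p
  proof -
    have "rigid (motion_coords (rigid t \<circ> rigid p)) = rigid t \<circ> rigid p" for t
      by (simp add: rigid_comp motion_coords_rigid)
    then show "motion_coords (rigid s \<circ> rigid (motion_coords (rigid s' \<circ> rigid p))) = p"
      "motion_coords (rigid s' \<circ> rigid (motion_coords (rigid s \<circ> rigid p))) = p"
      using s' by (simp_all add: comp_assoc[symmetric] motion_coords_rigid)
  qed
  have distr_closed: "(fst t ** fst v, fst t *v snd v) \<in> distr pulled_back (motion_coords (rigid t \<circ> rigid p))"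
    if t: "orthogonal_matrix (fst t)" "det (fst t) > 0" and p: "p \<in> SE2_mfd" and v: "v \<in> distr pulled_back p" for t p v
  proof -
    obtain w where w: "w \<in> distr (bicycle l) (orbit_map q p)" "v = orbit_inv l q w"
      using v by (auto simp: pulled_back_simps(2) simp del: bicycle_simps)
    have "bike_linear (fst t) 1 w \<in> distr (bicycle l) (orbit_map q (motion_coords (rigid t \<circ> rigid p)))"
      unfolding orbit_map_translation by (rule bike_linear_distr[OF t(1) _ orbit_map_in_Q[OF p] w(1)]) simp
    \<comment> \<open>A vector is recovered by \<open>orbit_inv\<close> from its image only if its
      matrix part is some \<open>turn w\<close>. The determinant condition makes
      \<open>fst t\<close> such a matrix, and products of these keep the form.\<close>
    moreover have "(fst t ** fst v, fst t *v snd v) = orbit_inv l q (bike_linear (fst t) 1 w)"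
    proof -
      obtain y where "fst t = turn y" using t orthogonal_det_pos_iff by blast
      then have "(fst t ** fst v, fst t *v snd v) = (turn (turn y *v rel_heading l q w), fst t *v snd v)"
        by (simp add: w(2) orbit_inv_def turn_mult)
      then have "orbit_inv l q (orbit_map q (fst t ** fst v, fst t *v snd v)) = (fst t ** fst v, fst t *v snd v)"
        using orbit_inv_map_turn by simp
      then show ?thesis by (simp add: orbit_map_translation_linear w(2) orbit_map_inv)
    qed
    ultimately show ?thesis by (simp add: pulled_back_simps(2) del: bicycle_simps)
  qed
  show "sr_isometry pulled_back pulled_back (\<lambda>p. motion_coords (g \<circ> rigid p))"
    unfolding s(3)
  proof (rule sr_isometry_affine[OF bl[of s] bl[of s'], where c = "(0, snd s)" and c' = "(0, snd s')"])
    fix p assume "p \<in> pts pulled_back"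
    then have p: "p \<in> SE2_mfd" by (simp add: pulled_back_simps)
    show "motion_coords (rigid s \<circ> rigid p) = (fst s ** fst p, fst s *v snd p) + (0, snd s)"
      by (rule left_translation_affine)
    show "motion_coords (rigid s \<circ> rigid p) \<in> pts pulled_back"
      using closed[OF s(1,2) p] by (simp add: pulled_back_simps)
    show "(fst s' ** fst p, fst s' *v snd p) + (0, snd s') \<in> pts pulled_back"
      using closed[OF s'(1) det' p] by (simp only: left_translation_affine pulled_back_simps)
    show "motion_coords (rigid s \<circ> rigid ((fst s' ** fst p, fst s' *v snd p) + (0, snd s'))) = p"
      unfolding left_translation_affine[symmetric] by (rule cancel)
    show "(fst s' ** fst (motion_coords (rigid s \<circ> rigid p)), fst s' *v snd (motion_coords (rigid s \<circ> rigid p))) + (0, snd s') = p"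
      unfolding left_translation_affine[symmetric, of s'] by (rule cancel)
    show "(fst s ** fst v, fst s *v snd v) \<in> distr pulled_back (motion_coords (rigid s \<circ> rigid p))"
      if "v \<in> distr pulled_back p" for v using distr_closed[OF s(1,2) p that] .
    show "(fst s' ** fst w, fst s' *v snd w) \<in> distr pulled_back p \<and>
        (fst s ** fst (fst s' ** fst w, fst s' *v snd w), fst s *v snd (fst s' ** fst w, fst s' *v snd w)) = w"
      if "w \<in> distr pulled_back (motion_coords (rigid s \<circ> rigid p))" for w
      using distr_closed[OF s'(1) det' closed[OF s(1,2) p] that, unfolded cancel] s(1)
      by (simp add: s'_def orthogonal_matrix_def matrix_mul_assoc matrix_vector_mul_assoc del: transpose_matrix_vector)
    fix v w assume "v \<in> distr pulled_back p" "w \<in> distr pulled_back p"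
    then obtain v' w' where "v' \<in> distr (bicycle l) (orbit_map q p)" "v = orbit_inv l q v'"
      "w' \<in> distr (bicycle l) (orbit_map q p)" "w = orbit_inv l q w'"
      by (auto simp: pulled_back_simps(2) simp del: bicycle_simps)
    then show "met pulled_back (motion_coords (rigid s \<circ> rigid p)) (fst s ** fst v, fst s *v snd v)
        (fst s ** fst w, fst s *v snd w) = met pulled_back p v w"
      using bike_linear_met[OF s(1) _ orbit_map_in_Q[OF p] l, of 1 v' w']
      by (simp add: pulled_back_simps(3) orbit_map_translation_linear orbit_map_inv)
  qed
qed (rule pulled_back_simps)

end

theorem theorem3p3:
  fixes l :: real
  assumes "l > 0"
  shows
    "group (IsomQ l) \<and>
     Phi l \<in> carrier (IsomQ l) \<and>
     Phi l \<otimes>\<^bsub>IsomQ l\<^esub> Phi l = \<one>\<^bsub>IsomQ l\<^esub> \<and>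
     card (generate (IsomQ l) {Phi l}) = 2 \<and>
     (\<exists>\<pi>. group_extension Z2 (IsomQ l) E2 (\<lambda>k. Phi l [^]\<^bsub>IsomQ l\<^esub> k) \<pi> \<and>
          (\<forall>g\<in>carrier E2. \<pi> (act l g) = g)) \<and>
     (\<exists>\<epsilon>. group_extension E2 (IsomQ l) Z2 (act l) \<epsilon> \<and> \<epsilon> (Phi l) = 1) \<and>
     (\<exists>\<theta>\<in>hom Z2 (AutoGroup E2).
        (\<lambda>(g, k). act l g \<otimes>\<^bsub>IsomQ l\<^esub> Phi l [^]\<^bsub>IsomQ l\<^esub> k)
          \<in> iso (semidirect E2 Z2 \<theta>) (IsomQ l)) \<and>
     (\<exists>\<rho>\<in>carrier E2 - carrier SE2. \<exists>\<theta>\<in>hom (Z2 \<times>\<times> Z2) (AutoGroup SE2).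
        (\<lambda>(g, j, k). act l g \<otimes>\<^bsub>IsomQ l\<^esub> act l \<rho> [^]\<^bsub>IsomQ l\<^esub> j \<otimes>\<^bsub>IsomQ l\<^esub> Phi l [^]\<^bsub>IsomQ l\<^esub> k)
          \<in> iso (semidirect SE2 (Z2 \<times>\<times> Z2) \<theta>) (IsomQ l)) \<and>
     connected_component_of_set (compact_open (Q l) (carrier (IsomQ l))) \<one>\<^bsub>IsomQ l\<^esub>
       = act l ` carrier SE2 \<and>
     transitive_action SE2 (Q l) (act l) \<and>
     (\<forall>q\<in>Q l. stabilizer SE2 (act l) q = {\<one>\<^bsub>SE2\<^esub>}) \<and>
     (\<forall>q\<in>Q l. \<exists>S. sub_riemannian 2 S \<and> left_invariant S \<and>
        sr_isometry S (bicycle l) (\<lambda>p. act l (rigid p) q))"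
proof -
  note l = assms
  have \<rho>: "flip \<in> carrier E2 - carrier SE2" using flip_in_E2 flip_notin_SE2 by blast
  obtain \<psi> where \<psi>: "group_extension Z2 (IsomQ l) E2 (\<lambda>k. Phi l [^]\<^bsub>IsomQ l\<^esub> k) (\<lambda>x. fst (\<psi> x))"
    "group_extension E2 (IsomQ l) Z2 (act l) (\<lambda>x. snd (\<psi> x))"
    "\<forall>g\<in>carrier E2. \<forall>k\<in>carrier Z2. \<psi> (iso_map l (g, k)) = (g, k)"
    using extensions[OF l] by blast
  have \<psi>_act: "\<forall>g\<in>carrier E2. fst (\<psi> (act l g)) = g"
    using \<psi>(3) by (simp add: act_eq_iso_map)
  have \<psi>_Phi: "snd (\<psi> (Phi l)) = 1"
    using \<psi>(3) id_in_E2 by (simp add: Phi_eq_iso_map)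
  have orbit: "\<exists>S. sub_riemannian 2 S \<and> left_invariant S \<and> sr_isometry S (bicycle l) (\<lambda>p. act l (rigid p) q)"
    if q: "q \<in> Q l" for q
  proof (intro exI conjI)
    show "sub_riemannian 2 (pulled_back l q)" by (rule sub_riemannian_pulled_back[OF l q])
    show "left_invariant (pulled_back l q)" by (rule left_invariant_pulled_back[OF l q])
    show "sr_isometry (pulled_back l q) (bicycle l) (\<lambda>p. act l (rigid p) q)"
      using q by (intro orbit_map_isometry[OF l q]) (cases q, simp add: act_def orbit_map_def)
  qed
  have split_E2: "\<exists>\<theta>\<in>hom Z2 (AutoGroup E2). (\<lambda>(g, k). act l g \<otimes>\<^bsub>IsomQ l\<^esub> Phi l [^]\<^bsub>IsomQ l\<^esub> k)
      \<in> iso (semidirect E2 Z2 \<theta>) (IsomQ l)"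
    by (rule bexI, rule semidirect_E2(2)[OF l], rule semidirect_E2(1)[OF l])
  have split_SE2: "\<exists>\<rho>\<in>carrier E2 - carrier SE2. \<exists>\<theta>\<in>hom (Z2 \<times>\<times> Z2) (AutoGroup SE2).
      (\<lambda>(g, j, k). act l g \<otimes>\<^bsub>IsomQ l\<^esub> act l \<rho> [^]\<^bsub>IsomQ l\<^esub> j \<otimes>\<^bsub>IsomQ l\<^esub> Phi l [^]\<^bsub>IsomQ l\<^esub> k)
        \<in> iso (semidirect SE2 (Z2 \<times>\<times> Z2) \<theta>) (IsomQ l)"
    using \<rho> flip_conj_hom semidirect_SE2[OF l] by blast
  show ?thesis
    by (intro conjI group_IsomQ[OF l] Phi_closed[OF l] Phi_involution[OF l] card_generate_Phi[OF l]
        exI[of _ "\<lambda>x. fst (\<psi> x)"] exI[of _ "\<lambda>x. snd (\<psi> x)"] \<psi>(1,2) \<psi>_act \<psi>_Phi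
        split_E2 split_SE2
        identity_component[OF l] act_transitive[OF l] ballI act_free[OF l] orbit)
qed

end
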